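(* In the setting described in the context (with prior $\mathbb P(\theta=1)=\pi$, optimal constant control $u^*$, boundary $A^*\in(0,1/2)$, stopping time $\tau^*$ and decision $d^*=h(\Pi^{u^*}(\tau^* ))$), fix $A^*<\pi<1-A^*$. The conditional distribution of $d^*\in\{h(A^* ),h(1-A^* )\}$ is characterized by $$\mathbb P(d^*=h(1-A^* )\mid\theta=1)=\frac{(1-A^* )(\pi-A^* )}{(1-2A^* )\pi},\qquad \mathbb P(d^*=h(1-A^* )\mid\theta=0)=\frac{A^*(\pi-A^* )}{(1-2A^* )(1-\pi)}.$$ The conditional means of $\tau^*$ are $$\mathbb E[\tau^*\mid\theta=1]=\frac{2}{(u^* )^2}\left[2\ln\left(\frac{1-A^*}{A^*}\right)\frac{(1-A^* )(\pi-A^* )}{(1-2A^* )\pi}-\ln\left(\frac{(1-A^* )\pi}{A^*(1-\pi)}\right)\right],$$ $$\mathbb E[\tau^*\mid\theta=0]=\frac{2}{(u^* )^2}\left[\ln\left(\frac{(1-A^* )\pi}{A^*(1-\pi)}\right)-2\ln\left(\frac{1-A^*}{A^*}\right)\frac{A^*(\pi-A^* )}{(1-2A^* )(1-\pi)}\right].$$ Write $R:=\frac{1-A^*}{A^*}$ and $r:=\frac{\pi}{1-\pi}$. For $\alpha>0$, with $\beta:=\sqrt{\frac{2\alpha}{(u^* )^2}+\frac14}$, the Laplace transforms of the conditional laws of $\tau^*$ are $$\mathbb E[e^{-\alpha\tau^*}\mid\theta=1]=\frac{\left[R^{\beta-\frac12}-R^{-\beta+\frac12}\right]r^{-\beta-\frac12}+\left[R^{\beta+\frac12}-R^{-\beta-\frac12}\right]r^{\beta-\frac12}}{R^{2\beta}-R^{-2\beta}},$$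 $$\mathbb E[e^{-\alpha\tau^*}\mid\theta=0]=\frac{\left[R^{\beta+\frac12}-R^{-\beta-\frac12}\right]r^{-\beta+\frac12}+\left[R^{\beta-\frac12}-R^{-\beta+\frac12}\right]r^{\beta+\frac12}}{R^{2\beta}-R^{-2\beta}}.$$ As a consequence, the conditional laws of $\tau^*$ have densities on $t>0$ given by $$\mathbb P(\tau^*\in dt\mid\theta=1)=e^{-\frac{(u^* )^2t}{8}}\Bigg[\sqrt{\frac{A^*(1-\pi)}{(1-A^* )\pi}}\sum_{k=-\infty}^{\infty}\frac{\ln(rR^{4k+1})}{\sqrt{2\boldsymbol{\pi}}\,|u^*|\,t^{3/2}}e^{-\frac{(\ln(rR^{4k+1}))^2}{2(u^* )^2t}}+\sqrt{\frac{(1-A^* )(1-\pi)}{A^*\pi}}\sum_{k=-\infty}^{\infty}\frac{\ln(r^{-1}R^{4k+1})}{\sqrt{2\boldsymbol{\pi}}\,|u^*|\,t^{3/2}}e^{-\frac{(\ln(r^{-1}R^{4k+1}))^2}{2(u^* )^2t}}\Bigg]dt,$$ $$\mathbb P(\tau^*\in dt\mid\theta=0)=e^{-\frac{(u^* )^2t}{8}}\Bigg[\sqrt{\frac{(1-A^* )\pi}{A^*(1-\pi)}}\sum_{k=-\infty}^{\infty}\frac{\ln(rR^{4k+1})}{\sqrt{2\boldsymbol{\pi}}\,|u^*|\,t^{3/2}}e^{-\frac{(\ln(rR^{4k+1}))^2}{2(u^* )^2t}}+\sqrt{\frac{A^*\pi}{(1-A^* )(1-\pi)}}\sum_{k=-\infty}^{\infty}\frac{\ln(r^{-1}R^{4k+1})}{\sqrt{2\boldsymbol{\pi}}\,|u^*|\,t^{3/2}}e^{-\frac{(\ln(r^{-1}R^{4k+1}))^2}{2(u^*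 )^2t}}\Bigg]dt.$$ Here $\boldsymbol{\pi}=3.14159\ldots$ is the mathematical constant, not the prior parameter $\pi$.
   Context: Probabilistic setting: $(\Omega,\mathcal F,\mathbb F,\mathbb P)$ is a filtered probability space satisfying the usual conditions, supporting a Bernoulli random variable $\theta$ with $\mathbb P(\theta=1)=\pi=1-\mathbb P(\theta=0)$, $0<\pi<1$, and an independent standard $(\mathbb P,\mathbb F)$-Brownian motion $W$. For the constant control $u^*$, the observation process is $X^{u^*}(t)=\theta u^*t+W(t)$, and $\Pi^{u^*}(t):=\mathbb P(\theta=1\mid\mathcal F^{X^{u^*}}(t))$ is the (continuous) posterior probability process, where $(\mathcal F^{X^{u^*}}(t))_{t\ge0}$ is the usual augmentation of the filtration generated by $X^{u^*}$. Problem data: $\mathcal U\subseteq\mathbb R\setminus\{0\}$ is non-empty and measurable, $\varphi:\mathcal U\to\mathbb R$ is measurable, $c>0$, $\eta(u):=\frac{\varphi(u)+c}{u^2}$, and $M:=\inf_{u\in\mathcal U}\eta(u)$. It is assumed that the infimum is attained at $u^*\in\mathcal U$ and that $M>0$. Loss and decision rule: $\mathcal D\subseteq[0,1]$ is compact; $\mathfrak L:\{0,1\}\times[0,1]\to[0,\infty)$ is a loss function with $\mathfrak L(x,y)=0$ iff $x=y$ and $d\mapsto\mathfrak L(x,d)$ continuous on $\mathcal D$ for $x\in\{0,1\}$; $f(\pi,d):=\mathfrak L(1,d)\pi+\mathfrak L(0,d)(1-\pi)$; $h$ is a measurable function with $h(\pi)\in\arg\min_{d\in\mathcal D}f(\pi,d)$;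 and $g(\pi):=f(\pi,h(\pi))=\min_{d\in\mathcal D}f(\pi,d)$. It is assumed that $g:[0,1]\to[0,\infty)$ is symmetric about $1/2$, concave, with $g(0)=g(1)=0$, and either (a) $g(\pi)=\kappa(\pi\wedge(1-\pi))$ for some constant $\kappa>0$, or (b) $g\in C^2((0,1))$ and $\pi\mapsto\pi^2(1-\pi)^2g''(\pi)$ is strictly decreasing on $(0,1/2)$ and strictly increasing on $(1/2,1)$. Boundary and optimal rule: with $\Psi(\pi):=(1-2\pi)\ln\left(\frac{\pi}{1-\pi}\right)$, $A^*$ is the smallest solution in $(0,1/2]$ of $g'(\pi)=2M\Psi'(\pi)$, and it is assumed that $(A^*,1-A^* )\neq\emptyset$, i.e. $A^*<1/2$. The optimal stopping time is $\tau^*:=\inf\{t\ge0:\Pi^{u^*}(t)\notin(A^*,1-A^* )\}$ and the optimal decision is $d^*:=h(\Pi^{u^*}(\tau^* ))$. *)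

theory Defs
  imports "HOL-Probability.Probability"
begin

section \<open>Filtrations, Brownian motion, posterior process\<close>

text \<open>Processes and filtrations are indexed by \<^typ>\<open>real\<close>, but only indices \<open>t \<ge> 0\<close> matter;
  what happens at negative indices is never constrained nor used.\<close>

definition usual_filtration :: "'a measure \<Rightarrow> (real \<Rightarrow> 'a measure) \<Rightarrow> bool" where
  "usual_filtration P F \<longleftrightarrow>
     complete_measure P \<and>
     (\<forall>t\<ge>0. subalgebra P (F t)) \<and>
     (\<forall>s t. 0 \<le> s \<longrightarrow> s \<le> t \<longrightarrow> sets (F s) \<subseteq> sets (F t)) \<and>
     null_sets P \<subseteq> sets (F 0) \<and>
     (\<forall>t\<ge>0. sets (F t) = (\<Inter>s\<in>{t<..}. sets (F s)))"

definition standard_brownian_motion ::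
  "'a measure \<Rightarrow> (real \<Rightarrow> 'a measure) \<Rightarrow> (real \<Rightarrow> 'a \<Rightarrow> real) \<Rightarrow> bool" where
  "standard_brownian_motion P F W \<longleftrightarrow>
     (\<forall>t\<ge>0. W t \<in> borel_measurable (F t)) \<and>
     (AE \<omega> in P. W 0 \<omega> = 0) \<and>
     (AE \<omega> in P. continuous_on {0..} (\<lambda>t. W t \<omega>)) \<and>
     (\<forall>s t. 0 \<le> s \<longrightarrow> s < t \<longrightarrow>
        distributed P lborel (\<lambda>\<omega>. W t \<omega> - W s \<omega>) (\<lambda>x. ennreal (normal_density 0 (sqrt (t - s)) x)) \<and>
        prob_space.indep_set P (sets (F s))
          (sets (vimage_algebra (space P) (\<lambda>\<omega>. W t \<omega> - W s \<omega>) borel)))"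

definition natural_filtration :: "'a measure \<Rightarrow> (real \<Rightarrow> 'a \<Rightarrow> real) \<Rightarrow> real \<Rightarrow> 'a measure" where
  "natural_filtration P X t =
     sigma (space P) (\<Union>s\<in>{0..t}. {X s -` B \<inter> space P | B. B \<in> sets borel})"

text \<open>Usual augmentation: adjoin all null sets, then pass to the right limit. (The family of
  \<open>\<sigma>\<close>-algebras under the intersection is increasing; the intersection is itself a \<open>\<sigma>\<close>-algebra.)\<close>

definition augmented_filtration :: "'a measure \<Rightarrow> (real \<Rightarrow> 'a \<Rightarrow> real) \<Rightarrow> real \<Rightarrow> 'a measure" where
  "augmented_filtration P X t =
     sigma (space P)
       (\<Inter>s\<in>{t<..}. sets (sigma (space P) (sets (natural_filtration P X s) \<union> null_sets P)))"

text \<open>The continuous version of \<open>t \<mapsto> P(\<theta> = 1 | F\<^sup>X(t))\<close>; it is determined up to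
  indistinguishability.\<close>

definition posterior_process ::
  "'a measure \<Rightarrow> ('a \<Rightarrow> real) \<Rightarrow> (real \<Rightarrow> 'a \<Rightarrow> real) \<Rightarrow> (real \<Rightarrow> 'a \<Rightarrow> real) \<Rightarrow> bool" where
  "posterior_process P \<theta> X post \<longleftrightarrow>
     (\<forall>t\<ge>0. post t \<in> borel_measurable (augmented_filtration P X t) \<and>
        (AE \<omega> in P. post t \<omega> =
           real_cond_exp P (augmented_filtration P X t) (indicator {\<omega> \<in> space P. \<theta> \<omega> = 1}) \<omega>)) \<and>
     (AE \<omega> in P. continuous_on {0..} (\<lambda>t. post t \<omega>))"


section \<open>Loss and boundary\<close>

definition expected_loss :: "(real \<Rightarrow> real \<Rightarrow> real) \<Rightarrow> real \<Rightarrow> real \<Rightarrow> real" where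
  "expected_loss L p d = L 1 d * p + L 0 d * (1 - p)"

definition C2_on :: "real set \<Rightarrow> (real \<Rightarrow> real) \<Rightarrow> bool" where
  "C2_on S g \<longleftrightarrow>
     (\<forall>x\<in>S. g field_differentiable (at x)) \<and>
     (\<forall>x\<in>S. deriv g field_differentiable (at x)) \<and>
     continuous_on S (deriv (deriv g))"

definition Psi :: "real \<Rightarrow> real" where
  "Psi p = (1 - 2 * p) * ln (p / (1 - p))"

text \<open>Solutions in \<open>(0,1/2]\<close> of \<open>g' = 2 m Psi'\<close>; a point where \<open>g\<close> is not
  differentiable (such as \<open>1/2\<close> for \<open>g(p) = \<kappa> min p (1-p)\<close>) is not a solution.\<close>

definition boundary_solutions :: "(real \<Rightarrow> real) \<Rightarrow> real \<Rightarrow> real set" where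
  "boundary_solutions g m =
     {x \<in> {0<..1/2}. (g has_real_derivative 2 * m * deriv Psi x) (at x)}"


section \<open>Stopping time, decision, conditional law\<close>

text \<open>The infimum of the empty set is \<open>\<infinity>\<close>.\<close>

definition exit_time :: "(real \<Rightarrow> 'a \<Rightarrow> real) \<Rightarrow> real \<Rightarrow> 'a \<Rightarrow> ennreal" where
  "exit_time post A \<omega> = (INF t\<in>{t. 0 \<le> t \<and> post t \<omega> \<notin> {A<..<1 - A}}. ennreal t)"

text \<open>On the event \<open>exit_time = \<infinity>\<close> the decision is, by convention, the one made at time \<open>0\<close>.\<close>

definition decision :: "(real \<Rightarrow> real) \<Rightarrow> (real \<Rightarrow> 'a \<Rightarrow> real) \<Rightarrow> real \<Rightarrow> 'a \<Rightarrow> real" where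
  "decision h post A \<omega> = h (post (enn2real (exit_time post A \<omega>)) \<omega>)"

definition given :: "'a measure \<Rightarrow> ('a \<Rightarrow> real) \<Rightarrow> real \<Rightarrow> 'a measure" where
  "given P \<theta> i = uniform_measure P {\<omega> \<in> space P. \<theta> \<omega> = i}"

text \<open>\<open>exp (- \<alpha> T)\<close> for \<open>\<alpha> > 0\<close> and an extended nonnegative \<open>T\<close>, with \<open>exp (- \<infinity>) = 0\<close>.\<close>

definition exp_neg :: "real \<Rightarrow> ennreal \<Rightarrow> real" where
  "exp_neg \<alpha> T = (if T = \<infinity> then 0 else exp (- \<alpha> * enn2real T))"

text \<open>The (finite) mean of an extended nonnegative variable. Nonnegativity of \<open>m\<close> is required
  because \<^const>\<open>ennreal\<close> truncates negative values.\<close>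

definition has_mean :: "'a measure \<Rightarrow> ('a \<Rightarrow> ennreal) \<Rightarrow> real \<Rightarrow> bool" where
  "has_mean N T m \<longleftrightarrow> T \<in> borel_measurable N \<and> 0 \<le> m \<and> (\<integral>\<^sup>+ \<omega>. T \<omega> \<partial>N) = ennreal m"

definition image_series :: "real \<Rightarrow> real \<Rightarrow> real \<Rightarrow> real \<Rightarrow> real" where
  "image_series u R x t =
     (\<Sum>\<^sub>\<infinity>k\<in>(UNIV::int set).
        ln (x * R powi (4 * k + 1)) / (sqrt (2 * pi) * \<bar>u\<bar> * t powr (3/2)) *
        exp (- ((ln (x * R powi (4 * k + 1)))\<^sup>2 / (2 * u\<^sup>2 * t))))"

text \<open>The (possibly infinite) nonnegative variable \<open>T\<close> is a.s. finite and has, under \<open>N\<close>, a law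
  concentrated on \<open>(0,\<infinity>)\<close> with Lebesgue density \<open>f\<close>. Nonnegativity of \<open>f\<close> is required
  separately for the same reason as above.\<close>

definition has_density_on_pos :: "'a measure \<Rightarrow> ('a \<Rightarrow> ennreal) \<Rightarrow> (real \<Rightarrow> real) \<Rightarrow> bool" where
  "has_density_on_pos N T f \<longleftrightarrow>
     (AE \<omega> in N. T \<omega> < \<infinity>) \<and>
     (AE t in lborel. 0 < t \<longrightarrow> 0 \<le> f t) \<and>
     distributed N lborel (\<lambda>\<omega>. enn2real (T \<omega>)) (\<lambda>t. ennreal (f t) * indicator {0<..} t)"

end

theory Submission
  imports Defs
begin

text \<open>
  Bayes' formula, with the likelihood ratio \<open>exp (u X\<^sub>t - u\<^sup>2 t / 2)\<close> of the Girsanov theorem, shows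
  that the log-odds of the posterior are \<open>L\<^sub>t = ln r + u X\<^sub>t - u\<^sup>2 t / 2\<close>. Given \<open>\<theta>\<close>, this is a Brownian
  motion with volatility \<open>u\<close> and drift \<open>\<epsilon> u\<^sup>2 / 2\<close>, where \<open>\<epsilon> = 1\<close> if \<open>\<theta> = 1\<close> and \<open>\<epsilon> = - 1\<close> if \<open>\<theta> = 0\<close>,
  and the stopping time is its exit time from \<open>(- ln R, ln R)\<close>. Optional stopping of
  \<open>exp (\<delta> L\<^sub>t - \<alpha> t)\<close> for the two roots \<open>\<delta> = - \<epsilon> / 2 \<plusminus> \<beta>\<close> gives two linear equations for the transforms
  of the exit time on the two exit events. Letting \<open>\<alpha>\<close> tend to \<open>0\<close> yields the exit probabilities and
  the mean. The density is identified by uniqueness of Laplace transforms: the terms of the image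
  series are signed first passage densities, whose transforms form a geometric series.
\<close>

section \<open>Exit times of continuous paths\<close>

text \<open>Two obstacles shape the argument. The hypotheses on \<open>W\<close> and
  \<open>post\<close> hold only almost surely, whereas stopping arguments want every path; so
  \<open>W\<close> is replaced by a modification with all paths continuous, and completeness of
  \<open>P\<close> carries the results back to \<tau> and d. Moreover, finiteness of the exit time
  is not known in advance. Paths that never leave the interval are therefore kept, with exp (-
  \<infinity>) read as 0: for \<alpha> > 0 they contribute nothing to the limit of the stopped
  martingales. One difference quotient at \<delta> = 0 later yields finiteness and mean together.
  Conditioning on \<theta> is harmless: \<theta> is independent of \<open>W\<close>, which therefore
  stays a Brownian motion for its own filtration under either conditional measure, and one locale
  serves both signs of \<epsilon>. The change of measure is used only on bounded horizons, inside
  Bayes' formula, where two path laws are compared on cylinder sets. The image series has terms of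
  both signs, so nonnegativity of the density has to come out of the uniqueness argument instead of
  entering it.\<close>

definition exit_of :: "real \<Rightarrow> (real \<Rightarrow> real) \<Rightarrow> ennreal" where
  "exit_of b f = (INF t\<in>{t. 0 \<le> t \<and> f t \<notin> {- b<..<b}}. ennreal t)"

text \<open>The times outside the open interval form a closed set, so the infimum is attained;
  continuity from the left then puts the exit value exactly on the boundary. The hypothesis on
  \<open>f 0\<close> excludes an exit at time 0.\<close>

lemma exit_of_cases:
  assumes f: "continuous_on {0..} f" and f0: "\<bar>f 0\<bar> < b"
  obtains (never) "exit_of b f = \<infinity>" "\<And>t. 0 \<le> t \<Longrightarrow> \<bar>f t\<bar> < b"
  | (exit) t where "0 < t" "exit_of b f = ennreal t" "\<bar>f t\<bar> = b" "\<And>s. 0 \<le> s \<Longrightarrow> s < t \<Longrightarrow> \<bar>f s\<bar> < b"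
proof (cases "\<exists>t\<ge>0. f t \<notin> {- b<..<b}")
  case False
  then have "{t. 0 \<le> t \<and> f t \<notin> {- b<..<b}} = {}" by blast
  then have "exit_of b f = \<infinity>" unfolding exit_of_def by simp
  moreover have "\<bar>f t\<bar> < b" if "0 \<le> t" for t
    using False that by (auto simp: abs_less_iff)
  ultimately show ?thesis by (rule never)
next
  case True
  define S where "S = {t. 0 \<le> t \<and> f t \<notin> {- b<..<b}}"
  have S_eq: "S = {0..} \<inter> f -` (- {- b<..<b})"
    by (auto simp: S_def)
  have "closed S"
    unfolding S_eq by (rule continuous_closed_preimage[OF f]) (auto simp: closed_def)
  moreover have "S \<noteq> {}" using True by (auto simp: S_def)
  moreover have bdd: "bdd_below S" by (rule bdd_belowI[of _ 0]) (simp add: S_def)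
  ultimately have InfS: "Inf S \<in> S"
    by (intro closed_contains_Inf)
  define t where "t = Inf S"
  have t: "0 \<le> t" "f t \<notin> {- b<..<b}" using InfS by (auto simp: S_def t_def)
  have "t \<noteq> 0" using t f0 by auto
  with t have t0: "0 < t" by simp
  have less: "\<bar>f s\<bar> < b" if "0 \<le> s" "s < t" for s
  proof (rule ccontr)
    assume "\<not> \<bar>f s\<bar> < b"
    then have "s \<in> S" using that by (auto simp: S_def)
    then have "t \<le> s" unfolding t_def using bdd by (rule cInf_lower)
    with that show False by simp
  qed
  \<comment> \<open>Limit from the left, along times at which the path is still inside;
    \<open>0 < t\<close> keeps the one-sided filter nontrivial.\<close>
  have "\<bar>f t\<bar> \<le> b"
  proof (rule tendsto_le[of "at t within {0..<t}"])
    show "at t within {0..<t} \<noteq> bot"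
      using t0 by (simp add: at_within_eq_bot_iff)
    show "((\<lambda>_. b) \<longlongrightarrow> b) (at t within {0..<t})" by simp
    have "continuous (at t within {0..}) f" using f t by (simp add: continuous_on_eq_continuous_within)
    then have "(f \<longlongrightarrow> f t) (at t within {0..<t})"
      unfolding continuous_within by (rule tendsto_within_subset) auto
    then show "((\<lambda>s. \<bar>f s\<bar>) \<longlongrightarrow> \<bar>f t\<bar>) (at t within {0..<t})" by (rule tendsto_rabs)
    show "\<forall>\<^sub>F s in at t within {0..<t}. \<bar>f s\<bar> \<le> b"
      using less by (auto simp: eventually_at_filter intro!: always_eventually less_imp_le)
  qed
  with t have "\<bar>f t\<bar> = b" by auto
  moreover have "exit_of b f = ennreal t"
    unfolding exit_of_def S_def[symmetric]
  proof (rule antisym)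
    show "(INF t\<in>S. ennreal t) \<le> ennreal t" using InfS by (auto simp: t_def intro: INF_lower)
    show "ennreal t \<le> (INF t\<in>S. ennreal t)"
      using bdd by (auto simp: t_def intro!: INF_greatest ennreal_leI cInf_lower)
  qed
  ultimately show ?thesis using exit t0 less by blast
qed

lemma less_exit_of_iff:
  assumes f: "continuous_on {0..} f" and f0: "\<bar>f 0\<bar> < b" and t: "0 \<le> t"
  shows "ennreal t < exit_of b f \<longleftrightarrow> (\<forall>s\<in>{0..t}. \<bar>f s\<bar> < b)"
proof (cases rule: exit_of_cases[OF f f0])
  case 1
  then show ?thesis by auto
next
  case (2 t')
  have "ennreal t < ennreal t' \<longleftrightarrow> t < t'" using 2 t by (intro ennreal_less_iff) auto
  moreover have "t < t' \<longleftrightarrow> (\<forall>s\<in>{0..t}. \<bar>f s\<bar> < b)"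
    using 2 t by (auto simp: not_less)
  ultimately show ?thesis using 2 by simp
qed

text \<open>Writes a condition on uncountably many times as a countable one. The margin 1 / (m + 1)
  is essential: strict inequality at rational points alone would allow the path to touch b in
  between, while compactness supplies a uniform margin. Scaling by t keeps the index set independent
  of t.\<close>

lemma all_abs_less_iff_rational:
  fixes f :: "real \<Rightarrow> real"
  assumes f: "continuous_on {0..} f" and t: "0 \<le> t"
  shows "(\<forall>s\<in>{0..t}. \<bar>f s\<bar> < b) \<longleftrightarrow> (\<exists>m::nat. \<forall>q\<in>\<rat> \<inter> {0..1}. \<bar>f (t * q)\<bar> \<le> b - 1 / Suc m)"
proof
  assume *: "\<forall>s\<in>{0..t}. \<bar>f s\<bar> < b"
  have "continuous_on {0..t} (\<lambda>s. \<bar>f s\<bar>)"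
    by (intro continuous_intros continuous_on_subset[OF f]) auto
  then have "\<exists>x\<in>{0..t}. \<forall>y\<in>{0..t}. \<bar>f y\<bar> \<le> \<bar>f x\<bar>"
    using t by (intro continuous_attains_sup) auto
  then obtain x where x: "x \<in> {0..t}" "\<And>y. y \<in> {0..t} \<Longrightarrow> \<bar>f y\<bar> \<le> \<bar>f x\<bar>"
    by blast
  then have "0 < b - \<bar>f x\<bar>" using * by auto
  then obtain m where m: "1 / real (Suc m) < b - \<bar>f x\<bar>"
    using nat_approx_posE by blast
  have "\<bar>f (t * q)\<bar> \<le> b - 1 / Suc m" if "q \<in> \<rat> \<inter> {0..1}" for q
  proof -
    have "t * q \<in> {0..t}" using that t by (auto simp: mult_left_le)
    then show ?thesis using x(2)[of "t * q"] m by linarith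
  qed
  then show "\<exists>m::nat. \<forall>q\<in>\<rat> \<inter> {0..1}. \<bar>f (t * q)\<bar> \<le> b - 1 / Suc m" by blast
next
  assume "\<exists>m::nat. \<forall>q\<in>\<rat> \<inter> {0..1}. \<bar>f (t * q)\<bar> \<le> b - 1 / Suc m"
  then obtain m :: nat where m: "\<And>q. q \<in> \<rat> \<inter> {0..1} \<Longrightarrow> \<bar>f (t * q)\<bar> \<le> b - 1 / Suc m" by blast
  have cont: "continuous_on {0..1} (\<lambda>q. \<bar>f (t * q)\<bar>)"
    using t by (intro continuous_intros continuous_on_compose2[OF f]) auto
  have dense: "{0..1} \<subseteq> closure (\<rat> \<inter> {0..1::real})"
  proof
    fix x :: real assume x: "x \<in> {0..1}"
    show "x \<in> closure (\<rat> \<inter> {0..1})"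
      unfolding closure_approachable
    proof (intro allI impI)
      fix e :: real assume e: "0 < e"
      have "max 0 (x - e) < min 1 (x + e) " using x e by auto
      then obtain q where "q \<in> \<rat>" "max 0 (x - e) < q" "q < min 1 (x + e)"
        using Rats_dense_in_real by blast
      then show "\<exists>y\<in>\<rat> \<inter> {0..1}. dist y x < e"
        by (intro bexI[of _ q]) (auto simp: dist_real_def)
    qed
  qed
  have "\<bar>f (t * q)\<bar> \<le> b - 1 / Suc m" if "q \<in> {0..1}" for q
  proof (rule continuous_le_on_closure[of "\<rat> \<inter> {0..1}" "\<lambda>q. \<bar>f (t * q)\<bar>"])
    have "closure (\<rat> \<inter> {0..1::real}) \<subseteq> {0..1}" by (intro closure_minimal) auto
    then show "continuous_on (closure (\<rat> \<inter> {0..1})) (\<lambda>q. \<bar>f (t * q)\<bar>)"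
      by (rule continuous_on_subset[OF cont])
    show "q \<in> closure (\<rat> \<inter> {0..1})" using dense that by blast
    show "\<bar>f (t * q)\<bar> \<le> b - 1 / Suc m" if "q \<in> \<rat> \<inter> {0..1}" for q using m that by blast
  qed
  moreover have "\<exists>q\<in>{0..1}. s = t * q" if "s \<in> {0..t}" for s
    using that by (cases "t = 0") (auto intro!: bexI[of _ "s / t"])
  moreover have "b - 1 / Suc m < b" by simp
  ultimately show "\<forall>s\<in>{0..t}. \<bar>f s\<bar> < b" by (metis order_le_less_trans)
qed

text \<open>A stopped value as a sum of increments that are switched on while \<open>i < m\<close>.
  The switch is decided at the left end point of each increment, which is what the martingale
  property needs.\<close>

lemma telescope_stop:
  fixes f :: "real \<Rightarrow> real" and K :: real
  assumes "0 < N"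
  defines "s \<equiv> \<lambda>i::nat. K * real i / real N"
  shows "f (s 0) + (\<Sum>i<N. if i < m then f (s (Suc i)) - f (s i) else 0) = f (s (min m N))"
proof -
  have "(\<Sum>i<N. if i < m then f (s (Suc i)) - f (s i) else 0) = (\<Sum>i<min m N. f (s (Suc i)) - f (s i))"
    by (rule sum.mono_neutral_cong_right) auto
  also have "\<dots> = f (s (min m N)) - f (s 0)" by (rule sum_lessThan_telescope)
  finally show ?thesis by simp
qed

section \<open>Brownian motion and optional stopping\<close>

text \<open>Completing the square: the exponential weight moves the mean from 0 to \<gamma> h. This
  is the one-dimensional form of Girsanov's formula.\<close>

lemma normal_density_exp_tilt:
  assumes "0 < h"
  shows "normal_density 0 (sqrt h) y * exp (\<gamma> * y - \<gamma>\<^sup>2 * h / 2) = normal_density 0 (sqrt h) (y - \<gamma> * h)"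
proof -
  have "- (y\<^sup>2 / (2 * h)) + (\<gamma> * y - \<gamma>\<^sup>2 * h / 2) = - ((y - \<gamma> * h)\<^sup>2 / (2 * h))"
    using assms by (simp add: field_simps power2_eq_square)
  then show ?thesis
    using assms by (simp add: normal_density_def mult_exp_exp)
qed

lemma nn_integral_normal_density_exp:
  assumes h: "0 < h"
  shows "(\<integral>\<^sup>+ y. ennreal (exp (\<gamma> * y - \<gamma>\<^sup>2 * h / 2)) * ennreal (normal_density 0 (sqrt h) y) \<partial>lborel) = 1"
proof -
  have "(\<integral>\<^sup>+ y. ennreal (exp (\<gamma> * y - \<gamma>\<^sup>2 * h / 2)) * ennreal (normal_density 0 (sqrt h) y) \<partial>lborel)
      = (\<integral>\<^sup>+ y. ennreal (normal_density (\<gamma> * h) (sqrt h) y) \<partial>lborel)"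
  proof (intro nn_integral_cong)
    fix y
    have "normal_density 0 (sqrt h) y * exp (\<gamma> * y - \<gamma>\<^sup>2 * h / 2) = normal_density (\<gamma> * h) (sqrt h) y"
      unfolding normal_density_exp_tilt[OF h] by (simp add: normal_density_def)
    then show "ennreal (exp (\<gamma> * y - \<gamma>\<^sup>2 * h / 2)) * ennreal (normal_density 0 (sqrt h) y)
        = ennreal (normal_density (\<gamma> * h) (sqrt h) y)"
      by (simp add: ennreal_mult'[symmetric] mult.commute)
  qed
  also have "\<dots> = 1"
  proof -
    interpret prob_space "density lborel (normal_density (\<gamma> * h) (sqrt h))"
      using h by (intro prob_space_normal_density) simp
    show ?thesis using emeasure_space_1 by (simp add: emeasure_density)
  qed
  finally show ?thesis .
qed

text \<open>Uniform integrability from the second-moment bound: truncating at level \<open>c\<close> costs at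
  most \<open>C / c\<close>.\<close>

lemma (in prob_space) integral_limit_of_L2_bounded:
  fixes Y :: "nat \<Rightarrow> 'a \<Rightarrow> real"
  assumes int: "\<And>n. integrable M (Y n)" "\<And>n. integral\<^sup>L M (Y n) = 1"
    and nonneg: "\<And>n \<omega>. 0 \<le> Y n \<omega>"
    and sq: "\<And>n. integrable M (\<lambda>\<omega>. (Y n \<omega>)\<^sup>2)" "\<And>n. integral\<^sup>L M (\<lambda>\<omega>. (Y n \<omega>)\<^sup>2) \<le> C"
    and lim: "\<And>\<omega>. \<omega> \<in> space M \<Longrightarrow> (\<lambda>n. Y n \<omega>) \<longlonglongrightarrow> Z \<omega>"
  shows "integrable M Z" "integral\<^sup>L M Z = 1"
proof -
  have [measurable]: "Y n \<in> borel_measurable M" for n using int(1) by auto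
  have Z_meas [measurable]: "Z \<in> borel_measurable M"
    by (rule borel_measurable_LIMSEQ_real[OF lim]) auto
  have Z_nonneg: "0 \<le> Z \<omega>" if "\<omega> \<in> space M" for \<omega>
    using lim[OF that] nonneg by (intro LIMSEQ_le_const) auto
  have "(\<integral>\<^sup>+ \<omega>. ennreal (Z \<omega>) \<partial>M) = (\<integral>\<^sup>+ \<omega>. liminf (\<lambda>n. ennreal (Y n \<omega>)) \<partial>M)"
    using lim by (intro nn_integral_cong) (auto intro!: lim_imp_Liminf[symmetric] tendsto_ennrealI)
  also have "\<dots> \<le> liminf (\<lambda>n. \<integral>\<^sup>+ \<omega>. ennreal (Y n \<omega>) \<partial>M)"
    by (rule nn_integral_liminf) auto
  also have "\<dots> = 1"
    using int nonneg by (simp add: nn_integral_eq_integral Liminf_const)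
  finally have le1: "(\<integral>\<^sup>+ \<omega>. ennreal (Z \<omega>) \<partial>M) \<le> 1" .
  then show intZ: "integrable M Z"
    using Z_nonneg by (intro integrableI_nonneg) (auto intro: le_less_trans)
  have upper: "integral\<^sup>L M Z \<le> 1"
    using le1 Z_nonneg by (subst (asm) nn_integral_eq_integral[OF intZ]) (auto)
  have "0 \<le> C" using sq(2)[of 0] by (rule order_trans[rotated]) simp
  have lower: "1 \<le> integral\<^sup>L M Z + C / c" if c: "0 < c" for c :: real
  proof -
    have "1 \<le> (\<integral> \<omega>. min (Y n \<omega>) c \<partial>M) + C / c" for n
    proof -
      have "1 = (\<integral> \<omega>. Y n \<omega> \<partial>M)" using int by simp
      also have "\<dots> \<le> (\<integral> \<omega>. min (Y n \<omega>) c + (Y n \<omega>)\<^sup>2 / c \<partial>M)"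
      proof (rule integral_mono)
        show "integrable M (\<lambda>\<omega>. min (Y n \<omega>) c + (Y n \<omega>)\<^sup>2 / c)"
          using sq int by (intro Bochner_Integration.integrable_add integrable_min) auto
        show "Y n \<omega> \<le> min (Y n \<omega>) c + (Y n \<omega>)\<^sup>2 / c" for \<omega>
        proof (cases "Y n \<omega> \<le> c")
          case False
          then have "Y n \<omega> * c \<le> Y n \<omega> * Y n \<omega>" using nonneg c by (intro mult_left_mono) auto
          then have "Y n \<omega> \<le> (Y n \<omega>)\<^sup>2 / c" using c by (simp add: pos_le_divide_eq power2_eq_square)
          then show ?thesis using False c by simp
        qed (use c in auto)
      qed (use int in auto)
      also have "\<dots> = (\<integral> \<omega>. min (Y n \<omega>) c \<partial>M) + (\<integral> \<omega>. (Y n \<omega>)\<^sup>2 \<partial>M) / c"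
        using sq int by (subst Bochner_Integration.integral_add) (auto intro!: integrable_min)
      also have "\<dots> \<le> (\<integral> \<omega>. min (Y n \<omega>) c \<partial>M) + C / c"
        using sq c by (auto intro!: divide_right_mono)
      finally show ?thesis .
    qed
    moreover have "(\<lambda>n. \<integral> \<omega>. min (Y n \<omega>) c \<partial>M) \<longlonglongrightarrow> (\<integral> \<omega>. min (Z \<omega>) c \<partial>M)"
      using nonneg c lim
      by (intro integral_dominated_convergence[where w="\<lambda>_. c"]) (auto intro!: tendsto_min)
    then have "(\<lambda>n. (\<integral> \<omega>. min (Y n \<omega>) c \<partial>M) + C / c) \<longlonglongrightarrow> (\<integral> \<omega>. min (Z \<omega>) c \<partial>M) + C / c"
      by (intro tendsto_intros)
    ultimately have "1 \<le> (\<integral> \<omega>. min (Z \<omega>) c \<partial>M) + C / c"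
      by (intro LIMSEQ_le_const) auto
    moreover have "(\<integral> \<omega>. min (Z \<omega>) c \<partial>M) \<le> integral\<^sup>L M Z"
      using intZ by (intro integral_mono integrable_min) auto
    ultimately show ?thesis by linarith
  qed
  have "1 \<le> integral\<^sup>L M Z"
  proof (rule ccontr)
    assume "\<not> 1 \<le> integral\<^sup>L M Z"
    then have pos: "0 < 1 - integral\<^sup>L M Z" by simp
    \<comment> \<open>Chosen so that C / c stays below the gap to 1. Taking C + 1 instead of C keeps
      c positive and the estimate strict even for C = 0.\<close>
    define c where "c = (C + 1) / (1 - integral\<^sup>L M Z)"
    have "0 < c" using pos \<open>0 \<le> C\<close> by (simp add: c_def)
    have "C / c = C / (C + 1) * (1 - integral\<^sup>L M Z)" by (simp add: c_def)
    also have "\<dots> < 1 * (1 - integral\<^sup>L M Z)"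
      using pos \<open>0 \<le> C\<close> by (intro mult_strict_right_mono) auto
    finally show False using lower[OF \<open>0 < c\<close>] by simp
  qed
  with upper show "integral\<^sup>L M Z = 1" by simp
qed

section \<open>Natural filtrations\<close>

lemma space_natural_filtration [simp]: "space (natural_filtration P X t) = space P"
  unfolding natural_filtration_def by (subst space_measure_of) auto

lemma sets_natural_filtration:
  "sets (natural_filtration P X t) =
    sigma_sets (space P) (\<Union>s\<in>{0..t}. {X s -` B \<inter> space P | B. B \<in> sets borel})"
  unfolding natural_filtration_def by (rule sets_measure_of) auto

lemma measurable_natural_filtration:
  assumes "0 \<le> s" "s \<le> t"
  shows "X s \<in> borel_measurable (natural_filtration P X t)"
proof (rule measurableI)
  fix B :: "real set" assume "B \<in> sets borel"
  then show "X s -` B \<inter> space (natural_filtration P X t) \<in> sets (natural_filtration P X t)"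
    unfolding space_natural_filtration sets_natural_filtration
    using assms by (intro sigma_sets.Basic UN_I[of s]) auto
qed auto

lemma sets_natural_filtration_le:
  assumes "space M = space P" "\<And>s. 0 \<le> s \<Longrightarrow> s \<le> t \<Longrightarrow> X s \<in> borel_measurable M"
  shows "sets (natural_filtration P X t) \<subseteq> sets M"
  unfolding sets_natural_filtration
proof (rule sets.sigma_sets_subset'[of _ M "space P", unfolded])
  show "(\<Union>s\<in>{0..t}. {X s -` B \<inter> space P |B. B \<in> sets borel}) \<subseteq> sets M"
    using assms by (auto simp flip: assms(1) intro!: measurable_sets)
  show "space P \<in> sets M" using sets.top[of M] assms(1) by simp
qed

text \<open>All path properties hold for every point of the space. Increments are independent of the
  filtration of \<open>W\<close> itself, a form that survives conditioning on an independent
  \<theta>. A single product formula encodes both independence and the normal law.\<close>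

locale brownian_motion = prob_space N for N :: "'a measure" +
  fixes W :: "real \<Rightarrow> 'a \<Rightarrow> real"
  assumes W_measurable [measurable]: "\<And>t. W t \<in> borel_measurable N"
    and W_zero: "\<And>\<omega>. \<omega> \<in> space N \<Longrightarrow> W 0 \<omega> = 0"
    and W_continuous: "\<And>\<omega>. \<omega> \<in> space N \<Longrightarrow> continuous_on {0..} (\<lambda>t. W t \<omega>)"
    and W_increment: "\<And>s t A B. 0 \<le> s \<Longrightarrow> s < t \<Longrightarrow> A \<in> sets (natural_filtration N W s) \<Longrightarrow>
      B \<in> sets borel \<Longrightarrow>
      emeasure N (A \<inter> ((\<lambda>\<omega>. W t \<omega> - W s \<omega>) -` B \<inter> space N)) =
      emeasure N A * emeasure (density lborel (normal_density 0 (sqrt (t - s)))) B"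
begin

abbreviation G :: "real \<Rightarrow> 'a measure" where "G \<equiv> natural_filtration N W"

lemma subalgebra_G: "subalgebra N (G s)"
  using sets_natural_filtration_le[of N N s W] by (simp add: subalgebra_def)

lemma G_sets_N: "A \<in> sets (G s) \<Longrightarrow> A \<in> sets N"
  using subalgebra_G[of s] by (auto simp: subalgebra_def)

lemma measurable_G [measurable (raw)]: "0 \<le> r \<Longrightarrow> r \<le> s \<Longrightarrow> W r \<in> borel_measurable (G s)"
  by (rule measurable_natural_filtration)

text \<open>Freezing the past: by \<open>W_increment\<close> the pair of \<omega> and the increment
  has a product law on rectangles, hence everywhere, and Tonelli integrates the increment first. The
  first factor carries only the \<sigma>-algebra \<open>G s\<close>, because the product formula is
  available for its events.\<close>

lemma nn_integral_increment:
  assumes st: "0 \<le> s" "s < t" and k [measurable]: "k \<in> borel_measurable (G s \<Otimes>\<^sub>M borel)"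
  shows "(\<integral>\<^sup>+ \<omega>. k (\<omega>, W t \<omega> - W s \<omega>) \<partial>N) =
    (\<integral>\<^sup>+ \<omega>. (\<integral>\<^sup>+ y. k (\<omega>, y) * ennreal (normal_density 0 (sqrt (t - s)) y) \<partial>lborel) \<partial>N)"
proof -
  let ?V = "density lborel (normal_density 0 (sqrt (t - s)))"
  let ?R = "restr_to_subalg N (G s)"
  interpret R: prob_space ?R by (rule prob_space_restr_to_subalg[OF subalgebra_G]) unfold_locales
  interpret V: prob_space ?V using st by (intro prob_space_normal_density) simp
  have id [measurable]: "(\<lambda>\<omega>. \<omega>) \<in> measurable N (G s)"
    by (rule measurable_from_subalg[OF subalgebra_G[of s]]) (rule measurable_ident_sets[OF refl])
  have sets_R [measurable_cong]: "sets ?R = sets (G s)" by (rule sets_restr_to_subalg[OF subalgebra_G])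
  have k' [measurable]: "k \<in> borel_measurable (?R \<Otimes>\<^sub>M ?V)"
    by (simp cong: measurable_cong_sets add: sets_R)
  have eq: "?R \<Otimes>\<^sub>M ?V = distr N (G s \<Otimes>\<^sub>M borel) (\<lambda>\<omega>. (\<omega>, W t \<omega> - W s \<omega>))"
  proof (rule pair_measure_eqI)
    show "sigma_finite_measure ?R" "sigma_finite_measure ?V" by unfold_locales
    show "sets (?R \<Otimes>\<^sub>M ?V) = sets (distr N (G s \<Otimes>\<^sub>M borel) (\<lambda>\<omega>. (\<omega>, W t \<omega> - W s \<omega>)))"
      by (simp, rule sets_pair_measure_cong) (simp_all add: sets_R)
    fix A B assume A: "A \<in> sets ?R" and B: "B \<in> sets ?V"
    have A': "A \<in> sets (G s)" using A by (simp add: sets_R)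
    have B': "B \<in> sets borel" using B by simp
    have "emeasure (distr N (G s \<Otimes>\<^sub>M borel) (\<lambda>\<omega>. (\<omega>, W t \<omega> - W s \<omega>))) (A \<times> B)
        = emeasure N ((\<lambda>\<omega>. (\<omega>, W t \<omega> - W s \<omega>)) -` (A \<times> B) \<inter> space N)"
      using A' B' by (intro emeasure_distr) auto
    also have "(\<lambda>\<omega>. (\<omega>, W t \<omega> - W s \<omega>)) -` (A \<times> B) \<inter> space N
        = A \<inter> ((\<lambda>\<omega>. W t \<omega> - W s \<omega>) -` B \<inter> space N)"
      by auto
    also have "emeasure N \<dots> = emeasure N A * emeasure ?V B"
      by (rule W_increment[OF st A' B'])
    also have "emeasure N A = emeasure ?R A"
      using emeasure_restr_to_subalg[OF subalgebra_G A'] by simp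
    finally show "emeasure ?R A * emeasure ?V B =
        emeasure (distr N (G s \<Otimes>\<^sub>M borel) (\<lambda>\<omega>. (\<omega>, W t \<omega> - W s \<omega>))) (A \<times> B)" by simp
  qed
  have "(\<integral>\<^sup>+ \<omega>. k (\<omega>, W t \<omega> - W s \<omega>) \<partial>N) = (\<integral>\<^sup>+ z. k z \<partial>(?R \<Otimes>\<^sub>M ?V))"
    unfolding eq by (subst nn_integral_distr) auto
  also have "\<dots> = (\<integral>\<^sup>+ \<omega>. (\<integral>\<^sup>+ y. k (\<omega>, y) \<partial>?V) \<partial>?R)"
    by (rule V.nn_integral_fst[symmetric]) fact
  also have "\<dots> = (\<integral>\<^sup>+ \<omega>. (\<integral>\<^sup>+ y. k (\<omega>, y) \<partial>?V) \<partial>N)"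
    using V.borel_measurable_nn_integral_fst[OF k']
    by (intro nn_integral_subalgebra2[OF subalgebra_G]) (simp cong: measurable_cong_sets add: sets_R)
  also have "\<dots> = (\<integral>\<^sup>+ \<omega>. (\<integral>\<^sup>+ y. k (\<omega>, y) * ennreal (normal_density 0 (sqrt (t - s)) y) \<partial>lborel) \<partial>N)"
  proof (rule nn_integral_cong)
    fix \<omega> assume "\<omega> \<in> space N"
    then have "\<omega> \<in> space (G s)" by simp
    then have [measurable]: "(\<lambda>y. k (\<omega>, y)) \<in> borel_measurable borel" by measurable
    show "(\<integral>\<^sup>+ y. k (\<omega>, y) \<partial>?V) = (\<integral>\<^sup>+ y. k (\<omega>, y) * ennreal (normal_density 0 (sqrt (t - s)) y) \<partial>lborel)"
      by (subst nn_integral_density) (auto simp: mult.commute)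
  qed
  finally show ?thesis .
qed

section \<open>The exponential martingale and optional stopping\<close>

definition expmart :: "real \<Rightarrow> real \<Rightarrow> 'a \<Rightarrow> real" where
  "expmart \<gamma> t \<omega> = exp (\<gamma> * W t \<omega> - \<gamma>\<^sup>2 * t / 2)"

lemma expmart_pos: "0 < expmart \<gamma> t \<omega>"
  by (simp add: expmart_def)

lemma expmart_measurable [measurable]: "expmart \<gamma> t \<in> borel_measurable N"
  unfolding expmart_def by measurable

text \<open>The martingale property. With nonnegative integrals it presupposes no integrability,
  which is instead deduced from the case of the whole space and s = 0.\<close>

lemma nn_integral_expmart_eq:
  assumes st: "0 \<le> s" "s \<le> t" and A [measurable]: "A \<in> sets (G s)"
  shows "(\<integral>\<^sup>+ \<omega>. ennreal (expmart \<gamma> t \<omega>) * indicator A \<omega> \<partial>N) = (\<integral>\<^sup>+ \<omega>. ennreal (expmart \<gamma> s \<omega>) * indicator A \<omega> \<partial>N)"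
proof (cases "s = t")
  case False
  with st have st': "s < t" by simp
  define k where "k = (\<lambda>(\<omega>, y). ennreal (expmart \<gamma> s \<omega>) * indicator A \<omega> * ennreal (exp (\<gamma> * y - \<gamma>\<^sup>2 * (t - s) / 2)))"
  have [measurable]: "W s \<in> borel_measurable (G s)" using st by (intro measurable_G) auto
  have k: "k \<in> borel_measurable (G s \<Otimes>\<^sub>M borel)"
    unfolding k_def expmart_def by measurable
  have "(\<integral>\<^sup>+ \<omega>. ennreal (expmart \<gamma> t \<omega>) * indicator A \<omega> \<partial>N) = (\<integral>\<^sup>+ \<omega>. k (\<omega>, W t \<omega> - W s \<omega>) \<partial>N)"
  proof (intro nn_integral_cong)
    fix \<omega>
    have "expmart \<gamma> t \<omega> = expmart \<gamma> s \<omega> * exp (\<gamma> * (W t \<omega> - W s \<omega>) - \<gamma>\<^sup>2 * (t - s) / 2)"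
      unfolding expmart_def mult_exp_exp by (simp add: field_simps)
    then show "ennreal (expmart \<gamma> t \<omega>) * indicator A \<omega> = k (\<omega>, W t \<omega> - W s \<omega>)"
      by (simp add: k_def ennreal_mult' less_imp_le[OF expmart_pos] mult_ac)
  qed
  also have "\<dots> = (\<integral>\<^sup>+ \<omega>. (\<integral>\<^sup>+ y. k (\<omega>, y) * ennreal (normal_density 0 (sqrt (t - s)) y) \<partial>lborel) \<partial>N)"
    by (rule nn_integral_increment[OF st(1) st' k])
  also have "\<dots> = (\<integral>\<^sup>+ \<omega>. ennreal (expmart \<gamma> s \<omega>) * indicator A \<omega> \<partial>N)"
  proof (intro nn_integral_cong)
    fix \<omega>
    show "(\<integral>\<^sup>+ y. k (\<omega>, y) * ennreal (normal_density 0 (sqrt (t - s)) y) \<partial>lborel) = ennreal (expmart \<gamma> s \<omega>) * indicator A \<omega>"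
      using st' by (simp add: k_def mult.assoc nn_integral_cmult nn_integral_normal_density_exp)
  qed
  finally show ?thesis .
qed simp

lemma nn_integral_expmart: "0 \<le> t \<Longrightarrow> (\<integral>\<^sup>+ \<omega>. ennreal (expmart \<gamma> t \<omega>) \<partial>N) = 1"
proof -
  assume t: "0 \<le> t"
  have "(\<integral>\<^sup>+ \<omega>. ennreal (expmart \<gamma> t \<omega>) \<partial>N) = (\<integral>\<^sup>+ \<omega>. ennreal (expmart \<gamma> t \<omega>) * indicator (space N) \<omega> \<partial>N)"
    by (intro nn_integral_cong) auto
  also have "\<dots> = (\<integral>\<^sup>+ \<omega>. ennreal (expmart \<gamma> 0 \<omega>) * indicator (space N) \<omega> \<partial>N)"
    using t sets.top[of "G 0"] by (intro nn_integral_expmart_eq) auto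
  also have "\<dots> = (\<integral>\<^sup>+ \<omega>. 1 \<partial>N)"
    by (intro nn_integral_cong) (auto simp: expmart_def W_zero)
  finally show ?thesis by (simp add: emeasure_space_1)
qed

lemma integrable_expmart: "0 \<le> t \<Longrightarrow> integrable N (expmart \<gamma> t)"
  using nn_integral_expmart[of t \<gamma>]
  by (intro integrableI_nonneg) (auto intro: less_imp_le expmart_pos)

lemma integral_expmart_increment:
  assumes "0 \<le> s" "s \<le> t" "A \<in> sets (G s)"
  shows "integrable N (\<lambda>\<omega>. indicator A \<omega> * (expmart \<gamma> t \<omega> - expmart \<gamma> s \<omega>))"
    and "(\<integral> \<omega>. indicator A \<omega> * (expmart \<gamma> t \<omega> - expmart \<gamma> s \<omega>) \<partial>N) = 0"
proof -
  have A: "A \<in> sets N" using assms by (auto intro: G_sets_N)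
  have int: "integrable N (\<lambda>\<omega>. indicator A \<omega> * expmart \<gamma> r \<omega>)" if "0 \<le> r" for r
    using integrable_mult_indicator[OF A integrable_expmart[OF that, of \<gamma>]] by simp
  have int': "integrable N (\<lambda>\<omega>. indicator A \<omega> * expmart \<gamma> s \<omega>)" "integrable N (\<lambda>\<omega>. indicator A \<omega> * expmart \<gamma> t \<omega>)"
    using assms by (auto intro: int)
  then show "integrable N (\<lambda>\<omega>. indicator A \<omega> * (expmart \<gamma> t \<omega> - expmart \<gamma> s \<omega>))"
    by (simp add: right_diff_distrib)
  have eq: "ennreal (\<integral> \<omega>. indicator A \<omega> * expmart \<gamma> r \<omega> \<partial>N) = (\<integral>\<^sup>+ \<omega>. ennreal (expmart \<gamma> r \<omega>) * indicator A \<omega> \<partial>N)"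
    if "0 \<le> r" for r
    using expmart_pos[of \<gamma> r]
    by (subst nn_integral_eq_integral[OF int[OF that], symmetric])
       (auto simp: ennreal_mult' mult.commute less_imp_le intro!: nn_integral_cong split: split_indicator)
  have "ennreal (\<integral> \<omega>. indicator A \<omega> * expmart \<gamma> t \<omega> \<partial>N) = ennreal (\<integral> \<omega>. indicator A \<omega> * expmart \<gamma> s \<omega> \<partial>N)"
    using assms nn_integral_expmart_eq[OF assms] by (simp add: eq)
  then have "(\<integral> \<omega>. indicator A \<omega> * expmart \<gamma> t \<omega> \<partial>N) = (\<integral> \<omega>. indicator A \<omega> * expmart \<gamma> s \<omega> \<partial>N)"
    by (subst (asm) ennreal_inj) (auto intro!: integral_nonneg_AE simp: less_imp_le[OF expmart_pos])
  then show "(\<integral> \<omega>. indicator A \<omega> * (expmart \<gamma> t \<omega> - expmart \<gamma> s \<omega>) \<partial>N) = 0"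
    using int' by (simp add: right_diff_distrib)
qed

text \<open>Since \<open>i < m\<close> is decided at the i-th grid point, every switched increment
  in \<open>telescope_stop\<close> has mean zero. The same telescoping shows that \<open>W\<close>
  at the random grid time is measurable.\<close>

lemma optional_stopping_grid:
  fixes m :: "'a \<Rightarrow> nat"
  assumes n: "0 < n" and K: "0 \<le> K"
    and m: "\<And>i. i < n \<Longrightarrow> {\<omega> \<in> space N. i < m \<omega>} \<in> sets (G (K * real i / real n))"
    and le: "\<And>\<omega>. m \<omega> \<le> n"
  shows "integrable N (\<lambda>\<omega>. expmart \<gamma> (K * real (m \<omega>) / real n) \<omega>)"
    and "(\<integral> \<omega>. expmart \<gamma> (K * real (m \<omega>) / real n) \<omega> \<partial>N) = 1"
    and "(\<lambda>\<omega>. W (K * real (m \<omega>) / real n) \<omega>) \<in> borel_measurable N"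
proof -
  let ?s = "\<lambda>i. K * real i / real n"
  let ?A = "\<lambda>i. {\<omega> \<in> space N. i < m \<omega>}"
  have A: "?A i \<in> sets N" if "i < n" for i using m[OF that] by (rule G_sets_N)
  have tele: "f (?s 0) \<omega> + (\<Sum>i<n. indicator (?A i) \<omega> * (f (?s (Suc i)) \<omega> - f (?s i) \<omega>)) = f (?s (m \<omega>)) \<omega>"
    if "\<omega> \<in> space N" for f :: "real \<Rightarrow> 'a \<Rightarrow> real" and \<omega>
  proof -
    have "(\<Sum>i<n. indicator (?A i) \<omega> * (f (?s (Suc i)) \<omega> - f (?s i) \<omega>)) =
        (\<Sum>i<n. if i < m \<omega> then f (?s (Suc i)) \<omega> - f (?s i) \<omega> else 0)"
      using that by (intro sum.cong) auto
    then show ?thesis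
      using telescope_stop[OF n, of "\<lambda>t. f t \<omega>" K "m \<omega>"] le[of \<omega>] by (simp add: min_absorb1)
  qed
  have mono: "0 \<le> ?s i" "?s i \<le> ?s (Suc i)" for i
    using K n by (auto intro!: divide_right_mono mult_left_mono)
  have "has_bochner_integral N (\<lambda>\<omega>. expmart \<gamma> (?s 0) \<omega> + (\<Sum>i<n. indicator (?A i) \<omega> * (expmart \<gamma> (?s (Suc i)) \<omega> - expmart \<gamma> (?s i) \<omega>)))
     (1 + (\<Sum>i<n. 0))"
  proof (intro has_bochner_integral_add has_bochner_integral_sum)
    show "has_bochner_integral N (expmart \<gamma> (?s 0)) 1"
      using nn_integral_expmart[of 0 \<gamma>]
      by (intro has_bochner_integral_nn_integral) (auto intro: less_imp_le expmart_pos)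
    fix i assume "i \<in> {..<n}"
    then show "has_bochner_integral N (\<lambda>\<omega>. indicator (?A i) \<omega> * (expmart \<gamma> (?s (Suc i)) \<omega> - expmart \<gamma> (?s i) \<omega>)) 0"
      using integral_expmart_increment[OF mono m] by (simp add: has_bochner_integral_iff)
  qed
  then have "has_bochner_integral N (\<lambda>\<omega>. expmart \<gamma> (?s (m \<omega>)) \<omega>) 1"
    by (subst (asm) has_bochner_integral_cong[OF refl tele refl]) auto
  then show "integrable N (\<lambda>\<omega>. expmart \<gamma> (?s (m \<omega>)) \<omega>)" "(\<integral> \<omega>. expmart \<gamma> (?s (m \<omega>)) \<omega> \<partial>N) = 1"
    by (auto simp: has_bochner_integral_iff)
  have "(\<lambda>\<omega>. W (?s 0) \<omega> + (\<Sum>i<n. indicator (?A i) \<omega> * (W (?s (Suc i)) \<omega> - W (?s i) \<omega>))) \<in> borel_measurable N"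
    using A by (intro borel_measurable_add borel_measurable_sum borel_measurable_times) auto
  then show "(\<lambda>\<omega>. W (?s (m \<omega>)) \<omega>) \<in> borel_measurable N"
    by (subst (asm) measurable_cong[OF tele]) auto
qed

text \<open>The stopping time is approximated from the right by the first grid point after it, so
  that no path property beyond continuity is needed.\<close>

lemma optional_stopping:
  fixes S :: "'a \<Rightarrow> real"
  assumes K: "0 < K" and S: "\<And>\<omega>. \<omega> \<in> space N \<Longrightarrow> 0 \<le> S \<omega> \<and> S \<omega> \<le> K"
    and stop: "\<And>t. 0 \<le> t \<Longrightarrow> {\<omega> \<in> space N. t < S \<omega>} \<in> sets (G t)"
  shows "integrable N (\<lambda>\<omega>. expmart \<gamma> (S \<omega>) \<omega>)"
    and "(\<integral> \<omega>. expmart \<gamma> (S \<omega>) \<omega> \<partial>N) = 1"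
    and "(\<lambda>\<omega>. W (S \<omega>) \<omega>) \<in> borel_measurable N"
proof -
  \<comment> \<open>Rounds S up to the grid: \<open>i < m n \<omega>\<close> says exactly that the
    i-th grid time lies strictly before S, the event supplied by \<open>stop\<close>. The value 0
    outside the space keeps the bound by n + 1 valid for every \<omega>.\<close>
  define m where "m n \<omega> = (if \<omega> \<in> space N then nat \<lceil>S \<omega> * real (Suc n) / K\<rceil> else 0)" for n \<omega>
  let ?\<sigma> = "\<lambda>n \<omega>. K * real (m n \<omega>) / real (Suc n)"
  have m_le: "m n \<omega> \<le> Suc n" for n \<omega>
  proof -
    have "S \<omega> * real (Suc n) / K \<le> real (Suc n)" if "\<omega> \<in> space N"
      using S[OF that] K by (simp add: divide_le_eq mult.commute mult_left_mono del: of_nat_Suc)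
    then have "\<lceil>S \<omega> * real (Suc n) / K\<rceil> \<le> int (Suc n)" if "\<omega> \<in> space N"
      using that by (subst ceiling_le_iff) (simp only: of_int_of_nat_eq)
    then show ?thesis by (simp add: m_def nat_le_iff del: of_nat_Suc)
  qed
  have m_set: "{\<omega> \<in> space N. i < m n \<omega>} \<in> sets (G (K * real i / real (Suc n)))" for i n
  proof -
    have "i < m n \<omega> \<longleftrightarrow> K * real i / real (Suc n) < S \<omega>" if "\<omega> \<in> space N" for \<omega>
    proof -
      have "i < m n \<omega> \<longleftrightarrow> real i < S \<omega> * real (Suc n) / K"
        using that S[OF that] K by (simp add: m_def zless_nat_eq_int_zless less_ceiling_iff del: of_nat_Suc)
      also have "\<dots> \<longleftrightarrow> K * real i / real (Suc n) < S \<omega>"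
        using K by (simp add: field_simps del: of_nat_Suc)
      finally show ?thesis .
    qed
    then have "{\<omega> \<in> space N. i < m n \<omega>} = {\<omega> \<in> space N. K * real i / real (Suc n) < S \<omega>}" by auto
    then show ?thesis using stop[of "K * real i / real (Suc n)"] K by simp
  qed
  note grid = optional_stopping_grid[OF zero_less_Suc less_imp_le[OF K] m_set m_le]
  have \<sigma>_nonneg: "0 \<le> ?\<sigma> n \<omega>" for n \<omega> using K by simp
  have \<sigma>_le: "?\<sigma> n \<omega> \<le> K" for n \<omega>
    using K m_le[of n \<omega>] by (simp add: divide_le_eq mult_left_mono del: of_nat_Suc)
  have \<sigma>_lim: "(\<lambda>n. ?\<sigma> n \<omega>) \<longlonglongrightarrow> S \<omega>" if \<omega>: "\<omega> \<in> space N" for \<omega>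
  proof (rule tendsto_sandwich[of "\<lambda>_. S \<omega>" _ _ "\<lambda>n. S \<omega> + K / real (Suc n)"])
    have "S \<omega> \<le> ?\<sigma> n \<omega> \<and> ?\<sigma> n \<omega> \<le> S \<omega> + K / real (Suc n)" for n
    proof -
      have nn: "0 \<le> S \<omega> * real (Suc n) / K" using S[OF \<omega>] K by simp
      have "real (m n \<omega>) = of_int \<lceil>S \<omega> * real (Suc n) / K\<rceil>"
        using \<omega> nn by (simp add: m_def del: of_nat_Suc)
      then have "S \<omega> * real (Suc n) / K \<le> real (m n \<omega>)" "real (m n \<omega>) \<le> S \<omega> * real (Suc n) / K + 1"
        by linarith+
      then show ?thesis using K by (simp add: field_simps del: of_nat_Suc)
    qed
    then show "\<forall>\<^sub>F n in sequentially. S \<omega> \<le> ?\<sigma> n \<omega>" "\<forall>\<^sub>F n in sequentially. ?\<sigma> n \<omega> \<le> S \<omega> + K / real (Suc n)"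
      by auto
    have "(\<lambda>n. S \<omega> + K * (1 / real (Suc n))) \<longlonglongrightarrow> S \<omega> + K * 0"
      by (intro tendsto_intros LIMSEQ_Suc[OF lim_1_over_n])
    then show "(\<lambda>n. S \<omega> + K / real (Suc n)) \<longlonglongrightarrow> S \<omega>" by simp
  qed simp
  have W_lim: "(\<lambda>n. W (?\<sigma> n \<omega>) \<omega>) \<longlonglongrightarrow> W (S \<omega>) \<omega>" if \<omega>: "\<omega> \<in> space N" for \<omega>
    by (rule continuous_on_tendsto_compose[OF W_continuous[OF \<omega>] \<sigma>_lim[OF \<omega>]])
       (use S[OF \<omega>] \<sigma>_nonneg in auto)
  have "integrable N (\<lambda>\<omega>. (expmart \<gamma> (?\<sigma> n \<omega>) \<omega>)\<^sup>2) \<and> integral\<^sup>L N (\<lambda>\<omega>. (expmart \<gamma> (?\<sigma> n \<omega>) \<omega>)\<^sup>2) \<le> exp (\<gamma>\<^sup>2 * K)" for n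
  proof -
    \<comment> \<open>Squaring doubles \<gamma> up to the factor exp (\<gamma>^2 t), bounded by exp
      (\<gamma>^2 K). Stopping on the grid with 2 \<gamma> therefore bounds the second moments
      uniformly in n.\<close>
    have sq: "(expmart \<gamma> t \<omega>)\<^sup>2 = expmart (2 * \<gamma>) t \<omega> * exp (\<gamma>\<^sup>2 * t)" for t \<omega>
      unfolding expmart_def exp_double[symmetric] mult_exp_exp
      by (simp add: power2_eq_square field_simps)
    have le: "(expmart \<gamma> (?\<sigma> n \<omega>) \<omega>)\<^sup>2 \<le> expmart (2 * \<gamma>) (?\<sigma> n \<omega>) \<omega> * exp (\<gamma>\<^sup>2 * K)" for \<omega>
      unfolding sq using mult_left_mono[OF \<sigma>_le[of n \<omega>], of "\<gamma>\<^sup>2"]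
      by (intro mult_left_mono) (simp_all add: less_imp_le[OF expmart_pos] del: of_nat_Suc times_divide_eq_right)
    have int: "integrable N (\<lambda>\<omega>. expmart (2 * \<gamma>) (?\<sigma> n \<omega>) \<omega> * exp (\<gamma>\<^sup>2 * K))"
      using grid(1) by (intro integrable_mult_left) auto
    have meas: "(\<lambda>\<omega>. (expmart \<gamma> (?\<sigma> n \<omega>) \<omega>)\<^sup>2) \<in> borel_measurable N"
      by (intro borel_measurable_power borel_measurable_integrable grid(1))
    have "integrable N (\<lambda>\<omega>. (expmart \<gamma> (?\<sigma> n \<omega>) \<omega>)\<^sup>2)"
      by (rule Bochner_Integration.integrable_bound[OF int meas])
         (use le less_imp_le[OF expmart_pos] in auto)
    moreover from this have "integral\<^sup>L N (\<lambda>\<omega>. (expmart \<gamma> (?\<sigma> n \<omega>) \<omega>)\<^sup>2)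
        \<le> integral\<^sup>L N (\<lambda>\<omega>. expmart (2 * \<gamma>) (?\<sigma> n \<omega>) \<omega> * exp (\<gamma>\<^sup>2 * K))"
      using int le by (intro integral_mono) auto
    ultimately show ?thesis by (simp add: grid(2) del: of_nat_Suc)
  qed
  note sq = conjunct1[OF this] conjunct2[OF this]
  have lim: "(\<lambda>n. expmart \<gamma> (?\<sigma> n \<omega>) \<omega>) \<longlonglongrightarrow> expmart \<gamma> (S \<omega>) \<omega>" if \<omega>: "\<omega> \<in> space N" for \<omega>
    unfolding expmart_def using W_lim[OF \<omega>] \<sigma>_lim[OF \<omega>] by (intro tendsto_intros) auto
  show "integrable N (\<lambda>\<omega>. expmart \<gamma> (S \<omega>) \<omega>)" "(\<integral> \<omega>. expmart \<gamma> (S \<omega>) \<omega> \<partial>N) = 1"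
    using integral_limit_of_L2_bounded[OF grid(1) grid(2) less_imp_le[OF expmart_pos] sq lim] by auto
  show "(\<lambda>\<omega>. W (S \<omega>) \<omega>) \<in> borel_measurable N"
    by (rule borel_measurable_LIMSEQ_real[OF W_lim grid(3)])
qed

end

section \<open>Exit of a drifted Brownian motion from an interval\<close>

lemma exp_neg_bounds: "0 \<le> \<alpha> \<Longrightarrow> 0 \<le> exp_neg \<alpha> T" "0 \<le> \<alpha> \<Longrightarrow> exp_neg \<alpha> T \<le> 1"
  by (auto simp: exp_neg_def)

lemma exp_neg_measurable [measurable]: "exp_neg \<alpha> \<in> borel_measurable borel"
  unfolding exp_neg_def by measurable

locale drifted_brownian_motion = brownian_motion +
  fixes x0 u \<epsilon> b :: real
  assumes u_nonzero: "u \<noteq> 0" and \<epsilon>: "\<epsilon> = 1 \<or> \<epsilon> = - 1" and x0: "\<bar>x0\<bar> < b"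
begin

definition L :: "real \<Rightarrow> 'a \<Rightarrow> real" where
  "L t \<omega> = x0 + u * W t \<omega> + \<epsilon> * u\<^sup>2 / 2 * t"

definition T :: "'a \<Rightarrow> ennreal" where
  "T \<omega> = exit_of b (\<lambda>t. L t \<omega>)"

lemma L_measurable [measurable]: "L t \<in> borel_measurable N"
  unfolding L_def by measurable

lemma L_measurable_G: "0 \<le> s \<Longrightarrow> s \<le> t \<Longrightarrow> L s \<in> borel_measurable (G t)"
  unfolding L_def by measurable

lemma L_continuous: "\<omega> \<in> space N \<Longrightarrow> continuous_on {0..} (\<lambda>t. L t \<omega>)"
  unfolding L_def by (intro continuous_intros W_continuous)

lemma L_zero: "\<omega> \<in> space N \<Longrightarrow> \<bar>L 0 \<omega>\<bar> < b"
  using x0 by (simp add: L_def W_zero)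

text \<open>T is a stopping time already for the raw filtration: the exit set is closed and the
  paths are continuous, so t < T is decided by the path on [0, t], and countably many times
  suffice.\<close>

lemma less_T_sets:
  assumes t: "0 \<le> t"
  shows "{\<omega> \<in> space N. ennreal t < T \<omega>} \<in> sets (G t)"
proof -
  have "{\<omega> \<in> space N. ennreal t < T \<omega>} =
      (\<Union>m::nat. \<Inter>q\<in>\<rat> \<inter> {0..1}. {\<omega> \<in> space (G t). \<bar>L (t * q) \<omega>\<bar> \<le> b - 1 / Suc m})"
  proof (rule set_eqI)
    fix \<omega>
    have "0 \<in> \<rat> \<inter> {0..1::real}" by simp
    then show "\<omega> \<in> {\<omega> \<in> space N. ennreal t < T \<omega>} \<longleftrightarrow>
      \<omega> \<in> (\<Union>m::nat. \<Inter>q\<in>\<rat> \<inter> {0..1}. {\<omega> \<in> space (G t). \<bar>L (t * q) \<omega>\<bar> \<le> b - 1 / Suc m})"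
      unfolding T_def
      using less_exit_of_iff[OF L_continuous L_zero t, of \<omega>] all_abs_less_iff_rational[OF L_continuous t, of \<omega> b]
      by (cases "\<omega> \<in> space N") auto
  qed
  also have "\<dots> \<in> sets (G t)"
  proof (intro sets.countable_UN image_subsetI sets.countable_INT')
    show "countable (\<rat> \<inter> {0..1::real})" by (intro countable_Int1 countable_rat)
    have "0 \<in> \<rat> \<inter> {0..1::real}" by simp
    then show "\<rat> \<inter> {0..1::real} \<noteq> {}" by blast
  next
    fix m :: nat and q :: real assume "q \<in> \<rat> \<inter> {0..1}"
      then have [measurable]: "L (t * q) \<in> borel_measurable (G t)"
        using t by (intro L_measurable_G) (auto simp: mult_left_le)
      show "{\<omega> \<in> space (G t). \<bar>L (t * q) \<omega>\<bar> \<le> b - 1 / real (Suc m)} \<in> sets (G t)" by measurable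
  qed
  finally show ?thesis .
qed

lemma T_measurable [measurable]: "T \<in> borel_measurable N"
proof (rule borel_measurableI_greater)
  fix y :: ennreal
  show "{\<omega> \<in> space N. y < T \<omega>} \<in> sets N"
    by (cases y) (auto intro: G_sets_N less_T_sets)
qed

lemma T_cases:
  assumes "\<omega> \<in> space N"
  obtains (never) "T \<omega> = \<infinity>" "\<And>t. 0 \<le> t \<Longrightarrow> \<bar>L t \<omega>\<bar> < b"
  | (exit) t where "0 < t" "T \<omega> = ennreal t" "\<bar>L t \<omega>\<bar> = b" "\<And>s. 0 \<le> s \<Longrightarrow> s < t \<Longrightarrow> \<bar>L s \<omega>\<bar> < b"
  using exit_of_cases[OF L_continuous[OF assms] L_zero[OF assms]] unfolding T_def by blast

section \<open>Truncated exit times and transforms on the two exit events\<close>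

definition S :: "nat \<Rightarrow> 'a \<Rightarrow> real" where
  "S n \<omega> = enn2real (min (T \<omega>) (ennreal (Suc n)))"

lemma S_never: "T \<omega> = \<infinity> \<Longrightarrow> S n \<omega> = real (Suc n)"
  unfolding S_def by (simp del: of_nat_Suc)

lemma S_exit: "T \<omega> = ennreal t \<Longrightarrow> 0 < t \<Longrightarrow> S n \<omega> = min t (real (Suc n))"
  unfolding S_def by (simp add: min_def del: of_nat_Suc)

lemma S_bounds: "\<omega> \<in> space N \<Longrightarrow> 0 \<le> S n \<omega> \<and> S n \<omega> \<le> real (Suc n)"
  by (erule T_cases) (simp_all add: S_never S_exit del: of_nat_Suc)

lemma less_S_sets: "0 \<le> t \<Longrightarrow> {\<omega> \<in> space N. t < S n \<omega>} \<in> sets (G t)"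
proof -
  assume t: "0 \<le> t"
  have "t < S n \<omega> \<longleftrightarrow> t < real (Suc n) \<and> ennreal t < T \<omega>" if "\<omega> \<in> space N" for \<omega>
    using that by (cases rule: T_cases) (use t in \<open>auto simp: S_never S_exit ennreal_less_iff simp del: of_nat_Suc\<close>)
  then have "{\<omega> \<in> space N. t < S n \<omega>} = (if t < real (Suc n) then {\<omega> \<in> space N. ennreal t < T \<omega>} else {})"
    by auto
  then show ?thesis using less_T_sets[OF t] by simp
qed

text \<open>This bound, uniform in n, dominates the stopped martingales when the truncation is
  removed.\<close>

lemma L_S_bound: "\<omega> \<in> space N \<Longrightarrow> \<bar>L (S n \<omega>) \<omega>\<bar> \<le> b"
proof (erule T_cases)
  assume "T \<omega> = \<infinity>" "\<And>t. 0 \<le> t \<Longrightarrow> \<bar>L t \<omega>\<bar> < b"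
  then show ?thesis by (simp add: S_never less_imp_le del: of_nat_Suc)
next
  fix t assume t: "0 < t" "T \<omega> = ennreal t" "\<bar>L t \<omega>\<bar> = b" "\<And>s. 0 \<le> s \<Longrightarrow> s < t \<Longrightarrow> \<bar>L s \<omega>\<bar> < b"
  show ?thesis
  proof (cases "t \<le> real (Suc n)")
    case False
    then have "\<bar>L (S n \<omega>) \<omega>\<bar> = \<bar>L (real (Suc n)) \<omega>\<bar>" using S_exit[OF t(2,1)] by (simp add: min_def)
    then show ?thesis using t(4)[of "real (Suc n)"] False by simp
  qed (use t in \<open>simp add: S_exit del: of_nat_Suc\<close>)
qed

definition exits_at :: "real \<Rightarrow> 'a set" where
  "exits_at y = {\<omega> \<in> space N. T \<omega> < \<infinity> \<and> L (enn2real (T \<omega>)) \<omega> = y}"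

lemma stopping_S:
  "integrable N (\<lambda>\<omega>. expmart \<gamma> (S n \<omega>) \<omega>)"
  "(\<integral> \<omega>. expmart \<gamma> (S n \<omega>) \<omega> \<partial>N) = 1"
  "(\<lambda>\<omega>. W (S n \<omega>) \<omega>) \<in> borel_measurable N"
  using S_bounds less_S_sets
  by (intro optional_stopping[of "real (Suc n)"]; simp del: of_nat_Suc)+

lemma exits_at_sets [measurable]: "exits_at y \<in> sets N"
proof -
  \<comment> \<open>Paths that never leave get the value y + 1, which differs from y and so keeps
    them out of the event. On the other paths the truncated time is eventually T, so the limit is
    the value at the exit.\<close>
  define f where "f n \<omega> = (if T \<omega> = \<infinity> then y + 1 else x0 + u * W (S n \<omega>) \<omega> + \<epsilon> * u\<^sup>2 / 2 * S n \<omega>)" for n \<omega>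
  have [measurable]: "(\<lambda>\<omega>. W (S n \<omega>) \<omega>) \<in> borel_measurable N" for n by (rule stopping_S(3))
  have [measurable]: "S n \<in> borel_measurable N" for n unfolding S_def by measurable
  have "f n \<in> borel_measurable N" for n unfolding f_def by measurable
  moreover have lim: "(\<lambda>n. f n \<omega>) \<longlonglongrightarrow> (if T \<omega> = \<infinity> then y + 1 else L (enn2real (T \<omega>)) \<omega>)" if "\<omega> \<in> space N" for \<omega>
    using that
  proof (cases rule: T_cases)
    case never
    then show ?thesis by (simp add: f_def)
  next
    case (exit t)
    obtain k :: nat where k: "t \<le> real k" using real_arch_simple by blast
    have "\<forall>\<^sub>F n in sequentially. f n \<omega> = L t \<omega>"
      using eventually_ge_at_top[of k]
    proof eventually_elim
      case (elim n)
      then have "S n \<omega> = t" using k S_exit[OF exit(2,1), of n] by simp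
      then show ?case by (simp add: f_def exit L_def)
    qed
    then show ?thesis using exit by (simp add: tendsto_eventually)
  qed
  ultimately have "(\<lambda>\<omega>. if T \<omega> = \<infinity> then y + 1 else L (enn2real (T \<omega>)) \<omega>) \<in> borel_measurable N"
    by (intro borel_measurable_LIMSEQ_real[OF lim]) auto
  then have "{\<omega> \<in> space N. (if T \<omega> = \<infinity> then y + 1 else L (enn2real (T \<omega>)) \<omega>) = y} \<in> sets N"
    by measurable
  also have "{\<omega> \<in> space N. (if T \<omega> = \<infinity> then y + 1 else L (enn2real (T \<omega>)) \<omega>) = y} = exits_at y"
    by (auto simp: exits_at_def less_top)
  finally show ?thesis .
qed

definition exit_transform :: "real \<Rightarrow> real \<Rightarrow> real" where
  "exit_transform y \<alpha> = (\<integral> \<omega>. indicator (exits_at y) \<omega> * exp_neg \<alpha> (T \<omega>) \<partial>N)"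

text \<open>The condition on \<delta> makes exp (\<delta> (L - x0) - \<alpha> t) the exponential
  martingale with parameter \<delta> u. On paths that never leave, boundedness of L and \<alpha> > 0
  send the stopped martingale to 0, so the limit only sees the two exit events and no finiteness of
  T is presupposed.\<close>

lemma exit_transform_equation:
  assumes \<alpha>: "0 < \<alpha>" and \<delta>: "(\<delta> * \<epsilon> + \<delta>\<^sup>2) * u\<^sup>2 / 2 = \<alpha>"
  shows "exp (\<delta> * (b - x0)) * exit_transform b \<alpha> + exp (\<delta> * (- b - x0)) * exit_transform (- b) \<alpha> = 1"
proof -
  let ?Z = "\<lambda>\<omega>. exp (\<delta> * (b - x0)) * (indicator (exits_at b) \<omega> * exp_neg \<alpha> (T \<omega>))
     + exp (\<delta> * (- b - x0)) * (indicator (exits_at (- b)) \<omega> * exp_neg \<alpha> (T \<omega>))"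
  have mart: "expmart (\<delta> * u) t \<omega> = exp (\<delta> * (L t \<omega> - x0)) * exp (- \<alpha> * t)" for t \<omega>
    unfolding expmart_def mult_exp_exp \<delta>[symmetric] L_def by (simp add: field_simps power2_eq_square)
  have b0: "0 < b" using x0 by linarith
  have bound: "exp (\<delta> * (L (S n \<omega>) \<omega> - x0)) \<le> exp (\<bar>\<delta>\<bar> * (2 * b))" if "\<omega> \<in> space N" for n \<omega>
  proof -
    have "\<delta> * (L (S n \<omega>) \<omega> - x0) \<le> \<bar>\<delta>\<bar> * \<bar>L (S n \<omega>) \<omega> - x0\<bar>"
      by (metis abs_ge_self abs_mult)
    also have "\<dots> \<le> \<bar>\<delta>\<bar> * (2 * b)"
      using L_S_bound[OF that, of n] x0 by (intro mult_left_mono) auto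
    finally show ?thesis by simp
  qed
  have lim: "(\<lambda>n. expmart (\<delta> * u) (S n \<omega>) \<omega>) \<longlonglongrightarrow> ?Z \<omega>" if \<omega>: "\<omega> \<in> space N" for \<omega>
    using \<omega>
  proof (cases rule: T_cases)
    case never
    have "(\<lambda>n. exp (\<delta> * (L (S n \<omega>) \<omega> - x0)) * exp (- \<alpha> * S n \<omega>)) \<longlonglongrightarrow> 0"
    proof (rule tendsto_sandwich[of "\<lambda>_. 0" _ _ "\<lambda>n. exp (\<bar>\<delta>\<bar> * (2 * b)) * exp (- \<alpha> * real (Suc n))"])
      show "\<forall>\<^sub>F n in sequentially. exp (\<delta> * (L (S n \<omega>) \<omega> - x0)) * exp (- \<alpha> * S n \<omega>) \<le> exp (\<bar>\<delta>\<bar> * (2 * b)) * exp (- \<alpha> * real (Suc n))"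
        using bound[OF \<omega>] by (intro always_eventually allI) (simp add: S_never[OF never(1)] del: of_nat_Suc)
      have "(\<lambda>n. exp (\<bar>\<delta>\<bar> * (2 * b)) * exp (- \<alpha>) ^ Suc n) \<longlonglongrightarrow> exp (\<bar>\<delta>\<bar> * (2 * b)) * 0"
        using \<alpha> by (intro tendsto_intros LIMSEQ_Suc[OF LIMSEQ_power_zero]) auto
      then show "(\<lambda>n. exp (\<bar>\<delta>\<bar> * (2 * b)) * exp (- \<alpha> * real (Suc n))) \<longlonglongrightarrow> 0"
        by (simp only: exp_of_nat2_mult[symmetric] mult_zero_right)
    qed auto
    moreover have "?Z \<omega> = 0" using never by (simp add: exp_neg_def)
    ultimately show ?thesis by (simp add: mart)
  next
    case (exit t)
    obtain k :: nat where k: "t \<le> real k" using real_arch_simple by blast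
    have Z: "?Z \<omega> = exp (\<delta> * (L t \<omega> - x0)) * exp (- \<alpha> * t)"
    proof (cases "L t \<omega> = b")
      case True
      then show ?thesis using exit b0 \<omega> by (simp add: exits_at_def exp_neg_def)
    next
      case False
      then have "L t \<omega> = - b" using exit(3) by auto
      then show ?thesis using exit b0 \<omega> by (simp add: exits_at_def exp_neg_def)
    qed
    have "\<forall>\<^sub>F n in sequentially. expmart (\<delta> * u) (S n \<omega>) \<omega> = ?Z \<omega>"
      using eventually_ge_at_top[of k]
    proof eventually_elim
      case (elim n)
      then have "S n \<omega> = t" using k S_exit[OF exit(2,1), of n] by simp
      then show ?case by (simp only: Z mart)
    qed
    then show ?thesis by (rule tendsto_eventually)
  qed
  have "(\<lambda>n. \<integral> \<omega>. expmart (\<delta> * u) (S n \<omega>) \<omega> \<partial>N) \<longlonglongrightarrow> integral\<^sup>L N ?Z"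
  proof (rule integral_dominated_convergence[where w="\<lambda>_. exp (\<bar>\<delta>\<bar> * (2 * b))"])
    show "AE \<omega> in N. (\<lambda>n. expmart (\<delta> * u) (S n \<omega>) \<omega>) \<longlonglongrightarrow> ?Z \<omega>" using lim by auto
    have "norm (expmart (\<delta> * u) (S n \<omega>) \<omega>) \<le> exp (\<bar>\<delta>\<bar> * (2 * b))" if "\<omega> \<in> space N" for n \<omega>
    proof -
      have "exp (\<delta> * (L (S n \<omega>) \<omega> - x0)) * exp (- \<alpha> * S n \<omega>) \<le> exp (\<bar>\<delta>\<bar> * (2 * b)) * 1"
        using bound[OF that] S_bounds[OF that, of n] \<alpha> by (intro mult_mono) auto
      then show ?thesis by (simp add: mart)
    qed
    then show "AE \<omega> in N. norm (expmart (\<delta> * u) (S n \<omega>) \<omega>) \<le> exp (\<bar>\<delta>\<bar> * (2 * b))" for n by auto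
    show "(\<lambda>\<omega>. expmart (\<delta> * u) (S n \<omega>) \<omega>) \<in> borel_measurable N" for n
      by (rule borel_measurable_integrable[OF stopping_S(1)])
    show "?Z \<in> borel_measurable N" by measurable
  qed simp
  then have "integral\<^sup>L N ?Z = 1"
    unfolding stopping_S(2) by (simp add: LIMSEQ_const_iff)
  moreover have "integrable N (\<lambda>\<omega>. indicator (exits_at y) \<omega> * exp_neg \<alpha> (T \<omega>))" for y
    by (rule integrable_const_bound[where B=1])
       (use \<alpha> in \<open>auto simp: exp_neg_bounds indicator_def\<close>)
  ultimately show ?thesis by (simp add: exit_transform_def)
qed

lemma exit_transform_eq:
  assumes \<alpha>: "0 < \<alpha>"
  defines "\<beta> \<equiv> sqrt (2 * \<alpha> / u\<^sup>2 + 1 / 4)"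
  shows "exit_transform b \<alpha> = exp (\<epsilon> * (b - x0) / 2) * (sinh (\<beta> * (b + x0)) / sinh (2 * \<beta> * b))"
    and "exit_transform (- b) \<alpha> = exp (- (\<epsilon> * (b + x0) / 2)) * (sinh (\<beta> * (b - x0)) / sinh (2 * \<beta> * b))"
proof -
  have b0: "0 < b" using x0 by linarith
  have u2: "0 < u\<^sup>2" using u_nonzero by simp
  have \<beta>0: "0 < \<beta>" unfolding \<beta>_def using \<alpha> u2 by (simp add: add_pos_pos)
  have \<beta>2: "\<beta>\<^sup>2 = 2 * \<alpha> / u\<^sup>2 + 1 / 4" unfolding \<beta>_def using \<alpha> u2 by simp
  have \<epsilon>2: "\<epsilon> * \<epsilon> = 1" using \<epsilon> by auto
  have root: "((- (\<epsilon> / 2) + s * \<beta>) * \<epsilon> + (- (\<epsilon> / 2) + s * \<beta>)\<^sup>2) * u\<^sup>2 / 2 = \<alpha>" if "s * s = 1" for s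
  proof -
    have "(- (\<epsilon> / 2) + s * \<beta>) * \<epsilon> + (- (\<epsilon> / 2) + s * \<beta>)\<^sup>2 = (s * s) * \<beta>\<^sup>2 - (\<epsilon> * \<epsilon>) / 4"
      by (simp add: power2_eq_square algebra_simps)
    also have "\<dots> = 2 * \<alpha> / u\<^sup>2" by (simp add: that \<epsilon>2 \<beta>2)
    finally show ?thesis using u2 by simp
  qed
  \<comment> \<open>Splitting off the common part - \<epsilon> / 2 of the roots leaves a system in
    \<beta> alone, with coefficients \<open>exp (\<plusminus> \<beta> * (b - x0))\<close> and
    \<open>exp (\<plusminus> \<beta> * (b + x0))\<close> and determinant 2 sinh (2 \<beta> b), which
    is nonzero.\<close>
  define U where "U = exp (- (\<epsilon> * (b - x0) / 2)) * exit_transform b \<alpha>"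
  define D where "D = exp (\<epsilon> * (b + x0) / 2) * exit_transform (- b) \<alpha>"
  have UU: "exit_transform b \<alpha> = exp (\<epsilon> * (b - x0) / 2) * U"
    unfolding U_def mult.assoc[symmetric] mult_exp_exp by simp
  have DD: "exit_transform (- b) \<alpha> = exp (- (\<epsilon> * (b + x0) / 2)) * D"
    unfolding D_def mult.assoc[symmetric] mult_exp_exp by simp
  have eq: "exp (s * \<beta> * (b - x0)) * U + exp (- (s * \<beta> * (b + x0))) * D = 1" if "s * s = 1" for s
  proof -
    have "exp (s * \<beta> * (b - x0)) * U = exp ((- (\<epsilon> / 2) + s * \<beta>) * (b - x0)) * exit_transform b \<alpha>"
      unfolding U_def mult.assoc[symmetric] mult_exp_exp by (simp add: field_simps)
    moreover have "exp (- (s * \<beta> * (b + x0))) * D = exp ((- (\<epsilon> / 2) + s * \<beta>) * (- b - x0)) * exit_transform (- b) \<alpha>"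
      unfolding D_def mult.assoc[symmetric] mult_exp_exp by (simp add: field_simps)
    ultimately show ?thesis
      using exit_transform_equation[OF \<alpha> root[OF that]] by simp
  qed
  have plus: "exp (\<beta> * (b - x0)) * U + exp (- (\<beta> * (b + x0))) * D = 1" using eq[of 1] by simp
  have minus: "exp (- (\<beta> * (b - x0))) * U + exp (\<beta> * (b + x0)) * D = 1" using eq[of "- 1"] by simp
  have E2: "exp (\<beta> * (b + x0)) * exp (\<beta> * (b - x0)) = exp (2 * \<beta> * b)"
    "exp (- (\<beta> * (b + x0))) * exp (- (\<beta> * (b - x0))) = exp (- (2 * \<beta> * b))"
    unfolding mult_exp_exp by (simp_all add: algebra_simps)
  have inv: "exp (\<beta> * (b + x0)) * exp (- (\<beta> * (b + x0))) = 1" "exp (\<beta> * (b - x0)) * exp (- (\<beta> * (b - x0))) = 1"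
    unfolding mult_exp_exp by simp_all
  have sinh0: "sinh (2 * \<beta> * b) \<noteq> 0" using \<beta>0 b0 by simp
  have "exp (\<beta> * (b + x0)) * (exp (\<beta> * (b - x0)) * U + exp (- (\<beta> * (b + x0))) * D)
      - exp (- (\<beta> * (b + x0))) * (exp (- (\<beta> * (b - x0))) * U + exp (\<beta> * (b + x0)) * D)
     = (exp (2 * \<beta> * b) - exp (- (2 * \<beta> * b))) * U"
    unfolding E2[symmetric] by (simp add: algebra_simps)
  then have "sinh (2 * \<beta> * b) * U = sinh (\<beta> * (b + x0))"
    unfolding plus minus by (simp add: sinh_def)
  then have "U = sinh (\<beta> * (b + x0)) / sinh (2 * \<beta> * b)" using sinh0 by (simp add: field_simps)
  then show "exit_transform b \<alpha> = exp (\<epsilon> * (b - x0) / 2) * (sinh (\<beta> * (b + x0)) / sinh (2 * \<beta> * b))"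
    using UU by simp
  have "exp (\<beta> * (b - x0)) * (exp (- (\<beta> * (b - x0))) * U + exp (\<beta> * (b + x0)) * D)
      - exp (- (\<beta> * (b - x0))) * (exp (\<beta> * (b - x0)) * U + exp (- (\<beta> * (b + x0))) * D)
     = (exp (2 * \<beta> * b) - exp (- (2 * \<beta> * b))) * D"
    unfolding E2[symmetric] by (simp add: algebra_simps)
  then have "sinh (2 * \<beta> * b) * D = sinh (\<beta> * (b - x0))"
    unfolding plus minus by (simp add: sinh_def)
  then have "D = sinh (\<beta> * (b - x0)) / sinh (2 * \<beta> * b)" using sinh0 by (simp add: field_simps)
  then show "exit_transform (- b) \<alpha> = exp (- (\<epsilon> * (b + x0) / 2)) * (sinh (\<beta> * (b - x0)) / sinh (2 * \<beta> * b))"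
    using DD by simp
qed

end

section \<open>First passage densities\<close>

definition std_normal_cdf :: "real \<Rightarrow> real" where
  "std_normal_cdf = cdf (density lborel std_normal_density)"

lemma real_distribution_std_normal: "real_distribution (density lborel std_normal_density)"
  using prob_space_normal_density[of 1 0] by (intro real_distribution.intro) (auto simp: real_distribution_axioms_def)

lemma std_normal_cdf_at_top: "(std_normal_cdf \<longlongrightarrow> 1) at_top"
  unfolding std_normal_cdf_def by (rule real_distribution.cdf_lim_at_top_prob[OF real_distribution_std_normal])

lemma std_normal_cdf_at_bot: "(std_normal_cdf \<longlongrightarrow> 0) at_bot"
proof -
  interpret real_distribution "density lborel std_normal_density" by (rule real_distribution_std_normal)
  show ?thesis unfolding std_normal_cdf_def by (rule cdf_lim_at_bot)
qed

text \<open>Near x the distribution function is a constant plus an integral over a compact interval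
  starting at x - 1, to which the fundamental theorem applies. The closed left end point is harmless
  because the law has no atoms.\<close>

lemma DERIV_std_normal_cdf: "(std_normal_cdf has_real_derivative std_normal_density x) (at x)"
proof -
  interpret real_distribution "density lborel std_normal_density" by (rule real_distribution_std_normal)
  have cont: "continuous_on A std_normal_density" for A
    unfolding normal_density_def by (intro continuous_intros) auto
  have eq: "std_normal_cdf y = std_normal_cdf (x - 1) + integral {x - 1..y} std_normal_density" if "x - 1 < y" for y
  proof -
    have int: "set_integrable lborel {x - 1..y} std_normal_density"
      by (rule borel_integrable_atLeastAtMost'[OF cont])
    have "std_normal_cdf y - std_normal_cdf (x - 1) = measure (density lborel std_normal_density) {x - 1<..y}"
      unfolding std_normal_cdf_def using that by (rule cdf_diff_eq)
    also have "\<dots> = measure (density lborel std_normal_density) {x - 1..y}"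
    proof -
      have "AE t in lborel. t \<noteq> x - 1" by (rule AE_lborel_singleton)
      then show ?thesis
        by (intro finite_measure_eq_AE) (auto simp: AE_density)
    qed
    also have "\<dots> = (\<integral>t. indicator {x - 1..y} t * std_normal_density t \<partial>lborel)"
    proof -
      have "emeasure (density lborel std_normal_density) {x - 1..y}
          = (\<integral>\<^sup>+ t. ennreal (indicator {x - 1..y} t * std_normal_density t) \<partial>lborel)"
        by (subst emeasure_density) (auto intro!: nn_integral_cong simp: ennreal_mult' mult.commute split: split_indicator)
      also have "\<dots> = ennreal (\<integral>t. indicator {x - 1..y} t * std_normal_density t \<partial>lborel)"
        using int by (intro nn_integral_eq_integral) (auto simp: set_integrable_def)
      finally show ?thesis
        by (simp add: measure_def integral_nonneg_AE)
    qed
    also have "\<dots> = integral {x - 1..y} std_normal_density"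
      using set_borel_integral_eq_integral(2)[OF int] by (simp add: set_lebesgue_integral_def)
    finally show ?thesis by simp
  qed
  have "((\<lambda>y. integral {x - 1..y} std_normal_density) has_real_derivative std_normal_density x) (at x within {x - 1..x + 1})"
    by (rule integral_has_real_derivative[OF cont]) auto
  then have "((\<lambda>y. integral {x - 1..y} std_normal_density) has_real_derivative std_normal_density x) (at x)"
    by (simp add: at_within_Icc_at)
  then have "((\<lambda>y. std_normal_cdf (x - 1) + integral {x - 1..y} std_normal_density) has_real_derivative 0 + std_normal_density x) (at x)"
    by (intro DERIV_add DERIV_const)
  then have "((\<lambda>y. std_normal_cdf (x - 1) + integral {x - 1..y} std_normal_density) has_real_derivative std_normal_density x) (at x)"
    by simp
  moreover have "\<forall>\<^sub>F y in nhds x. std_normal_cdf (x - 1) + integral {x - 1..y} std_normal_density = std_normal_cdf y"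
    using eventually_nhds_in_open[of "{x - 1<..}" x] by (auto elim!: eventually_mono simp: eq)
  ultimately show ?thesis
    by (subst (asm) DERIV_cong_ev[OF refl _ refl]) auto
qed

text \<open>For a > 0 this is the density of the first time at which u W reaches a. It is odd in a,
  which gives image terms at negative levels their sign.\<close>

definition passage_density :: "real \<Rightarrow> real \<Rightarrow> real \<Rightarrow> real" where
  "passage_density u a t = a / (sqrt (2 * pi) * \<bar>u\<bar> * t powr (3/2)) * exp (- (a\<^sup>2 / (2 * u\<^sup>2 * t)))"

lemma passage_density_nonneg: "0 \<le> a \<Longrightarrow> 0 \<le> passage_density u a t"
  by (simp add: passage_density_def)

lemma passage_density_measurable [measurable]: "passage_density u a \<in> borel_measurable borel"
  unfolding passage_density_def by measurable

lemma passage_density_minus: "passage_density u (- a) t = - passage_density u a t"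
  by (simp add: passage_density_def)

text \<open>The antiderivative is the distribution function of the inverse Gaussian law, the law of
  the first passage time of a Brownian motion with drift \<open>\<nu>\<close> at level \<open>c\<close>.\<close>

lemma inverse_gaussian_integral:
  fixes c \<nu> :: real
  assumes c: "0 < c" and \<nu>: "0 < \<nu>"
  defines "f \<equiv> \<lambda>t. std_normal_density (\<nu> * sqrt t + - (c * inverse (sqrt t))) * (c / (t * sqrt t))"
  shows "set_integrable lborel {0<..} f" and "(LBINT t:{0<..}. f t) = 1"
proof -
  define F where "F t = std_normal_cdf (\<nu> * sqrt t + - (c * inverse (sqrt t))) + exp (2 * c * \<nu>) * std_normal_cdf (- (\<nu> * sqrt t) + - (c * inverse (sqrt t)))" for t
  have deriv: "DERIV F t :> f t" if t: "0 < t" for t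
  proof -
    define s where "s = sqrt t"
    have s: "0 < s" "t = s * s" "s \<noteq> 0" using t by (simp_all add: s_def)
    have dinv: "((\<lambda>t. c * inverse (sqrt t)) has_real_derivative c * - (inverse s / 2 * inverse (s ^ Suc (Suc 0)))) (at t)"
      unfolding s_def using t by (intro DERIV_cmult DERIV_inverse_fun DERIV_real_sqrt) auto
    have dsqrt: "((\<lambda>t. \<nu> * sqrt t) has_real_derivative \<nu> * (inverse s / 2)) (at t)"
      unfolding s_def using t by (intro DERIV_cmult DERIV_real_sqrt)
    have dF: "DERIV F t :> std_normal_density (\<nu> * sqrt t + - (c * inverse (sqrt t))) * (\<nu> * (inverse s / 2) + - (c * - (inverse s / 2 * inverse (s ^ Suc (Suc 0)))))
        + exp (2 * c * \<nu>) * (std_normal_density (- (\<nu> * sqrt t) + - (c * inverse (sqrt t))) * (- (\<nu> * (inverse s / 2)) + - (c * - (inverse s / 2 * inverse (s ^ Suc (Suc 0))))))"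
      unfolding F_def
      by (intro DERIV_add DERIV_cmult DERIV_chain2[OF DERIV_std_normal_cdf] DERIV_minus dinv dsqrt)
    \<comment> \<open>The reflection identity: the factor exp (2 c \<nu>) turns the second normal
      density into the first. The two derivatives then share a factor, the \<nu>-terms cancel, and c
      / (t sqrt t) remains.\<close>
    have "2 * c * \<nu> + - ((- (\<nu> * sqrt t) + - (c * inverse (sqrt t)))\<^sup>2 / 2) = - ((\<nu> * sqrt t + - (c * inverse (sqrt t)))\<^sup>2 / 2)"
      unfolding s_def[symmetric] using s(3) by (simp add: power2_eq_square field_simps)
    then have tilt: "exp (2 * c * \<nu>) * std_normal_density (- (\<nu> * sqrt t) + - (c * inverse (sqrt t))) = std_normal_density (\<nu> * sqrt t + - (c * inverse (sqrt t)))"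
      by (simp add: normal_density_def mult_exp_exp)
    have "\<nu> * (inverse s / 2) + - (c * - (inverse s / 2 * inverse (s ^ Suc (Suc 0))))
        + (- (\<nu> * (inverse s / 2)) + - (c * - (inverse s / 2 * inverse (s ^ Suc (Suc 0))))) = c / (t * sqrt t)"
      unfolding s_def[symmetric] s(2) using s(1) by (simp add: field_simps)
    then have "std_normal_density (\<nu> * sqrt t + - (c * inverse (sqrt t))) * (\<nu> * (inverse s / 2) + - (c * - (inverse s / 2 * inverse (s ^ Suc (Suc 0)))))
        + std_normal_density (\<nu> * sqrt t + - (c * inverse (sqrt t))) * (- (\<nu> * (inverse s / 2)) + - (c * - (inverse s / 2 * inverse (s ^ Suc (Suc 0))))) = f t"
      unfolding f_def distrib_left[symmetric] by simp
    with dF show ?thesis by (simp only: tilt mult.assoc[symmetric])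
  qed
  have cont: "isCont f t" if "0 < t" for t
    unfolding f_def normal_density_def using that by (intro continuous_intros) auto
  have sqrt0: "filterlim sqrt (at_right 0) (at_right 0)"
    by (auto simp: filterlim_at eventually_at_filter intro!: tendsto_eq_intros)
  have inv0: "filterlim (\<lambda>t. c * inverse (sqrt t)) at_top (at_right 0)"
    using c by (intro filterlim_tendsto_pos_mult_at_top[OF tendsto_const] filterlim_compose[OF filterlim_inverse_at_top_right sqrt0])
  have lim1: "filterlim (\<lambda>t. \<nu> * sqrt t + - (c * inverse (sqrt t))) at_bot (at_right 0)"
  proof (rule iffD2[OF filterlim_tendsto_add_at_bot_iff])
    show "((\<lambda>t. \<nu> * sqrt t) \<longlongrightarrow> \<nu> * sqrt 0) (at_right 0)" by (intro tendsto_intros)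
    show "filterlim (\<lambda>t. - (c * inverse (sqrt t))) at_bot (at_right 0)"
      using inv0 by (simp add: filterlim_uminus_at_bot)
  qed
  have lim2: "filterlim (\<lambda>t. - (\<nu> * sqrt t) + - (c * inverse (sqrt t))) at_bot (at_right 0)"
  proof (rule iffD2[OF filterlim_tendsto_add_at_bot_iff])
    show "((\<lambda>t. - (\<nu> * sqrt t)) \<longlongrightarrow> - (\<nu> * sqrt 0)) (at_right 0)" by (intro tendsto_intros)
    show "filterlim (\<lambda>t. - (c * inverse (sqrt t))) at_bot (at_right 0)"
      using inv0 by (simp add: filterlim_uminus_at_bot)
  qed
  have top: "filterlim (\<lambda>t. \<nu> * sqrt t) at_top at_top"
    using \<nu> by (intro filterlim_tendsto_pos_mult_at_top[OF tendsto_const] sqrt_at_top)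
  have cinv: "((\<lambda>t. c * inverse (sqrt t)) \<longlongrightarrow> 0) at_top"
    using tendsto_mult[OF tendsto_const tendsto_inverse_0_at_top[OF sqrt_at_top], of c] by simp
  have lim3: "filterlim (\<lambda>t. - (c * inverse (sqrt t)) + \<nu> * sqrt t) at_top at_top"
    by (rule filterlim_tendsto_add_at_top[OF _ top]) (rule tendsto_minus[OF cinv])
  have lim4: "filterlim (\<lambda>t. - (c * inverse (sqrt t)) + - (\<nu> * sqrt t)) at_bot at_top"
    by (rule iffD2[OF filterlim_tendsto_add_at_bot_iff[OF tendsto_minus[OF cinv]]]) (use top in \<open>simp add: filterlim_uminus_at_bot\<close>)
  have F0: "(F \<longlongrightarrow> 0) (at_right 0)"
  proof -
    have "((\<lambda>t. std_normal_cdf (\<nu> * sqrt t + - (c * inverse (sqrt t))) + exp (2 * c * \<nu>) * std_normal_cdf (- (\<nu> * sqrt t) + - (c * inverse (sqrt t)))) \<longlongrightarrow> 0 + exp (2 * c * \<nu>) * 0) (at_right 0)"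
      by (rule tendsto_add[OF filterlim_compose[OF std_normal_cdf_at_bot lim1]
          tendsto_mult[OF tendsto_const filterlim_compose[OF std_normal_cdf_at_bot lim2]]])
    then show ?thesis by (simp add: F_def[abs_def])
  qed
  have F1: "(F \<longlongrightarrow> 1) at_top"
  proof -
    have "((\<lambda>t. std_normal_cdf (- (c * inverse (sqrt t)) + \<nu> * sqrt t) + exp (2 * c * \<nu>) * std_normal_cdf (- (c * inverse (sqrt t)) + - (\<nu> * sqrt t))) \<longlongrightarrow> 1 + exp (2 * c * \<nu>) * 0) at_top"
      by (rule tendsto_add[OF filterlim_compose[OF std_normal_cdf_at_top lim3]
          tendsto_mult[OF tendsto_const filterlim_compose[OF std_normal_cdf_at_bot lim4]]])
    then show ?thesis by (simp add: F_def[abs_def] add.commute)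
  qed
  have "((F \<circ> real_of_ereal) \<longlongrightarrow> 0) (at_right 0)"
    using F0 by (simp add: zero_ereal_def ereal_tendsto_simps)
  moreover have "((F \<circ> real_of_ereal) \<longlongrightarrow> 1) (at_left \<infinity>)"
    using F1 by (simp add: ereal_tendsto_simps)
  moreover have "AE x in lborel. 0 < ereal x \<longrightarrow> ereal x < \<infinity> \<longrightarrow> 0 \<le> f x"
    using c by (auto simp: f_def)
  ultimately have "set_integrable lborel (einterval 0 \<infinity>) f" "(LBINT t=0..\<infinity>. f t) = 1 - 0"
    using interval_integral_FTC_nonneg[of 0 \<infinity> F f 0 1] deriv cont by auto
  moreover have "einterval 0 \<infinity> = {0<..}" by (auto simp: einterval_iff)
  moreover have "(LBINT t=0..\<infinity>. f t) = (LBINT t:{0<..}. f t)"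
    unfolding interval_lebesgue_integral_def by (simp add: \<open>einterval 0 \<infinity> = {0<..}\<close>)
  ultimately show "set_integrable lborel {0<..} f" "(LBINT t:{0<..}. f t) = 1" by simp_all
qed

lemma powr_three_halves: "0 < t \<Longrightarrow> t powr (3/2) = t * sqrt (t::real)"
  using powr_add[of t 1 "1/2"] by (simp add: powr_half_sqrt)

text \<open>Completing the square turns the integrand into exp (- a s) times an inverse Gaussian
  density of total mass 1, with level a / |u| and drift |u| s. Writing the Laplace variable as u^2
  s^2 / 2 makes the transform exponential in a, hence geometric along equally spaced levels.\<close>

lemma nn_integral_passage_density:
  assumes u: "u \<noteq> 0" and a: "0 < a" and s: "0 < s"
  shows "(\<integral>\<^sup>+ t. ennreal (indicator {0<..} t * (exp (- (u\<^sup>2 * s\<^sup>2 / 2 * t)) * passage_density u a t)) \<partial>lborel)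
    = ennreal (exp (- (a * s)))"
proof -
  define c where "c = a / \<bar>u\<bar>"
  define \<nu> where "\<nu> = \<bar>u\<bar> * s"
  have c: "0 < c" and \<nu>: "0 < \<nu>" using u a s by (auto simp: c_def \<nu>_def)
  let ?f = "\<lambda>t. std_normal_density (\<nu> * sqrt t + - (c * inverse (sqrt t))) * (c / (t * sqrt t))"
  have eq: "exp (- (u\<^sup>2 * s\<^sup>2 / 2 * t)) * passage_density u a t = exp (- (a * s)) * ?f t" if t: "0 < t" for t
  proof -
    have as: "a * s = c * \<nu>" using u by (simp add: c_def \<nu>_def)
    have us: "u\<^sup>2 * s\<^sup>2 = \<nu>\<^sup>2" by (simp add: \<nu>_def power_mult_distrib)
    have au: "a\<^sup>2 / (2 * u\<^sup>2 * t) = c\<^sup>2 / (2 * t)" using u by (simp add: c_def power_divide)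
    have ac: "a / (sqrt (2 * pi) * \<bar>u\<bar> * t powr (3/2)) = c / (t * sqrt t) / sqrt (2 * pi)"
      using t by (simp add: c_def powr_three_halves)
    define r where "r = sqrt t"
    have r: "r \<noteq> 0" "t = r * r" using t by (simp_all add: r_def)
    have "- (\<nu>\<^sup>2 / 2 * t) + - (c\<^sup>2 / (2 * t)) = - (c * \<nu>) + - ((\<nu> * sqrt t + - (c * inverse (sqrt t)))\<^sup>2 / 2)"
      unfolding r_def[symmetric] r(2) using r(1) by (simp add: power2_eq_square field_simps)
    then have "exp (- (\<nu>\<^sup>2 / 2 * t)) * exp (- (c\<^sup>2 / (2 * t))) = exp (- (c * \<nu>)) * exp (- ((\<nu> * sqrt t + - (c * inverse (sqrt t)))\<^sup>2 / 2))"
      by (simp only: mult_exp_exp)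
    then show ?thesis
      unfolding passage_density_def as us au ac by (simp add: normal_density_def field_simps)
  qed
  have "(\<integral>\<^sup>+ t. ennreal (indicator {0<..} t * (exp (- (u\<^sup>2 * s\<^sup>2 / 2 * t)) * passage_density u a t)) \<partial>lborel)
      = (\<integral>\<^sup>+ t. ennreal (exp (- (a * s))) * ennreal (indicator {0<..} t * ?f t) \<partial>lborel)"
  proof (intro nn_integral_cong)
    fix t
    have "indicator {0<..} t * (exp (- (u\<^sup>2 * s\<^sup>2 / 2 * t)) * passage_density u a t) = exp (- (a * s)) * (indicator {0<..} t * ?f t)"
    proof (cases "0 < t")
      case True
      then show ?thesis unfolding eq[OF True] by simp
    qed simp
    then show "ennreal (indicator {0<..} t * (exp (- (u\<^sup>2 * s\<^sup>2 / 2 * t)) * passage_density u a t))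
        = ennreal (exp (- (a * s))) * ennreal (indicator {0<..} t * ?f t)"
      by (simp only: ennreal_mult' exp_ge_zero)
  qed
  also have "\<dots> = ennreal (exp (- (a * s))) * (\<integral>\<^sup>+ t. ennreal (indicator {0<..} t * ?f t) \<partial>lborel)"
    by (intro nn_integral_cmult) measurable
  also have "(\<integral>\<^sup>+ t. ennreal (indicator {0<..} t * ?f t) \<partial>lborel) = ennreal (LBINT t:{0<..}. ?f t)"
    unfolding set_lebesgue_integral_def real_scaleR_def
    using inverse_gaussian_integral(1)[OF c \<nu>] c
    by (intro nn_integral_eq_integral) (auto simp: set_integrable_def split: split_indicator)
  also have "\<dots> = 1" using inverse_gaussian_integral(2)[OF c \<nu>] by simp
  finally show ?thesis by simp
qed

section \<open>Uniqueness of Laplace transforms\<close>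

lemma approx_by_polynomial:
  fixes h :: "real \<Rightarrow> real"
  assumes "continuous_on {0..1} h" "0 < e"
  obtains a n where "\<And>x. x \<in> {0..1} \<Longrightarrow> \<bar>h x - (\<Sum>i\<le>n. a i * x ^ i)\<bar> < e"
proof -
  obtain q where q: "real_polynomial_function q" "\<And>x. x \<in> {0..1} \<Longrightarrow> \<bar>h x - q x\<bar> < e"
    using Stone_Weierstrass_real_polynomial_function[OF compact_Icc assms] by blast
  then obtain a n where "q = (\<lambda>x. \<Sum>i\<le>n. a i * x ^ i)"
    using real_polynomial_function_iff_sum by auto
  with q that show ?thesis by auto
qed

text \<open>A signed combination of finite measures on the half-line whose Laplace transform vanishes
  on the natural numbers is zero: the substitution \<open>s = exp (- x)\<close> turns this into a moment
  problem on the unit interval.\<close>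

lemma signed_measure_zero_of_laplace:
  fixes M :: "'i \<Rightarrow> real measure" and c :: "'i \<Rightarrow> real"
  assumes I: "finite I"
    and fin: "\<And>i. i \<in> I \<Longrightarrow> finite_measure (M i)"
    and sets_M: "\<And>i. i \<in> I \<Longrightarrow> sets (M i) = sets borel"
    and pos: "\<And>i. i \<in> I \<Longrightarrow> AE x in M i. 0 \<le> x"
    and laplace: "\<And>n::nat. (\<Sum>i\<in>I. c i * (\<integral>x. exp (- (real n * x)) \<partial>M i)) = 0"
    and B: "B \<in> sets borel"
  shows "(\<Sum>i\<in>I. c i * measure (M i) B) = 0"
proof -
  note [measurable_cong] = sets_M
  have space_M: "space (M i) = UNIV" if "i \<in> I" for i
    using sets_eq_imp_space_eq[OF sets_M[OF that]] by simp
  have int_bounded: "integrable (M i) f" if i: "i \<in> I" and f: "f \<in> borel_measurable borel" and le: "\<And>x. 0 \<le> x \<Longrightarrow> \<bar>f x\<bar> \<le> C" for i f and C :: real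
  proof (rule finite_measure.integrable_const_bound[OF fin[OF i], where B=C])
    show "AE x in M i. norm (f x) \<le> C" using pos[OF i] by eventually_elim (use le in auto)
    show "f \<in> borel_measurable (M i)" using f by (simp cong: measurable_cong_sets add: sets_M[OF i])
  qed
  have poly: "(\<Sum>i\<in>I. c i * (\<integral>x. (\<Sum>j\<le>n. a j * exp (- x) ^ j) \<partial>M i)) = 0" for a :: "nat \<Rightarrow> real" and n
  proof -
    have "(\<integral>x. (\<Sum>j\<le>n. a j * exp (- x) ^ j) \<partial>M i) = (\<Sum>j\<le>n. a j * (\<integral>x. exp (- (real j * x)) \<partial>M i))" if i: "i \<in> I" for i
    proof -
      have int: "integrable (M i) (\<lambda>x. a j * exp (- (real j * x)))" for j
        by (intro integrable_mult_right int_bounded[OF i, where C=1]) auto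
      have "(\<integral>x. (\<Sum>j\<le>n. a j * exp (- x) ^ j) \<partial>M i) = (\<integral>x. (\<Sum>j\<le>n. a j * exp (- (real j * x))) \<partial>M i)"
        by (simp flip: exp_of_nat_mult)
      also have "\<dots> = (\<Sum>j\<le>n. a j * (\<integral>x. exp (- (real j * x)) \<partial>M i))"
        using int by (subst Bochner_Integration.integral_sum) auto
      finally show ?thesis .
    qed
    then have "(\<Sum>i\<in>I. c i * (\<integral>x. (\<Sum>j\<le>n. a j * exp (- x) ^ j) \<partial>M i))
        = (\<Sum>i\<in>I. \<Sum>j\<le>n. a j * (c i * (\<integral>x. exp (- (real j * x)) \<partial>M i)))"
      by (simp add: sum_distrib_left mult.left_commute)
    also have "\<dots> = (\<Sum>j\<le>n. a j * (\<Sum>i\<in>I. c i * (\<integral>x. exp (- (real j * x)) \<partial>M i)))"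
      by (subst sum.swap) (simp add: sum_distrib_left)
    also have "\<dots> = 0" by (simp add: laplace)
    finally show ?thesis .
  qed
  define D where "D = (\<Sum>i\<in>I. \<bar>c i\<bar> * measure (M i) UNIV)"
  have D: "0 \<le> D" unfolding D_def by (intro sum_nonneg) auto
  have cont: "(\<Sum>i\<in>I. c i * (\<integral>x. h (exp (- x)) \<partial>M i)) = 0"
    if h: "continuous_on UNIV h" for h :: "real \<Rightarrow> real"
  proof -
    have hm [measurable]: "h \<in> borel_measurable borel" using h by (rule borel_measurable_continuous_onI)
    have "compact (h ` {0..1})" by (intro compact_continuous_image continuous_on_subset[OF h]) auto
    then obtain C where C: "\<And>s. s \<in> {0..1} \<Longrightarrow> \<bar>h s\<bar> \<le> C"
      using compact_imp_bounded bounded_iff by (metis image_eqI real_norm_def)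
    have "\<bar>\<Sum>i\<in>I. c i * (\<integral>x. h (exp (- x)) \<partial>M i)\<bar> \<le> e * D" if e: "0 < e" for e
    proof -
      obtain a n where a: "\<And>x. x \<in> {0..1} \<Longrightarrow> \<bar>h x - (\<Sum>i\<le>n. a i * x ^ i)\<bar> < e"
        using approx_by_polynomial[OF continuous_on_subset[OF h subset_UNIV] e] by blast
      let ?q = "\<lambda>x. \<Sum>j\<le>n. a j * exp (- x) ^ j"
      have int1: "integrable (M i) (\<lambda>x. h (exp (- x)))" if "i \<in> I" for i
        using that by (rule int_bounded[where C=C]) (auto intro: C)
      have d: "\<bar>h (exp (- x)) - ?q x\<bar> \<le> e" if "0 \<le> x" for x
        using a[of "exp (- x)"] that by auto
      have int2: "integrable (M i) (\<lambda>x. h (exp (- x)) - ?q x)" if "i \<in> I" for i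
        using that by (rule int_bounded[where C=e]) (auto intro: d)
      have "(\<Sum>i\<in>I. c i * (\<integral>x. h (exp (- x)) \<partial>M i)) = (\<Sum>i\<in>I. c i * (\<integral>x. h (exp (- x)) - ?q x \<partial>M i)) + (\<Sum>i\<in>I. c i * (\<integral>x. ?q x \<partial>M i))"
      proof -
        have "integrable (M i) ?q" if "i \<in> I" for i
          using Bochner_Integration.integrable_diff[OF int1[OF that] int2[OF that]] by simp
        then show ?thesis
          unfolding sum.distrib[symmetric] distrib_left[symmetric]
          using int1 by (intro sum.cong refl) (simp add: Bochner_Integration.integral_diff)
      qed
      also have "\<dots> = (\<Sum>i\<in>I. c i * (\<integral>x. h (exp (- x)) - ?q x \<partial>M i))" by (simp add: poly)
      also have "\<bar>\<dots>\<bar> \<le> (\<Sum>i\<in>I. \<bar>c i\<bar> * (e * measure (M i) UNIV))"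
      proof (rule order_trans[OF sum_abs], rule sum_mono)
        fix i assume i: "i \<in> I"
        interpret finite_measure "M i" using fin[OF i] .
        have "\<bar>\<integral>x. h (exp (- x)) - ?q x \<partial>M i\<bar> \<le> (\<integral>x. \<bar>h (exp (- x)) - ?q x\<bar> \<partial>M i)"
          by (rule integral_abs_bound)
        also have "\<dots> \<le> (\<integral>x. e \<partial>M i)"
          using pos[OF i] by (intro integral_mono_AE integrable_abs int2 i) (auto elim!: eventually_mono intro: d)
        also have "\<dots> = e * measure (M i) UNIV" by (simp add: space_M[OF i])
        finally show "\<bar>c i * (\<integral>x. h (exp (- x)) - ?q x \<partial>M i)\<bar> \<le> \<bar>c i\<bar> * (e * measure (M i) UNIV)"
          by (simp add: abs_mult mult_left_mono)
      qed
      also have "\<dots> = e * D" by (simp add: D_def sum_distrib_left mult.left_commute)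
      finally show ?thesis .
    qed
    \<comment> \<open>Applied to e / (D + 1), since D may vanish.\<close>
    then have "\<bar>\<Sum>i\<in>I. c i * (\<integral>x. h (exp (- x)) \<partial>M i)\<bar> \<le> 0 + e" if "0 < e" for e
      using that D mult_le_cancel_left_pos[of "e / (D + 1)" D "D + 1"]
      by (smt (verit, ccfv_SIG) divide_pos_pos times_divide_eq_left nonzero_eq_divide_eq)
    then have "\<bar>\<Sum>i\<in>I. c i * (\<integral>x. h (exp (- x)) \<partial>M i)\<bar> \<le> 0"
      by (rule field_le_epsilon)
    then show ?thesis by simp
  qed
  \<comment> \<open>The case n = 0 compares total masses; the complement step of the induction below
    relies on it.\<close>
  have total: "(\<Sum>i\<in>I. c i * measure (M i) UNIV) = 0"
    using laplace[of 0] by (simp add: space_M)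
  have tail: "(\<Sum>i\<in>I. c i * measure (M i) {y<..}) = 0" for y
  proof (cases "y < 0")
    case True
    have "measure (M i) {y<..} = measure (M i) UNIV" if i: "i \<in> I" for i
    proof -
      interpret finite_measure "M i" using fin[OF i] .
      show ?thesis using pos[OF i]
        by (intro finite_measure_eq_AE) (auto simp: sets_M[OF i] elim!: eventually_mono intro: less_le_trans[OF True])
    qed
    then show ?thesis using total by simp
  next
    case False
    \<comment> \<open>Continuous functions of s = exp (- x) that increase with k to the indicator of
      s < exp (- y), that is, of x > y. Half-lines form an intersection-stable generator of the
      Borel sets.\<close>
    define h where "h k s = min 1 (max 0 (real k * (exp (- y) - s)))" for k s
    have h_cont: "continuous_on UNIV (h k)" for k unfolding h_def by (intro continuous_intros)
    have h_meas [measurable]: "h k \<in> borel_measurable borel" for k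
      by (rule borel_measurable_continuous_onI[OF h_cont])
    have lim: "(\<lambda>k. h k (exp (- x))) \<longlonglongrightarrow> indicator {y<..} x" for x
    proof (cases "y < x")
      case True
      then have d: "0 < exp (- y) - exp (- x)" by simp
      obtain k0 :: nat where k0: "1 / (exp (- y) - exp (- x)) \<le> real k0" using real_arch_simple by blast
      have "\<forall>\<^sub>F k in sequentially. h k (exp (- x)) = 1"
        using eventually_ge_at_top[of k0]
      proof eventually_elim
        case (elim k)
        then have "1 / (exp (- y) - exp (- x)) \<le> real k" using k0 by (simp add: order_trans)
        then have "1 \<le> real k * (exp (- y) - exp (- x))" using d by (simp add: divide_le_eq)
        then show ?case by (simp add: h_def)
      qed
      then show ?thesis using True by (simp add: tendsto_eventually)
    next
      case False
      then have "real k * (exp (- y) - exp (- x)) \<le> 0" for k by (simp add: mult_nonneg_nonpos)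
      then have "h k (exp (- x)) = 0" for k unfolding h_def by (simp add: max_absorb1)
      then show ?thesis using False by simp
    qed
    have lim_int: "(\<lambda>k. \<integral>x. h k (exp (- x)) \<partial>M i) \<longlonglongrightarrow> measure (M i) {y<..}" if i: "i \<in> I" for i
    proof -
      interpret finite_measure "M i" using fin[OF i] .
      have "(\<lambda>k. \<integral>x. h k (exp (- x)) \<partial>M i) \<longlonglongrightarrow> (\<integral>x. indicator {y<..} x \<partial>M i)"
      proof (rule integral_dominated_convergence[where w="\<lambda>_. 1"])
        show "(\<lambda>x. h k (exp (- x))) \<in> borel_measurable (M i)" for k
          by (simp cong: measurable_cong_sets add: sets_M[OF i])
        show "indicator {y<..} \<in> borel_measurable (M i)"
          by (simp cong: measurable_cong_sets add: sets_M[OF i])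
      qed (use lim in \<open>auto simp: h_def\<close>)
      then show ?thesis by (simp add: space_M[OF i])
    qed
    have "(\<lambda>k. \<Sum>i\<in>I. c i * (\<integral>x. h k (exp (- x)) \<partial>M i)) \<longlonglongrightarrow> (\<Sum>i\<in>I. c i * measure (M i) {y<..})"
      by (intro tendsto_sum tendsto_mult tendsto_const lim_int)
    then show ?thesis by (simp add: cont[OF h_cont] LIMSEQ_const_iff)
  qed
  have stable: "Int_stable (range greaterThan :: real set set)"
  proof -
    have "{a<..} \<inter> {b<..} = {max a b<..}" for a b :: real by auto
    then show ?thesis by (auto simp: Int_stable_def)
  qed
  have sub: "range greaterThan \<subseteq> Pow (UNIV :: real set)" by simp
  have "B \<in> sigma_sets UNIV (range greaterThan)"
    using B by (simp add: borel_Ioi)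
  with stable sub show ?thesis
  proof (induction rule: sigma_sets_induct_disjoint)
    case (basic A)
    then show ?case using tail by auto
  next
    case empty
    then show ?case by simp
  next
    case (compl A)
    then have A: "A \<in> sets borel" by (simp add: borel_Ioi)
    have "measure (M i) (UNIV - A) = measure (M i) UNIV - measure (M i) A" if i: "i \<in> I" for i
    proof -
      interpret finite_measure "M i" using fin[OF i] .
      show ?thesis using finite_measure_compl[of A] A by (simp add: space_M[OF i] sets_M[OF i])
    qed
    then show ?case using compl total by (simp add: right_diff_distrib sum_subtractf)
  next
    case (union A)
    then have A: "range A \<subseteq> sets borel" by (simp add: borel_Ioi)
    have "(\<lambda>k. measure (M i) (A k)) sums measure (M i) (\<Union>k. A k)" if i: "i \<in> I" for i
    proof -
      interpret finite_measure "M i" using fin[OF i] .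
      show ?thesis using finite_measure_UNION[OF _ union(1)] A by (simp add: sets_M[OF i])
    qed
    then have "(\<lambda>k. \<Sum>i\<in>I. c i * measure (M i) (A k)) sums (\<Sum>i\<in>I. c i * measure (M i) (\<Union>k. A k))"
      by (intro sums_sum sums_mult)
    then show ?case using union by (simp add: sums_iff)
  qed
qed

section \<open>Image series\<close>

lemma summable_exp_arith:
  fixes d s a :: real
  assumes "0 < d" "0 < s"
  shows "(\<lambda>n. exp (- ((a + d * real n) * s))) sums (exp (- (a * s)) / (1 - exp (- (d * s))))"
proof -
  have "(\<lambda>n. exp (- (a * s)) * exp (- (d * s)) ^ n) sums (exp (- (a * s)) * (1 / (1 - exp (- (d * s)))))"
    using assms by (intro sums_mult geometric_sums) auto
  moreover have "exp (- (a * s)) * exp (- (d * s)) ^ n = exp (- ((a + d * real n) * s))" for n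
    unfolding exp_of_nat_mult[symmetric] mult_exp_exp by (simp add: algebra_simps)
  ultimately show ?thesis by simp
qed

lemma summable_passage_density:
  assumes u: "u \<noteq> 0" and a: "0 < a" and d: "0 < d" and t: "0 < t"
  shows "summable (\<lambda>n. passage_density u (a + d * real n) t)"
proof -
  define \<kappa> where "\<kappa> = 1 / (2 * u\<^sup>2 * t)"
  define K where "K = 1 / (sqrt (2 * pi) * \<bar>u\<bar> * t powr (3/2))"
  have \<kappa>: "0 < \<kappa>" and K: "0 \<le> K" using u t by (auto simp: \<kappa>_def K_def)
  have bound: "passage_density u c t \<le> K * exp (1 / \<kappa>) * exp (- c)" if c: "0 < c" for c
  proof -
    \<comment> \<open>The square gives \<kappa> c^2 \<ge> 2 c - 1 / \<kappa>. One of the two units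
      of decay absorbs the prefactor via c \<le> exp c; the other is left for comparison with a
      geometric series.\<close>
    have "0 \<le> (\<kappa> * c - 1)\<^sup>2 / \<kappa>" using \<kappa> by simp
    also have "\<dots> = \<kappa> * c\<^sup>2 - 2 * c + 1 / \<kappa>" using \<kappa> by (simp add: field_simps power2_eq_square)
    finally have "c + - (\<kappa> * c\<^sup>2) \<le> 1 / \<kappa> + - c" by simp
    then have "exp c * exp (- (\<kappa> * c\<^sup>2)) \<le> exp (1 / \<kappa>) * exp (- c)"
      unfolding mult_exp_exp by simp
    moreover have "c * exp (- (\<kappa> * c\<^sup>2)) \<le> exp c * exp (- (\<kappa> * c\<^sup>2))"
      using exp_ge_add_one_self[of c] by (intro mult_right_mono exp_ge_zero) linarith
    ultimately have "c * exp (- (\<kappa> * c\<^sup>2)) \<le> exp (1 / \<kappa>) * exp (- c)" by linarith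
    then have "K * (c * exp (- (\<kappa> * c\<^sup>2))) \<le> K * (exp (1 / \<kappa>) * exp (- c))"
      using K by (rule mult_left_mono)
    moreover have "passage_density u c t = K * (c * exp (- (\<kappa> * c\<^sup>2)))"
      by (simp add: passage_density_def K_def \<kappa>_def)
    ultimately show ?thesis by (simp add: mult.assoc)
  qed
  have ap: "0 < a + d * real n" for n using a d by (simp add: add_pos_nonneg)
  show ?thesis
  proof (rule summable_comparison_test')
    show "summable (\<lambda>n. K * exp (1 / \<kappa>) * exp (- ((a + d * real n) * 1)))"
      using sums_summable[OF summable_exp_arith[OF d zero_less_one]] by (intro summable_mult) auto
    show "norm (passage_density u (a + d * real n) t) \<le> K * exp (1 / \<kappa>) * exp (- ((a + d * real n) * 1))"
      if "0 \<le> n" for n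
      using bound[OF ap[of n]] passage_density_nonneg[OF less_imp_le[OF ap[of n]], of u t] by simp
  qed
qed

text \<open>The signless half of an image series: levels a, a + d, a + 2 d and so on. Below, d = 4
  b, the period of repeated reflection in both ends of the interval. The indicator makes it a
  function on the whole line that vanishes off the positive times.\<close>

definition passage_series :: "real \<Rightarrow> real \<Rightarrow> real \<Rightarrow> real \<Rightarrow> real" where
  "passage_series u d a t = indicator {0<..} t * (\<Sum>n. passage_density u (a + d * real n) t)"

lemma passage_series_measurable [measurable]: "passage_series u d a \<in> borel_measurable borel"
  unfolding passage_series_def by measurable

lemma passage_series_nonneg:
  assumes "u \<noteq> 0" "0 < a" "0 < d"
  shows "0 \<le> passage_series u d a t"
proof (cases "0 < t")
  case True
  have "0 \<le> passage_density u (a + d * real n) t" for n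
    using assms by (intro passage_density_nonneg) (simp add: add_nonneg_nonneg)
  then show ?thesis
    using summable_passage_density[OF assms True] True by (simp add: passage_series_def suminf_nonneg)
qed (simp add: passage_series_def)

text \<open>All terms are nonnegative, so sum and integral commute, and the transforms exp (- (a + d
  n) s) form a geometric series.\<close>

lemma laplace_passage_series:
  assumes u: "u \<noteq> 0" and a: "0 < a" and d: "0 < d" and s: "0 < s"
  shows "has_bochner_integral lborel (\<lambda>t. exp (- (u\<^sup>2 * s\<^sup>2 / 2 * t)) * passage_series u d a t)
    (exp (- (a * s)) / (1 - exp (- (d * s))))"
proof (rule has_bochner_integral_nn_integral)
  have ap: "0 < a + d * real n" for n using a d by (simp add: add_pos_nonneg)
  note sums = summable_exp_arith[OF d s, of a]
  let ?g = "\<lambda>n t. indicator {0<..} t * (exp (- (u\<^sup>2 * s\<^sup>2 / 2 * t)) * passage_density u (a + d * real n) t)"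
  have g: "0 \<le> ?g n t" for n t
    using passage_density_nonneg[OF less_imp_le[OF ap[of n]]] by simp
  show "0 \<le> exp (- (a * s)) / (1 - exp (- (d * s)))" using d s by simp
  have "(\<integral>\<^sup>+ t. ennreal (exp (- (u\<^sup>2 * s\<^sup>2 / 2 * t)) * passage_series u d a t) \<partial>lborel)
     = (\<integral>\<^sup>+ t. (\<Sum>n. ennreal (?g n t)) \<partial>lborel)"
  proof (intro nn_integral_cong)
    fix t
    show "ennreal (exp (- (u\<^sup>2 * s\<^sup>2 / 2 * t)) * passage_series u d a t) = (\<Sum>n. ennreal (?g n t))"
    proof (cases "0 < t")
      case True
      note summ = summable_passage_density[OF u a d True]
      have "(\<Sum>n. ennreal (?g n t)) = ennreal (\<Sum>n. ?g n t)"
        using g True by (intro suminf_ennreal2 summable_mult summ)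
      also have "(\<Sum>n. ?g n t) = exp (- (u\<^sup>2 * s\<^sup>2 / 2 * t)) * passage_series u d a t"
        using True by (simp add: passage_series_def suminf_mult[OF summ])
      finally show ?thesis by simp
    qed (simp add: passage_series_def)
  qed
  also have "\<dots> = (\<Sum>n. \<integral>\<^sup>+ t. ennreal (?g n t) \<partial>lborel)"
    by (intro nn_integral_suminf) measurable
  also have "\<dots> = (\<Sum>n. ennreal (exp (- ((a + d * real n) * s))))"
    by (simp only: nn_integral_passage_density[OF u ap s])
  also have "\<dots> = ennreal (exp (- (a * s)) / (1 - exp (- (d * s))))"
    using sums by (subst suminf_ennreal2) (auto simp: sums_iff)
  finally show "(\<integral>\<^sup>+ t. ennreal (exp (- (u\<^sup>2 * s\<^sup>2 / 2 * t)) * passage_series u d a t) \<partial>lborel)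
     = ennreal (exp (- (a * s)) / (1 - exp (- (d * s))))" .
qed (use passage_series_nonneg[OF u a d] in auto)

text \<open>The terms with \<open>k < 0\<close> are the negative ones; they form the second series.\<close>

lemma image_series_eq:
  assumes u: "u \<noteq> 0" and y: "\<bar>y\<bar> < b" and t: "0 < t"
  shows "image_series u (exp b) (exp y) t = passage_series u (4 * b) (b + y) t - passage_series u (4 * b) (3 * b - y) t"
proof -
  have b: "0 < b" using y by linarith
  define q where "q k = passage_density u (y + (4 * real_of_int k + 1) * b) t" for k :: int
  have "ln (exp y * exp b powi (4 * k + 1)) = y + (4 * real_of_int k + 1) * b" for k :: int
    by (simp add: exp_power_int mult_exp_exp)
  then have img: "image_series u (exp b) (exp y) t = (\<Sum>\<^sub>\<infinity>k\<in>UNIV. q k)"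
    by (simp add: image_series_def q_def passage_density_def)
  \<comment> \<open>k = - n - 1 has level y - (4 n + 3) b, the negative of 3 b - y + 4 b n, and n
    ranges over the naturals exactly when k ranges over the negative integers.\<close>
  let ?neg = "\<lambda>n::nat. - int n - 1"
  have q_pos: "q (int n) = passage_density u (b + y + 4 * b * real n) t" for n
    by (simp add: q_def algebra_simps)
  have q_neg: "q (?neg n) = - passage_density u (3 * b - y + 4 * b * real n) t" for n
    unfolding passage_density_minus[symmetric] q_def by (simp add: algebra_simps)
  have pos: "(q has_sum passage_series u (4 * b) (b + y) t) (range int)"
  proof -
    have s: "summable (\<lambda>n. passage_density u (b + y + 4 * b * real n) t)"
      using y b by (intro summable_passage_density u t) auto
    have "0 \<le> passage_density u (b + y + 4 * b * real n) t" for n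
    proof -
      have "0 \<le> 4 * b * real n" using b by simp
      with y show ?thesis by (intro passage_density_nonneg) linarith
    qed
    then have "((q \<circ> int) has_sum passage_series u (4 * b) (b + y) t) UNIV"
      using s t summable_sums[OF s] by (intro norm_summable_imp_has_sum) (auto simp: q_pos passage_series_def o_def)
    then show ?thesis by (subst has_sum_reindex) auto
  qed
  have neg: "(q has_sum - passage_series u (4 * b) (3 * b - y) t) (range ?neg)"
  proof -
    have s: "summable (\<lambda>n. passage_density u (3 * b - y + 4 * b * real n) t)"
      using y b by (intro summable_passage_density u t) auto
    have "0 \<le> passage_density u (3 * b - y + 4 * b * real n) t" for n
    proof -
      have "0 \<le> 4 * b * real n" using b by simp
      with y show ?thesis by (intro passage_density_nonneg) linarith
    qed
    then have "((q \<circ> ?neg) has_sum - passage_series u (4 * b) (3 * b - y) t) UNIV"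
      using s t sums_minus[OF summable_sums[OF s]]
      by (intro norm_summable_imp_has_sum) (auto simp: q_neg passage_series_def o_def)
    then show ?thesis by (subst has_sum_reindex) (auto simp: inj_on_def)
  qed
  have disj: "range int \<inter> range ?neg = {}" by auto
  have "k \<in> range int \<union> range ?neg" for k :: int
  proof (cases "0 \<le> k")
    case True
    then have "k = int (nat k)" by simp
    then show ?thesis by blast
  next
    case False
    then have "k = ?neg (nat (- k - 1))" by simp
    then show ?thesis by blast
  qed
  then have "range int \<union> range ?neg = UNIV" by blast
  with has_sum_Un_disjoint[OF pos neg disj] show ?thesis
    unfolding img by (metis infsumI add_uminus_conv_diff)
qed

text \<open>The candidate \<open>Fp - Fm\<close> need not be nonnegative in advance, so it defines
  no measure yet. Moving the negative part to the other side leaves a relation between three finite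
  measures, the law of T and the densities \<open>Fm\<close> and \<open>Fp\<close>, to which the
  signed uniqueness lemma applies.\<close>

lemma has_density_on_pos_of_laplace:
  assumes N: "prob_space N" and T [measurable]: "T \<in> borel_measurable N"
    and fin: "AE \<omega> in N. T \<omega> < \<infinity>"
    and Fp: "integrable lborel Fp" "\<And>t. 0 \<le> Fp t" "\<And>t. t \<le> 0 \<Longrightarrow> Fp t = 0"
    and Fm: "integrable lborel Fm" "\<And>t. 0 \<le> Fm t" "\<And>t. t \<le> 0 \<Longrightarrow> Fm t = 0"
    and laplace: "\<And>n::nat. (\<integral> \<omega>. exp (- (real n * enn2real (T \<omega>))) \<partial>N) + (\<integral> t. exp (- (real n * t)) * Fm t \<partial>lborel)
      = (\<integral> t. exp (- (real n * t)) * Fp t \<partial>lborel)"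
    and f: "\<And>t. 0 < t \<Longrightarrow> f t = Fp t - Fm t"
  shows "has_density_on_pos N T f"
proof -
  interpret N: prob_space N by fact
  note [measurable] = borel_measurable_integrable[OF Fp(1)] borel_measurable_integrable[OF Fm(1)]
  let ?X = "\<lambda>\<omega>. enn2real (T \<omega>)"
  define M where "M i = (if i = 0 then distr N borel ?X else if i = 1 then density lborel Fm else density lborel Fp)" for i :: nat
  define c where "c i = (if i = 2 then - 1 else 1 :: real)" for i :: nat
  have dens: "measure (density lborel F) B = (\<integral>t. indicator B t * F t \<partial>lborel)" "finite_measure (density lborel F)"
    if F: "integrable lborel F" "\<And>t. 0 \<le> F t" and B: "B \<in> sets borel" for F B
  proof -
    have [measurable]: "F \<in> borel_measurable borel" using F by auto
    have eq: "emeasure (density lborel F) B = ennreal (\<integral>t. indicator B t * F t \<partial>lborel)" if "B \<in> sets borel" for B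
    proof -
      have "emeasure (density lborel F) B = (\<integral>\<^sup>+ t. ennreal (indicator B t * F t) \<partial>lborel)"
        using that by (subst emeasure_density) (auto intro!: nn_integral_cong split: split_indicator)
      also have "\<dots> = ennreal (\<integral>t. indicator B t * F t \<partial>lborel)"
        using F integrable_mult_indicator[OF _ F(1), of B] that by (intro nn_integral_eq_integral) auto
      finally show ?thesis .
    qed
    show "measure (density lborel F) B = (\<integral>t. indicator B t * F t \<partial>lborel)"
      using eq[OF B] F by (simp add: measure_def integral_nonneg_AE)
    show "finite_measure (density lborel F)"
      by (rule finite_measureI) (simp add: eq)
  qed
  have law: "(\<Sum>i\<in>{0,1,2}. c i * measure (M i) B) = 0" if B: "B \<in> sets borel" for B
  proof (rule signed_measure_zero_of_laplace[OF _ _ _ _ _ B])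
    fix i :: nat
    show "finite_measure (M i)"
      using dens(2)[OF Fp(1,2)] dens(2)[OF Fm(1,2)] N.finite_measure_distr[of ?X borel] by (auto simp: M_def)
    show "sets (M i) = sets borel" by (simp add: M_def)
    have dpos: "AE x in density lborel F. 0 \<le> x" if "F \<in> borel_measurable borel" "\<And>t. t \<le> 0 \<Longrightarrow> F t = 0" for F :: "real \<Rightarrow> real"
    proof -
      have "0 < ennreal (F x) \<longrightarrow> 0 \<le> x" for x
        using that(2)[of x] by (cases "x \<le> 0") auto
      then show ?thesis using that(1) by (subst AE_density) auto
    qed
    have "AE x in distr N borel ?X. 0 \<le> x"
      by (subst AE_distr_iff) auto
    moreover have "AE x in density lborel Fp. 0 \<le> x" "AE x in density lborel Fm. 0 \<le> x"
      using Fp(3) Fm(3) by (auto intro!: dpos)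
    ultimately show "AE x in M i. 0 \<le> x"
      unfolding M_def by (simp split: if_split)
  next
    fix n :: nat
    have "(\<integral>x. exp (- (real n * x)) \<partial>distr N borel ?X) = (\<integral> \<omega>. exp (- (real n * enn2real (T \<omega>))) \<partial>N)"
      by (rule integral_distr) measurable
    moreover have "(\<integral>x. exp (- (real n * x)) \<partial>density lborel F) = (\<integral> t. exp (- (real n * t)) * F t \<partial>lborel)"
      if "F \<in> borel_measurable borel" "\<And>t. 0 \<le> F t" for F
      using that by (subst integral_density) (auto simp: mult.commute)
    ultimately show "(\<Sum>i\<in>{0,1,2}. c i * (\<integral>x. exp (- (real n * x)) \<partial>M i)) = 0"
      using laplace[of n] Fp(2) Fm(2) by (simp add: c_def M_def)
  qed simp
  have key: "measure (distr N borel ?X) B = (\<integral>t. indicator B t * (Fp t - Fm t) \<partial>lborel)" if B: "B \<in> sets borel" for B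
  proof -
    have "measure (distr N borel ?X) B = measure (density lborel Fp) B - measure (density lborel Fm) B"
      using law[OF B] by (simp add: c_def M_def)
    also have "\<dots> = (\<integral>t. indicator B t * (Fp t - Fm t) \<partial>lborel)"
      using integrable_mult_indicator[OF _ Fp(1), of B] integrable_mult_indicator[OF _ Fm(1), of B] B
      by (simp add: dens[OF Fp(1,2)] dens[OF Fm(1,2)] right_diff_distrib)
    finally show ?thesis .
  qed
  have intd: "integrable lborel (\<lambda>t. indicator B t * (Fp t - Fm t))" if "B \<in> sets borel" for B
    using integrable_mult_indicator[of B lborel "\<lambda>t. Fp t - Fm t"] Fp(1) Fm(1) that by simp
  have le: "AE t in lborel. Fm t \<le> Fp t"
  proof -
    \<comment> \<open>Nonnegativity comes from the law: on the set where the candidate is negative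
      its integral equals a probability, so the set is null.\<close>
    define B where "B = {t. Fp t < Fm t}"
    have B: "B \<in> sets borel" unfolding B_def by measurable
    have int: "integrable lborel (\<lambda>t. indicator B t * (Fm t - Fp t))"
      using integrable_mult_indicator[of B lborel "\<lambda>t. Fm t - Fp t"] Fp(1) Fm(1) B by simp
    have nn: "0 \<le> indicator B t * (Fm t - Fp t)" for t by (auto simp: B_def split: split_indicator)
    have "(\<integral>t. indicator B t * (Fm t - Fp t) \<partial>lborel) = - (\<integral>t. indicator B t * (Fp t - Fm t) \<partial>lborel)"
      by (subst Bochner_Integration.integral_minus[symmetric]) (simp add: right_diff_distrib)
    also have "\<dots> \<le> 0" by (simp flip: key[OF B])
    finally have "(\<integral>t. indicator B t * (Fm t - Fp t) \<partial>lborel) = 0"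
      using nn by (intro antisym integral_nonneg_AE) auto
    then have "AE t in lborel. indicator B t * (Fm t - Fp t) = 0"
      using integral_nonneg_eq_0_iff_AE[OF int] nn by simp
    then show ?thesis by eventually_elim (auto simp: B_def split: split_indicator_asm)
  qed
  have f_eq: "ennreal (f t) * indicator {0<..} t = ennreal (Fp t - Fm t)" for t
    using f Fp(3) Fm(3) by (cases "0 < t") auto
  have "distr N lborel ?X = density lborel (\<lambda>t. ennreal (f t) * indicator {0<..} t)"
  proof (rule measure_eqI)
    fix B assume "B \<in> sets (distr N lborel ?X)"
    then have B: "B \<in> sets borel" by simp
    have "emeasure (distr N lborel ?X) B = emeasure (distr N borel ?X) B"
      using B by (simp add: emeasure_distr)
    also have "\<dots> = ennreal (\<integral>t. indicator B t * (Fp t - Fm t) \<partial>lborel)"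
      using N.finite_measure_distr[of ?X borel] by (simp add: finite_measure.emeasure_eq_measure key[OF B])
    also have "\<dots> = (\<integral>\<^sup>+ t. ennreal (indicator B t * (Fp t - Fm t)) \<partial>lborel)"
      using le by (intro nn_integral_eq_integral[symmetric] intd B) (auto elim!: eventually_mono)
    also have "\<dots> = emeasure (density lborel (\<lambda>t. ennreal (f t) * indicator {0<..} t)) B"
      unfolding f_eq using B by (subst emeasure_density) (auto intro!: nn_integral_cong split: split_indicator)
    finally show "emeasure (distr N lborel ?X) B = emeasure (density lborel (\<lambda>t. ennreal (f t) * indicator {0<..} t)) B" .
  qed simp
  then have "distributed N lborel ?X (\<lambda>t. ennreal (f t) * indicator {0<..} t)"
    unfolding distributed_def f_eq by simp
  moreover have "AE t in lborel. 0 < t \<longrightarrow> 0 \<le> f t"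
    using le by eventually_elim (simp add: f)
  ultimately show ?thesis using fin by (simp add: has_density_on_pos_def)
qed

section \<open>Law of the exit time\<close>

context drifted_brownian_motion
begin

lemma exits_disjoint: "exits_at b \<inter> exits_at (- b) = {}"
  using x0 by (auto simp: exits_at_def)

lemma exits_union: "exits_at b \<union> exits_at (- b) = {\<omega> \<in> space N. T \<omega> < \<infinity>}"
proof (intro set_eqI)
  fix \<omega>
  show "\<omega> \<in> exits_at b \<union> exits_at (- b) \<longleftrightarrow> \<omega> \<in> {\<omega> \<in> space N. T \<omega> < \<infinity>}"
  proof (cases "\<omega> \<in> space N")
    case True
    then show ?thesis
      by (cases rule: T_cases) (auto simp: exits_at_def abs_if split: if_splits)
  qed (auto simp: exits_at_def)
qed

section \<open>Exit probabilities and mean as the Laplace variable tends to zero\<close>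

definition \<beta> :: "real \<Rightarrow> real" where
  "\<beta> \<alpha> = sqrt (2 * \<alpha> / u\<^sup>2 + 1 / 4)"

definition \<alpha>s :: "nat \<Rightarrow> real" where
  "\<alpha>s n = 1 / real (Suc n)"

text \<open>The root of \<open>(\<delta> \<epsilon> + \<delta>\<^sup>2) u\<^sup>2 / 2 = \<alpha>\<close> that tends to \<open>0\<close> with \<open>\<alpha>\<close>.\<close>

definition \<delta>s :: "nat \<Rightarrow> real" where
  "\<delta>s n = \<epsilon> * (\<beta> (\<alpha>s n) - 1 / 2)"

lemma b_pos: "0 < b"
  using x0 by linarith

lemma \<alpha>s_pos: "0 < \<alpha>s n"
  by (simp add: \<alpha>s_def)

lemma \<alpha>s_lim: "\<alpha>s \<longlonglongrightarrow> 0"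
  unfolding \<alpha>s_def using LIMSEQ_Suc[OF lim_1_over_n] by simp

lemma \<beta>_lim: "(\<lambda>n. \<beta> (\<alpha>s n)) \<longlonglongrightarrow> 1 / 2"
proof -
  have "(\<lambda>n. \<beta> (\<alpha>s n)) \<longlonglongrightarrow> sqrt (2 * 0 / u\<^sup>2 + 1 / 4)"
    unfolding \<beta>_def using u_nonzero by (intro tendsto_intros \<alpha>s_lim) auto
  then show ?thesis by (simp add: real_sqrt_divide)
qed

lemma \<delta>s_lim: "\<delta>s \<longlonglongrightarrow> 0"
proof -
  have "\<delta>s \<longlonglongrightarrow> \<epsilon> * (1 / 2 - 1 / 2)"
    unfolding \<delta>s_def by (intro tendsto_intros \<beta>_lim)
  then show ?thesis by simp
qed

lemma \<epsilon>_sq: "\<epsilon> * \<epsilon> = 1"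
  using \<epsilon> by auto

lemma \<delta>s_root: "(\<delta>s n * \<epsilon> + (\<delta>s n)\<^sup>2) * u\<^sup>2 / 2 = \<alpha>s n"
proof -
  have u2: "0 < u\<^sup>2" using u_nonzero by simp
  have "(\<beta> (\<alpha>s n))\<^sup>2 = 2 * \<alpha>s n / u\<^sup>2 + 1 / 4"
    unfolding \<beta>_def using u2 less_imp_le[OF \<alpha>s_pos] by simp
  moreover have "\<delta>s n * \<epsilon> + (\<delta>s n)\<^sup>2 = (\<epsilon> * \<epsilon>) * ((\<beta> (\<alpha>s n) - 1 / 2) + (\<beta> (\<alpha>s n) - 1 / 2)\<^sup>2)"
    unfolding \<delta>s_def by (simp add: power2_eq_square algebra_simps)
  ultimately have "\<delta>s n * \<epsilon> + (\<delta>s n)\<^sup>2 = 2 * \<alpha>s n / u\<^sup>2"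
    by (simp add: \<epsilon>_sq power2_eq_square algebra_simps)
  then show ?thesis using u2 by simp
qed

lemma \<delta>s_nonzero: "\<delta>s n \<noteq> 0"
  using \<delta>s_root[of n] \<alpha>s_pos[of n] by auto

lemma exit_transform_lim: "(\<lambda>n. exit_transform y (\<alpha>s n)) \<longlonglongrightarrow> measure N (exits_at y)"
proof -
  have "(\<lambda>n. \<integral> \<omega>. indicator (exits_at y) \<omega> * exp_neg (\<alpha>s n) (T \<omega>) \<partial>N) \<longlonglongrightarrow> (\<integral> \<omega>. indicator (exits_at y) \<omega> \<partial>N)"
  proof (rule integral_dominated_convergence[where w="\<lambda>_. 1"])
    have "(\<lambda>n. indicator (exits_at y) \<omega> * exp_neg (\<alpha>s n) (T \<omega>)) \<longlonglongrightarrow> (indicator (exits_at y) \<omega> :: real)" for \<omega>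
    proof (cases "\<omega> \<in> exits_at y")
      case True
      have "(\<lambda>n. exp (- \<alpha>s n * enn2real (T \<omega>))) \<longlonglongrightarrow> exp (- 0 * enn2real (T \<omega>))"
        by (intro tendsto_intros \<alpha>s_lim)
      moreover have "exp_neg (\<alpha>s n) (T \<omega>) = exp (- \<alpha>s n * enn2real (T \<omega>))" for n
        using True by (auto simp: exits_at_def exp_neg_def)
      ultimately show ?thesis using True by simp
    qed simp
    then show "AE \<omega> in N. (\<lambda>n. indicator (exits_at y) \<omega> * exp_neg (\<alpha>s n) (T \<omega>)) \<longlonglongrightarrow> (indicator (exits_at y) \<omega> :: real)"
      by simp
  qed (use less_imp_le[OF \<alpha>s_pos] in \<open>auto simp: exp_neg_bounds indicator_def\<close>)
  then show ?thesis by (simp add: exit_transform_def)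
qed

text \<open>Subtracting the sum of the transforms from \<open>exit_transform_equation\<close> and
  dividing by \<delta> leaves difference quotients of exp at 0. The limit has two uses: multiplied
  by \<delta> it shows that T is finite, and multiplied by \<delta> / \<alpha> it gives the
  mean.\<close>

lemma transform_sum_lim:
  "(\<lambda>n. (1 - (exit_transform b (\<alpha>s n) + exit_transform (- b) (\<alpha>s n))) / \<delta>s n) \<longlonglongrightarrow>
    (b - x0) * measure N (exits_at b) - (b + x0) * measure N (exits_at (- b))"
proof -
  have d: "(\<lambda>n. (exp (\<delta>s n * c) - 1) / \<delta>s n) \<longlonglongrightarrow> c" for c :: real
  proof -
    have "DERIV (\<lambda>x. exp (x * c)) 0 :> c"
      by (auto intro!: derivative_eq_intros)
    then have "((\<lambda>x. (exp (x * c) - 1) / x) \<longlongrightarrow> c) (at 0)"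
      by (simp add: has_field_derivative_iff)
    moreover have "filterlim \<delta>s (at 0) sequentially"
      using \<delta>s_lim \<delta>s_nonzero by (simp add: filterlim_at)
    ultimately show ?thesis by (rule filterlim_compose)
  qed
  have "(\<lambda>n. (exp (\<delta>s n * (b - x0)) - 1) / \<delta>s n * exit_transform b (\<alpha>s n)
      + (exp (\<delta>s n * (- b - x0)) - 1) / \<delta>s n * exit_transform (- b) (\<alpha>s n))
    \<longlonglongrightarrow> (b - x0) * measure N (exits_at b) + (- b - x0) * measure N (exits_at (- b))"
    by (intro tendsto_intros d exit_transform_lim)
  moreover have "(exp (\<delta>s n * (b - x0)) - 1) / \<delta>s n * exit_transform b (\<alpha>s n)
      + (exp (\<delta>s n * (- b - x0)) - 1) / \<delta>s n * exit_transform (- b) (\<alpha>s n)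
    = (1 - (exit_transform b (\<alpha>s n) + exit_transform (- b) (\<alpha>s n))) / \<delta>s n" for n
  proof -
    have "(exp (\<delta>s n * (b - x0)) - 1) / \<delta>s n * exit_transform b (\<alpha>s n)
        + (exp (\<delta>s n * (- b - x0)) - 1) / \<delta>s n * exit_transform (- b) (\<alpha>s n)
      = ((exp (\<delta>s n * (b - x0)) * exit_transform b (\<alpha>s n) + exp (\<delta>s n * (- b - x0)) * exit_transform (- b) (\<alpha>s n))
        - (exit_transform b (\<alpha>s n) + exit_transform (- b) (\<alpha>s n))) / \<delta>s n"
      by (simp add: add_divide_distrib diff_divide_distrib algebra_simps)
    then show ?thesis by (simp only: exit_transform_equation[OF \<alpha>s_pos \<delta>s_root])
  qed
  ultimately show ?thesis by (simp add: algebra_simps)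
qed

text \<open>The quotient in \<open>transform_sum_lim\<close> converges to a finite value while its
  denominator tends to 0, so its numerator tends to 0 as well.\<close>

lemma prob_exits_sum: "measure N (exits_at b) + measure N (exits_at (- b)) = 1"
proof -
  have "(\<lambda>n. (1 - (exit_transform b (\<alpha>s n) + exit_transform (- b) (\<alpha>s n))) / \<delta>s n * \<delta>s n) \<longlonglongrightarrow>
    ((b - x0) * measure N (exits_at b) - (b + x0) * measure N (exits_at (- b))) * 0"
    by (intro tendsto_mult transform_sum_lim \<delta>s_lim)
  then have "(\<lambda>n. 1 - (exit_transform b (\<alpha>s n) + exit_transform (- b) (\<alpha>s n))) \<longlonglongrightarrow> 0"
    using \<delta>s_nonzero by simp
  moreover have "(\<lambda>n. 1 - (exit_transform b (\<alpha>s n) + exit_transform (- b) (\<alpha>s n))) \<longlonglongrightarrow>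
    1 - (measure N (exits_at b) + measure N (exits_at (- b)))"
    by (intro tendsto_intros exit_transform_lim)
  ultimately have "0 = 1 - (measure N (exits_at b) + measure N (exits_at (- b)))"
    by (rule LIMSEQ_unique)
  then show ?thesis by simp
qed

lemma T_finite: "AE \<omega> in N. T \<omega> < \<infinity>"
proof -
  have "prob {\<omega> \<in> space N. T \<omega> < \<infinity>} = prob (exits_at b) + prob (exits_at (- b))"
    unfolding exits_union[symmetric] by (rule finite_measure_Union) (auto simp: exits_disjoint)
  then have "prob {\<omega> \<in> space N. T \<omega> < \<infinity>} = 1" by (simp add: prob_exits_sum)
  moreover have "{\<omega> \<in> space N. T \<omega> < \<infinity>} \<in> sets N" by measurable
  ultimately show ?thesis by (simp add: prob_Collect_eq_1)
qed

lemma prob_exits_at_b: "measure N (exits_at b) = exp (\<epsilon> * (b - x0) / 2) * (sinh ((b + x0) / 2) / sinh b)"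
proof -
  have "sinh (2 * (1 / 2) * b) \<noteq> 0" using b_pos by simp
  then have "(\<lambda>n. exp (\<epsilon> * (b - x0) / 2) * (sinh (\<beta> (\<alpha>s n) * (b + x0)) / sinh (2 * \<beta> (\<alpha>s n) * b))) \<longlonglongrightarrow>
     exp (\<epsilon> * (b - x0) / 2) * (sinh (1 / 2 * (b + x0)) / sinh (2 * (1 / 2) * b))"
    by (intro tendsto_intros \<beta>_lim)
  then have "(\<lambda>n. exit_transform b (\<alpha>s n)) \<longlonglongrightarrow> exp (\<epsilon> * (b - x0) / 2) * (sinh ((b + x0) / 2) / sinh b)"
    by (simp add: exit_transform_eq[OF \<alpha>s_pos] \<beta>_def)
  then show ?thesis
    using LIMSEQ_unique[OF exit_transform_lim[of b]] by simp
qed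

lemma expectation_exp_neg:
  assumes \<alpha>: "0 < \<alpha>"
  shows "(\<integral> \<omega>. exp_neg \<alpha> (T \<omega>) \<partial>N) = exit_transform b \<alpha> + exit_transform (- b) \<alpha>"
proof -
  have int: "integrable N (\<lambda>\<omega>. indicator (exits_at y) \<omega> * exp_neg \<alpha> (T \<omega>))" for y
    by (rule integrable_const_bound[where B=1]) (use \<alpha> in \<open>auto simp: exp_neg_bounds indicator_def\<close>)
  have "(\<integral> \<omega>. exp_neg \<alpha> (T \<omega>) \<partial>N) =
      (\<integral> \<omega>. indicator (exits_at b) \<omega> * exp_neg \<alpha> (T \<omega>) + indicator (exits_at (- b)) \<omega> * exp_neg \<alpha> (T \<omega>) \<partial>N)"
  proof (rule Bochner_Integration.integral_cong[OF refl])
    fix \<omega> assume \<omega>: "\<omega> \<in> space N"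
    show "exp_neg \<alpha> (T \<omega>) = indicator (exits_at b) \<omega> * exp_neg \<alpha> (T \<omega>) + indicator (exits_at (- b)) \<omega> * exp_neg \<alpha> (T \<omega>)"
    proof (cases "T \<omega> = \<infinity>")
      case False
      then have "\<omega> \<in> exits_at b \<union> exits_at (- b)" unfolding exits_union using \<omega> by (simp add: less_top)
      then show ?thesis using exits_disjoint by (auto split: split_indicator)
    qed (simp add: exp_neg_def)
  qed
  also have "\<dots> = exit_transform b \<alpha> + exit_transform (- b) \<alpha>"
    using int by (simp add: exit_transform_def)
  finally show ?thesis .
qed

text \<open>The variables (1 - exp (- \<alpha> T)) / \<alpha> are at most T and converge to it:
  Fatou bounds the mean of T above by the limit of their means, domination bounds it below, so
  integrability of T is a result. The value is the mean displacement at the exit divided by the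
  drift \<epsilon> u^2 / 2.\<close>

lemma T_has_mean:
  "has_mean N T (\<epsilon> * (2 / u\<^sup>2) * (2 * b * measure N (exits_at b) - (b + x0)))"
proof -
  let ?q = "measure N (exits_at b)"
  define m where "m = \<epsilon> * (2 / u\<^sup>2) * (2 * b * ?q - (b + x0))"
  define g where "g n \<omega> = (1 - exp_neg (\<alpha>s n) (T \<omega>)) / \<alpha>s n" for n \<omega>
  have u2: "0 < u\<^sup>2" using u_nonzero by simp
  have g_nonneg: "0 \<le> g n \<omega>" for n \<omega>
    unfolding g_def using exp_neg_bounds(2)[OF less_imp_le[OF \<alpha>s_pos]] less_imp_le[OF \<alpha>s_pos[of n]]
    by (intro divide_nonneg_nonneg) auto
  have g_meas [measurable]: "g n \<in> borel_measurable N" for n unfolding g_def by measurable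
  have g_int: "integrable N (g n)" for n
  proof -
    have "integrable N (\<lambda>\<omega>. exp_neg (\<alpha>s n) (T \<omega>))"
      by (rule integrable_const_bound[where B=1]) (use less_imp_le[OF \<alpha>s_pos] in \<open>auto simp: exp_neg_bounds\<close>)
    then show ?thesis unfolding g_def by auto
  qed
  have g_integral: "integral\<^sup>L N (g n) = (1 - (exit_transform b (\<alpha>s n) + exit_transform (- b) (\<alpha>s n))) / \<alpha>s n" for n
  proof -
    have "integrable N (\<lambda>\<omega>. exp_neg (\<alpha>s n) (T \<omega>))"
      by (rule integrable_const_bound[where B=1]) (use less_imp_le[OF \<alpha>s_pos] in \<open>auto simp: exp_neg_bounds\<close>)
    then show ?thesis
      unfolding g_def by (simp add: expectation_exp_neg[OF \<alpha>s_pos] prob_space)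
  qed
  \<comment> \<open>From \<alpha> = \<delta> (\<epsilon> + \<delta>) u^2 / 2 the ratio tends to 2 /
    (\<epsilon> u^2), and 1 / \<epsilon> = \<epsilon>.\<close>
  have ratio: "(\<lambda>n. \<delta>s n / \<alpha>s n) \<longlonglongrightarrow> \<epsilon> * (2 / u\<^sup>2)"
  proof -
    have "\<epsilon> \<noteq> 0" using \<epsilon> by auto
    then have "(\<lambda>n. 1 / ((\<epsilon> + \<delta>s n) * u\<^sup>2 / 2)) \<longlonglongrightarrow> 1 / ((\<epsilon> + 0) * u\<^sup>2 / 2)"
      using u2 by (intro tendsto_intros \<delta>s_lim) auto
    moreover have "1 / ((\<epsilon> + \<delta>s n) * u\<^sup>2 / 2) = \<delta>s n / \<alpha>s n" for n
    proof -
      have "\<alpha>s n = \<delta>s n * ((\<epsilon> + \<delta>s n) * u\<^sup>2 / 2)"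
        unfolding \<delta>s_root[of n, symmetric] by (simp add: power2_eq_square algebra_simps)
      then have "\<delta>s n / \<alpha>s n = \<delta>s n / (\<delta>s n * ((\<epsilon> + \<delta>s n) * u\<^sup>2 / 2))" by (rule arg_cong)
      also have "\<dots> = 1 / ((\<epsilon> + \<delta>s n) * u\<^sup>2 / 2)"
        by (rule nonzero_divide_mult_cancel_left[OF \<delta>s_nonzero])
      finally show ?thesis by (rule sym)
    qed
    moreover have "1 / ((\<epsilon> + 0) * u\<^sup>2 / 2) = \<epsilon> * (2 / u\<^sup>2)" using \<epsilon> by auto
    ultimately show ?thesis by simp
  qed
  have g_lim: "(\<lambda>n. integral\<^sup>L N (g n)) \<longlonglongrightarrow> m"
  proof -
    have "(\<lambda>n. \<delta>s n / \<alpha>s n * ((1 - (exit_transform b (\<alpha>s n) + exit_transform (- b) (\<alpha>s n))) / \<delta>s n)) \<longlonglongrightarrow>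
      \<epsilon> * (2 / u\<^sup>2) * ((b - x0) * ?q - (b + x0) * measure N (exits_at (- b)))"
      by (intro tendsto_mult ratio transform_sum_lim)
    moreover have "(b - x0) * ?q - (b + x0) * measure N (exits_at (- b)) = 2 * b * ?q - (b + x0)"
    proof -
      have compl: "measure N (exits_at (- b)) = 1 - ?q" using prob_exits_sum by simp
      show ?thesis unfolding compl by (simp add: algebra_simps)
    qed
    ultimately show ?thesis
      using \<delta>s_nonzero by (simp add: g_integral m_def)
  qed
  have nn: "(\<integral>\<^sup>+ \<omega>. ennreal (g n \<omega>) \<partial>N) = ennreal (integral\<^sup>L N (g n))" for n
    using g_int g_nonneg by (intro nn_integral_eq_integral) auto
  have nn_lim: "(\<lambda>n. \<integral>\<^sup>+ \<omega>. ennreal (g n \<omega>) \<partial>N) \<longlonglongrightarrow> ennreal m"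
    unfolding nn by (intro tendsto_ennrealI g_lim)
  have m0: "0 \<le> m"
    by (rule LIMSEQ_le_const[OF g_lim]) (use g_nonneg in auto)
  have pointwise: "(\<lambda>n. ennreal (g n \<omega>)) \<longlonglongrightarrow> T \<omega>" and le: "ennreal (g n \<omega>) \<le> T \<omega>" if fin: "T \<omega> < \<infinity>" for n \<omega>
  proof -
    obtain t where t: "0 \<le> t" "T \<omega> = ennreal t" using fin by (cases "T \<omega>") auto
    have g_eq: "g n \<omega> = (1 - exp (- \<alpha>s n * t)) / \<alpha>s n" for n
      using t by (simp add: g_def exp_neg_def)
    have "DERIV (\<lambda>x. - exp (- x * t)) 0 :> t"
      by (auto intro!: derivative_eq_intros)
    then have "((\<lambda>x. (1 - exp (- x * t)) / x) \<longlongrightarrow> t) (at 0)"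
      by (simp add: has_field_derivative_iff)
    moreover have "filterlim \<alpha>s (at 0) sequentially"
      using \<alpha>s_lim \<alpha>s_pos by (auto simp: filterlim_at less_imp_neq[THEN not_sym])
    ultimately have "(\<lambda>n. (1 - exp (- \<alpha>s n * t)) / \<alpha>s n) \<longlonglongrightarrow> t" by (rule filterlim_compose)
    then show "(\<lambda>n. ennreal (g n \<omega>)) \<longlonglongrightarrow> T \<omega>"
      unfolding t(2) g_eq by (rule tendsto_ennrealI)
    have "1 - exp (- \<alpha>s n * t) \<le> t * \<alpha>s n"
      using exp_ge_add_one_self[of "- \<alpha>s n * t"] by (simp add: mult.commute)
    then have "g n \<omega> \<le> t" unfolding g_eq using \<alpha>s_pos by (simp add: divide_le_eq)
    then show "ennreal (g n \<omega>) \<le> T \<omega>" unfolding t(2) by (rule ennreal_leI)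
  qed
  have "T \<omega> = liminf (\<lambda>n. ennreal (g n \<omega>))" if "T \<omega> < \<infinity>" for \<omega>
    using lim_imp_Liminf[OF sequentially_bot pointwise[OF that]] by simp
  then have "(\<integral>\<^sup>+ \<omega>. T \<omega> \<partial>N) = (\<integral>\<^sup>+ \<omega>. liminf (\<lambda>n. ennreal (g n \<omega>)) \<partial>N)"
    using T_finite by (intro nn_integral_cong_AE) (rule eventually_mono)
  also have "\<dots> \<le> liminf (\<lambda>n. \<integral>\<^sup>+ \<omega>. ennreal (g n \<omega>) \<partial>N)"
    by (rule nn_integral_liminf) measurable
  also have "\<dots> = ennreal m"
    by (rule lim_imp_Liminf[OF sequentially_bot nn_lim])
  finally have upper: "(\<integral>\<^sup>+ \<omega>. T \<omega> \<partial>N) \<le> ennreal m" .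
  have "(\<integral>\<^sup>+ \<omega>. ennreal (g n \<omega>) \<partial>N) \<le> (\<integral>\<^sup>+ \<omega>. T \<omega> \<partial>N)" for n
    using T_finite by (intro nn_integral_mono_AE) (auto elim!: eventually_mono intro: le)
  then have "ennreal m \<le> (\<integral>\<^sup>+ \<omega>. T \<omega> \<partial>N)"
    by (intro LIMSEQ_le_const2[OF nn_lim]) auto
  with upper m0 show ?thesis by (simp add: has_mean_def m_def)
qed

text \<open>Expanding 1 / sinh (2 s b) in powers of exp (- 4 b s) produces the images: positive ones
  at b + y + 4 b n and negative ones at 3 b - y + 4 b n. Here both geometric series are already
  summed, and what remains is cross-multiplication.\<close>

lemma sinh_ratio:
  assumes "0 < s"
  shows "exp (- ((b + y) * s)) / (1 - exp (- (4 * b * s))) - exp (- ((3 * b - y) * s)) / (1 - exp (- (4 * b * s)))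
    = sinh (s * (b - y)) / sinh (2 * s * b)"
proof -
  define e1 e3 k h h' p q where "e1 = exp (- ((b + y) * s))" and "e3 = exp (- ((3 * b - y) * s))"
    and "k = exp (- (4 * b * s))" and "h = exp (s * (b - y))" and "h' = exp (- (s * (b - y)))"
    and "p = exp (2 * s * b)" and "q = exp (- (2 * s * b))"
  note defs = e1_def e3_def k_def h_def h'_def p_def q_def
  have k: "k \<noteq> 1" using assms b_pos by (simp add: k_def)
  have pq: "p - q \<noteq> 0"
  proof -
    have "sinh (2 * s * b) \<noteq> 0" using assms b_pos by simp
    then show ?thesis by (simp add: sinh_def p_def q_def)
  qed
  have "e1 * p = h" "e1 * q = k * h" "e3 * p = h'" "e3 * q = k * h'"
    unfolding defs mult_exp_exp by (simp_all add: algebra_simps)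
  then have "(e1 - e3) * (p - q) = (1 - k) * (h - h')"
    by (simp add: left_diff_distrib right_diff_distrib)
  then have "(e1 - e3) / (1 - k) = (h - h') / (p - q)"
    using k pq by (simp add: frac_eq_eq mult.commute)
  moreover have S: "sinh (s * (b - y)) = (h - h') / 2" "sinh (2 * s * b) = (p - q) / 2"
    by (simp_all add: sinh_field_def defs)
  have "sinh (s * (b - y)) / sinh (2 * s * b) = (h - h') / (p - q)"
  proof -
    have "(x / 2) / (z / 2) = x / z" for x z :: real by simp
    then show ?thesis unfolding S .
  qed
  ultimately show ?thesis by (simp add: diff_divide_distrib flip: defs)
qed

text \<open>Drift changes the density of an exit at y by the weight exp (\<epsilon> (y - x0) / 2 -
  u^2 t / 8); the two prefactors are its space part at y = - b and y = b, and the image series are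
  the driftless densities at these ends. The proof only compares Laplace transforms.\<close>

lemma T_has_density:
  "has_density_on_pos N T (\<lambda>t. exp (- (u\<^sup>2 * t / 8)) *
    (exp (- (\<epsilon> * (b + x0) / 2)) * image_series u (exp b) (exp x0) t
     + exp (\<epsilon> * (b - x0) / 2) * image_series u (exp b) (exp (- x0)) t))"
proof -
  define c1 where "c1 = exp (- (\<epsilon> * (b + x0) / 2))"
  define c2 where "c2 = exp (\<epsilon> * (b - x0) / 2)"
  have c: "0 \<le> c1" "0 \<le> c2" by (simp_all add: c1_def c2_def)
  \<comment> \<open>The factor exp (- u^2 t / 8) shifts the Laplace variable to \<alpha> + u^2 / 8 =
    u^2 \<beta>^2 / 2, so the series are evaluated at s = \<beta>. Levels b + x0 and b - x0 give the
    positive part, 3 b - x0 and 3 b + x0 the negative one.\<close>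
  define Q where "Q a1 a2 t = exp (- (u\<^sup>2 * t / 8)) * (c1 * passage_series u (4 * b) a1 t + c2 * passage_series u (4 * b) a2 t)" for a1 a2 t
  have d: "0 < 4 * b" using b_pos by simp
  have u2: "0 < u\<^sup>2" using u_nonzero by simp
  have \<beta>_pos: "0 < \<beta> \<alpha>" if "0 \<le> \<alpha>" for \<alpha>
    unfolding \<beta>_def using that u2 by (intro real_sqrt_gt_zero add_nonneg_pos) auto
  have Q_nonneg: "0 \<le> Q a1 a2 t" if "0 < a1" "0 < a2" for a1 a2 t
    unfolding Q_def using that c by (intro mult_nonneg_nonneg add_nonneg_nonneg passage_series_nonneg[OF u_nonzero _ d]) auto
  have Q_zero: "Q a1 a2 t = 0" if "t \<le> 0" for a1 a2 t
    using that by (simp add: Q_def passage_series_def)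
  have Q_laplace: "has_bochner_integral lborel (\<lambda>t. exp (- (\<alpha> * t)) * Q a1 a2 t)
     (c1 * (exp (- (a1 * \<beta> \<alpha>)) / (1 - exp (- (4 * b * \<beta> \<alpha>)))) + c2 * (exp (- (a2 * \<beta> \<alpha>)) / (1 - exp (- (4 * b * \<beta> \<alpha>)))))"
    if a: "0 < a1" "0 < a2" and \<alpha>: "0 \<le> \<alpha>" for a1 a2 \<alpha>
  proof -
    have "(\<beta> \<alpha>)\<^sup>2 = 2 * \<alpha> / u\<^sup>2 + 1 / 4" unfolding \<beta>_def using \<alpha> u2 by simp
    then have e: "u\<^sup>2 * (\<beta> \<alpha>)\<^sup>2 / 2 = \<alpha> + u\<^sup>2 / 8" using u2 by (simp add: field_simps)
    have E: "exp (- (\<alpha> * t)) * exp (- (u\<^sup>2 * t / 8)) = exp (- (u\<^sup>2 * (\<beta> \<alpha>)\<^sup>2 / 2 * t))" for t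
      unfolding mult_exp_exp e by (simp add: algebra_simps)
    have "x * (y * (c1 * v + c2 * w)) = c1 * (x * y * v) + c2 * (x * y * w)" for x y v w :: real
      by (simp add: algebra_simps)
    then have "exp (- (\<alpha> * t)) * Q a1 a2 t = c1 * (exp (- (u\<^sup>2 * (\<beta> \<alpha>)\<^sup>2 / 2 * t)) * passage_series u (4 * b) a1 t)
        + c2 * (exp (- (u\<^sup>2 * (\<beta> \<alpha>)\<^sup>2 / 2 * t)) * passage_series u (4 * b) a2 t)" for t
      unfolding Q_def E[symmetric] by blast
    then show ?thesis
      using a by (simp only:) (intro has_bochner_integral_add has_bochner_integral_mult_right laplace_passage_series u_nonzero d \<beta>_pos \<alpha>)
  qed
  have pos: "0 < b + x0" "0 < b - x0" "0 < 3 * b - x0" "0 < 3 * b + x0"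
    using x0 by auto
  have integrable_Q: "integrable lborel (Q a1 a2)" if "0 < a1" "0 < a2" for a1 a2
    using Q_laplace[OF that, of 0] by (simp add: has_bochner_integral_iff)
  show ?thesis
  proof (rule has_density_on_pos_of_laplace[where Fp="Q (b + x0) (b - x0)" and Fm="Q (3 * b - x0) (3 * b + x0)"])
    show "prob_space N" by unfold_locales
    show "T \<in> borel_measurable N" by measurable
    show "AE \<omega> in N. T \<omega> < \<infinity>" by (rule T_finite)
    show "integrable lborel (Q (b + x0) (b - x0))" "integrable lborel (Q (3 * b - x0) (3 * b + x0))"
      using pos by (auto intro: integrable_Q)
    show "0 \<le> Q (b + x0) (b - x0) t" "0 \<le> Q (3 * b - x0) (3 * b + x0) t" for t
      using pos by (auto intro: Q_nonneg)
    show "Q (b + x0) (b - x0) t = 0" "Q (3 * b - x0) (3 * b + x0) t = 0" if "t \<le> 0" for t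
      using that by (auto intro: Q_zero)
    fix n :: nat
    let ?\<beta> = "\<beta> (real n)"
    have \<beta>0: "0 < ?\<beta>" by (rule \<beta>_pos) simp
    have "(\<integral> t. exp (- (real n * t)) * Q (b + x0) (b - x0) t \<partial>lborel) - (\<integral> t. exp (- (real n * t)) * Q (3 * b - x0) (3 * b + x0) t \<partial>lborel)
      = c1 * (exp (- ((b + x0) * ?\<beta>)) / (1 - exp (- (4 * b * ?\<beta>))) - exp (- ((3 * b - x0) * ?\<beta>)) / (1 - exp (- (4 * b * ?\<beta>))))
      + c2 * (exp (- ((b + - x0) * ?\<beta>)) / (1 - exp (- (4 * b * ?\<beta>))) - exp (- ((3 * b - - x0) * ?\<beta>)) / (1 - exp (- (4 * b * ?\<beta>))))"
      using Q_laplace[OF pos(1,2), of "real n"] Q_laplace[OF pos(3,4), of "real n"]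
      by (simp add: has_bochner_integral_iff right_diff_distrib)
    also have "\<dots> = c1 * (sinh (?\<beta> * (b - x0)) / sinh (2 * ?\<beta> * b)) + c2 * (sinh (?\<beta> * (b + x0)) / sinh (2 * ?\<beta> * b))"
      unfolding sinh_ratio[OF \<beta>0] by simp
    also have "\<dots> = (\<integral> \<omega>. exp (- (real n * enn2real (T \<omega>))) \<partial>N)"
    proof (cases "n = 0")
      \<comment> \<open>The closed forms of the transforms require \<alpha> > 0; at \<alpha> = 0,
        where \<beta> = 1/2, their limits are the exit probabilities, which add up to 1.\<close>
      case True
      have \<beta>_zero: "\<beta> 0 = 1 / 2" by (simp add: \<beta>_def real_sqrt_divide)
      have "measure N (exits_at (- b)) = c1 * (sinh ((b - x0) / 2) / sinh b)"
      proof -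
        have "(\<lambda>n. exp (- (\<epsilon> * (b + x0) / 2)) * (sinh (\<beta> (\<alpha>s n) * (b - x0)) / sinh (2 * \<beta> (\<alpha>s n) * b))) \<longlonglongrightarrow>
           exp (- (\<epsilon> * (b + x0) / 2)) * (sinh (1 / 2 * (b - x0)) / sinh (2 * (1 / 2) * b))"
          using b_pos by (intro tendsto_intros \<beta>_lim) auto
        then have "(\<lambda>n. exit_transform (- b) (\<alpha>s n)) \<longlonglongrightarrow> c1 * (sinh ((b - x0) / 2) / sinh b)"
          by (simp add: exit_transform_eq[OF \<alpha>s_pos] \<beta>_def c1_def)
        then show ?thesis
          using LIMSEQ_unique[OF exit_transform_lim[of "- b"]] by simp
      qed
      then show ?thesis
        using True prob_exits_at_b prob_exits_sum by (simp add: \<beta>_zero c2_def prob_space)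
    next
      case False
      then have n0: "0 < real n" by simp
      have "(\<integral> \<omega>. exp (- (real n * enn2real (T \<omega>))) \<partial>N) = (\<integral> \<omega>. exp_neg (real n) (T \<omega>) \<partial>N)"
        using T_finite by (intro integral_cong_AE) (measurable, auto elim!: eventually_mono simp: exp_neg_def)
      also have "\<dots> = c1 * (sinh (?\<beta> * (b - x0)) / sinh (2 * ?\<beta> * b)) + c2 * (sinh (?\<beta> * (b + x0)) / sinh (2 * ?\<beta> * b))"
        unfolding expectation_exp_neg[OF n0] exit_transform_eq[OF n0] c1_def c2_def \<beta>_def by simp
      finally show ?thesis by simp
    qed
    finally show "(\<integral> \<omega>. exp (- (real n * enn2real (T \<omega>))) \<partial>N) + (\<integral> t. exp (- (real n * t)) * Q (3 * b - x0) (3 * b + x0) t \<partial>lborel)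
      = (\<integral> t. exp (- (real n * t)) * Q (b + x0) (b - x0) t \<partial>lborel)" by simp
  next
    fix t :: real assume t: "0 < t"
    have "\<bar>- x0\<bar> < b" using x0 by simp
    note img = image_series_eq[OF u_nonzero x0 t] image_series_eq[OF u_nonzero this t]
    show "exp (- (u\<^sup>2 * t / 8)) *
        (exp (- (\<epsilon> * (b + x0) / 2)) * image_series u (exp b) (exp x0) t
         + exp (\<epsilon> * (b - x0) / 2) * image_series u (exp b) (exp (- x0)) t) = Q (b + x0) (b - x0) t - Q (3 * b - x0) (3 * b + x0) t"
      unfolding img by (simp add: Q_def c1_def c2_def algebra_simps)
  qed
qed

end

section \<open>The Girsanov formula on path space\<close>

context brownian_motion
begin

text \<open>The transition operator over time h of a Brownian motion with drift u, written with the
  likelihood weight in place of the drift.\<close>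

definition tilted_step :: "real \<Rightarrow> real \<Rightarrow> (real \<Rightarrow> ennreal) \<Rightarrow> real \<Rightarrow> ennreal" where
  "tilted_step u h g x = (\<integral>\<^sup>+ y. g (x + y) * ennreal (exp (u * y - u\<^sup>2 * h / 2)) * ennreal (normal_density 0 (sqrt h) y) \<partial>lborel)"

lemma tilted_step_measurable [measurable]:
  assumes [measurable]: "g \<in> borel_measurable borel"
  shows "tilted_step u h g \<in> borel_measurable borel"
  unfolding tilted_step_def by measurable

lemma tilted_step_eq:
  assumes [measurable]: "g \<in> borel_measurable borel" and h: "0 < h"
  shows "(\<integral>\<^sup>+ y. g (x + y + u * h) * ennreal (normal_density 0 (sqrt h) y) \<partial>lborel) = tilted_step u h g x"
proof -
  have "(\<integral>\<^sup>+ y. g (x + y) * ennreal (normal_density 0 (sqrt h) (y - u * h)) \<partial>lborel)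
      = (\<integral>\<^sup>+ y. g (x + (u * h + y)) * ennreal (normal_density 0 (sqrt h) (u * h + y - u * h)) \<partial>lborel)"
    using nn_integral_real_affine[of "\<lambda>y. g (x + y) * ennreal (normal_density 0 (sqrt h) (y - u * h))" 1 "u * h"] by simp
  also have "\<dots> = (\<integral>\<^sup>+ y. g (x + y + u * h) * ennreal (normal_density 0 (sqrt h) y) \<partial>lborel)"
    by (simp add: ac_simps)
  finally show ?thesis
    unfolding tilted_step_def normal_density_exp_tilt[OF h, symmetric]
    by (simp add: ennreal_mult' mult_ac)
qed

text \<open>H collects the factors from the past. This lemma and its weighted counterpart strip the
  last step from the two sides of Girsanov's formula and leave the same operator behind, so an
  induction over finitely many times becomes possible.\<close>

lemma nn_integral_shifted_step:
  assumes rs: "0 \<le> r" "r < s" and [measurable]: "H \<in> borel_measurable (G r)" "g \<in> borel_measurable borel"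
  shows "(\<integral>\<^sup>+ \<omega>. H \<omega> * g (W s \<omega> + u * s) \<partial>N) = (\<integral>\<^sup>+ \<omega>. H \<omega> * tilted_step u (s - r) g (W r \<omega> + u * r) \<partial>N)"
proof -
  have [measurable]: "W r \<in> borel_measurable (G r)" using rs by (intro measurable_G) auto
  have "(\<integral>\<^sup>+ \<omega>. H \<omega> * g (W s \<omega> + u * s) \<partial>N)
      = (\<integral>\<^sup>+ \<omega>. (\<lambda>(\<omega>, y). H \<omega> * g (W r \<omega> + u * r + y + u * (s - r))) (\<omega>, W s \<omega> - W r \<omega>) \<partial>N)"
    by (simp add: algebra_simps)
  also have "\<dots> = (\<integral>\<^sup>+ \<omega>. (\<integral>\<^sup>+ y. (\<lambda>(\<omega>, y). H \<omega> * g (W r \<omega> + u * r + y + u * (s - r))) (\<omega>, y) * ennreal (normal_density 0 (sqrt (s - r)) y) \<partial>lborel) \<partial>N)"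
    by (rule nn_integral_increment[OF rs]) measurable
  also have "\<dots> = (\<integral>\<^sup>+ \<omega>. H \<omega> * tilted_step u (s - r) g (W r \<omega> + u * r) \<partial>N)"
    using rs by (intro nn_integral_cong) (simp add: tilted_step_eq[symmetric] nn_integral_cmult[symmetric] mult.assoc)
  finally show ?thesis .
qed

lemma nn_integral_weighted_step:
  assumes rs: "0 \<le> r" "r < s" and [measurable]: "H \<in> borel_measurable (G r)" "g \<in> borel_measurable borel"
  shows "(\<integral>\<^sup>+ \<omega>. H \<omega> * g (W s \<omega>) * ennreal (expmart u s \<omega>) \<partial>N)
    = (\<integral>\<^sup>+ \<omega>. H \<omega> * tilted_step u (s - r) g (W r \<omega>) * ennreal (expmart u r \<omega>) \<partial>N)"
proof -
  have [measurable]: "W r \<in> borel_measurable (G r)" using rs by (intro measurable_G) auto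
  have [measurable]: "expmart u r \<in> borel_measurable (G r)" unfolding expmart_def by measurable
  let ?k = "\<lambda>(\<omega>, y). H \<omega> * ennreal (expmart u r \<omega>) * (g (W r \<omega> + y) * ennreal (exp (u * y - u\<^sup>2 * (s - r) / 2)))"
  have "(\<integral>\<^sup>+ \<omega>. H \<omega> * g (W s \<omega>) * ennreal (expmart u s \<omega>) \<partial>N) = (\<integral>\<^sup>+ \<omega>. ?k (\<omega>, W s \<omega> - W r \<omega>) \<partial>N)"
  proof (intro nn_integral_cong)
    fix \<omega>
    have "expmart u s \<omega> = expmart u r \<omega> * exp (u * (W s \<omega> - W r \<omega>) - u\<^sup>2 * (s - r) / 2)"
      unfolding expmart_def mult_exp_exp by (simp add: field_simps)
    then show "H \<omega> * g (W s \<omega>) * ennreal (expmart u s \<omega>) = ?k (\<omega>, W s \<omega> - W r \<omega>)"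
      by (simp add: ennreal_mult' less_imp_le[OF expmart_pos] mult_ac)
  qed
  also have "\<dots> = (\<integral>\<^sup>+ \<omega>. (\<integral>\<^sup>+ y. ?k (\<omega>, y) * ennreal (normal_density 0 (sqrt (s - r)) y) \<partial>lborel) \<partial>N)"
    by (rule nn_integral_increment[OF rs]) measurable
  also have "\<dots> = (\<integral>\<^sup>+ \<omega>. H \<omega> * tilted_step u (s - r) g (W r \<omega>) * ennreal (expmart u r \<omega>) \<partial>N)"
  proof (intro nn_integral_cong)
    fix \<omega>
    have "(\<integral>\<^sup>+ y. ?k (\<omega>, y) * ennreal (normal_density 0 (sqrt (s - r)) y) \<partial>lborel)
      = (\<integral>\<^sup>+ y. (H \<omega> * ennreal (expmart u r \<omega>)) * (g (W r \<omega> + y) * ennreal (exp (u * y - u\<^sup>2 * (s - r) / 2)) * ennreal (normal_density 0 (sqrt (s - r)) y)) \<partial>lborel)"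
      by (simp add: mult.assoc)
    also have "\<dots> = (H \<omega> * ennreal (expmart u r \<omega>)) * tilted_step u (s - r) g (W r \<omega>)"
      unfolding tilted_step_def by (rule nn_integral_cmult) measurable
    finally show "(\<integral>\<^sup>+ y. ?k (\<omega>, y) * ennreal (normal_density 0 (sqrt (s - r)) y) \<partial>lborel)
        = H \<omega> * tilted_step u (s - r) g (W r \<omega>) * ennreal (expmart u r \<omega>)"
      by (simp add: mult_ac)
  qed
  finally show ?thesis .
qed

text \<open>Induction that removes the largest time. The free terminal function g makes it work:
  after one step back to r, the factor at r and the operator applied to g merge into a new terminal
  function with horizon r.\<close>

lemma girsanov_cylinder:
  fixes f :: "real \<Rightarrow> real \<Rightarrow> ennreal"
  assumes J: "finite J" and f [measurable]: "\<And>j. f j \<in> borel_measurable borel"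
  shows "0 \<le> s \<Longrightarrow> (\<And>j. j \<in> J \<Longrightarrow> 0 \<le> j \<and> j \<le> s) \<Longrightarrow> g \<in> borel_measurable borel \<Longrightarrow>
    (\<integral>\<^sup>+ \<omega>. (\<Prod>j\<in>J. f j (W j \<omega> + u * j)) * g (W s \<omega> + u * s) \<partial>N)
    = (\<integral>\<^sup>+ \<omega>. (\<Prod>j\<in>J. f j (W j \<omega>)) * g (W s \<omega>) * ennreal (expmart u s \<omega>) \<partial>N)"
  using J
proof (induction J arbitrary: s g rule: finite_linorder_max_induct)
  case empty
  note [measurable] = empty.prems(3)
  show ?case
  proof (cases "s = 0")
    case True
    then show ?thesis
      by (auto intro!: nn_integral_cong simp: W_zero expmart_def)
  next
    case False
    then have "(0::real) \<le> 0" "0 < s" using empty by auto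
    from nn_integral_shifted_step[OF this, of "\<lambda>_. 1" g u] nn_integral_weighted_step[OF this, of "\<lambda>_. 1" g u]
    have "(\<integral>\<^sup>+ \<omega>. g (W s \<omega> + u * s) \<partial>N) = (\<integral>\<^sup>+ \<omega>. tilted_step u s g (W 0 \<omega>) \<partial>N)"
      "(\<integral>\<^sup>+ \<omega>. g (W s \<omega>) * ennreal (expmart u s \<omega>) \<partial>N) = (\<integral>\<^sup>+ \<omega>. tilted_step u s g (W 0 \<omega>) * ennreal (expmart u 0 \<omega>) \<partial>N)"
      by simp_all
    moreover have "(\<integral>\<^sup>+ \<omega>. tilted_step u s g (W 0 \<omega>) * ennreal (expmart u 0 \<omega>) \<partial>N) = (\<integral>\<^sup>+ \<omega>. tilted_step u s g (W 0 \<omega>) \<partial>N)"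
      by (intro nn_integral_cong) (simp add: W_zero expmart_def)
    ultimately show ?thesis by simp
  qed
next
  case (insert r J)
  note [measurable] = insert.prems(3)
  have r: "0 \<le> r" "r \<le> s" using insert.prems(2) by auto
  have J: "0 \<le> j \<and> j \<le> r" if "j \<in> J" for j
    using that insert.prems(2) insert.hyps(2) by (auto simp: less_imp_le)
  have notin: "r \<notin> J" using insert.hyps(2) by auto
  have prod: "(\<Prod>j\<in>insert r J. f j (x j)) = (\<Prod>j\<in>J. f j (x j)) * f r (x r)" for x
    using insert.hyps(1) notin by (simp add: mult.commute)
  show ?case
  \<comment> \<open>The step lemmas need a positive time gap, so for r = s the factor at r is
    absorbed into g without a step.\<close>
  proof (cases "r = s")
    case True
    have "(\<integral>\<^sup>+ \<omega>. (\<Prod>j\<in>J. f j (W j \<omega> + u * j)) * (f s (W s \<omega> + u * s) * g (W s \<omega> + u * s)) \<partial>N)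
    = (\<integral>\<^sup>+ \<omega>. (\<Prod>j\<in>J. f j (W j \<omega>)) * (f s (W s \<omega>) * g (W s \<omega>)) * ennreal (expmart u s \<omega>) \<partial>N)"
      using r J True by (intro insert.IH) auto
    then show ?thesis unfolding prod by (simp add: True mult.assoc)
  next
    case False
    then have rs: "r < s" using r by simp
    have [measurable]: "W j \<in> borel_measurable (G r)" if "j \<in> insert r J" for j
      using that J[of j] r by (intro measurable_G) auto
    have H1: "(\<lambda>\<omega>. \<Prod>j\<in>insert r J. f j (W j \<omega> + u * j)) \<in> borel_measurable (G r)"
      "(\<lambda>\<omega>. \<Prod>j\<in>insert r J. f j (W j \<omega>)) \<in> borel_measurable (G r)"
      by measurable
    have "(\<integral>\<^sup>+ \<omega>. (\<Prod>j\<in>insert r J. f j (W j \<omega> + u * j)) * g (W s \<omega> + u * s) \<partial>N)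
      = (\<integral>\<^sup>+ \<omega>. (\<Prod>j\<in>insert r J. f j (W j \<omega> + u * j)) * tilted_step u (s - r) g (W r \<omega> + u * r) \<partial>N)"
      by (rule nn_integral_shifted_step[OF r(1) rs H1(1)]) measurable
    also have "\<dots> = (\<integral>\<^sup>+ \<omega>. (\<Prod>j\<in>J. f j (W j \<omega> + u * j)) * (f r (W r \<omega> + u * r) * tilted_step u (s - r) g (W r \<omega> + u * r)) \<partial>N)"
      unfolding prod by (simp add: mult.assoc)
    also have "\<dots> = (\<integral>\<^sup>+ \<omega>. (\<Prod>j\<in>J. f j (W j \<omega>)) * (f r (W r \<omega>) * tilted_step u (s - r) g (W r \<omega>)) * ennreal (expmart u r \<omega>) \<partial>N)"
      by (rule insert.IH[OF r(1) J]) measurable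
    also have "\<dots> = (\<integral>\<^sup>+ \<omega>. (\<Prod>j\<in>insert r J. f j (W j \<omega>)) * tilted_step u (s - r) g (W r \<omega>) * ennreal (expmart u r \<omega>) \<partial>N)"
      unfolding prod by (simp add: mult.assoc)
    also have "\<dots> = (\<integral>\<^sup>+ \<omega>. (\<Prod>j\<in>insert r J. f j (W j \<omega>)) * g (W s \<omega>) * ennreal (expmart u s \<omega>) \<partial>N)"
      by (rule nn_integral_weighted_step[OF r(1) rs H1(2), symmetric]) measurable
    finally show ?thesis .
  qed
qed

section \<open>Laws on path space over a bounded horizon\<close>

definition path :: "real \<Rightarrow> 'a \<Rightarrow> real \<Rightarrow> real" where
  "path s \<omega> = (\<lambda>t\<in>{0..s}. W t \<omega>)"

definition shift :: "real \<Rightarrow> real \<Rightarrow> (real \<Rightarrow> real) \<Rightarrow> real \<Rightarrow> real" where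
  "shift u s x = (\<lambda>t\<in>{0..s}. x t + u * t)"

abbreviation paths :: "real \<Rightarrow> (real \<Rightarrow> real) measure" where
  "paths s \<equiv> Pi\<^sub>M {0..s} (\<lambda>_. borel)"

lemma path_measurable [measurable]: "path s \<in> measurable N (paths s)"
  unfolding path_def by (intro measurable_restrict) measurable

lemma shift_measurable [measurable]: "shift u s \<in> measurable (paths s) (paths s)"
  unfolding shift_def by (intro measurable_restrict) measurable

text \<open>Both sides are integrals of k against image measures on the product space. The measures
  agree on cylinder sets by \<open>girsanov_cylinder\<close>, one of them is finite, and cylinders
  determine a finite measure on the uncountable product.\<close>

lemma girsanov:
  assumes s: "0 \<le> s" and k [measurable]: "k \<in> borel_measurable (paths s)"
  shows "(\<integral>\<^sup>+ \<omega>. k (shift u s (path s \<omega>)) \<partial>N) = (\<integral>\<^sup>+ \<omega>. k (path s \<omega>) * ennreal (expmart u s \<omega>) \<partial>N)"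
proof -
  let ?P = "distr N (paths s) (\<lambda>\<omega>. shift u s (path s \<omega>))"
  let ?Q = "distr (density N (\<lambda>\<omega>. ennreal (expmart u s \<omega>))) (paths s) (path s)"
  have "?P = ?Q"
  proof (rule measure_eqI_PiM_infinite)
    show "finite_measure ?P" by (rule finite_measure_distr) measurable
    fix A :: "real \<Rightarrow> real set" and J :: "real set"
    assume J: "finite J" "J \<subseteq> {0..s}" and A: "\<And>i. i \<in> J \<Longrightarrow> A i \<in> sets borel"
    let ?E = "prod_emb {0..s} (\<lambda>_. borel :: real measure) J (Pi\<^sub>E J A)"
    have E [measurable]: "?E \<in> sets (paths s)" using J A by (intro sets_PiM_I) auto
    \<comment> \<open>The constant 1 off J meets the demand of \<open>girsanov_cylinder\<close> that
      every \<open>f j\<close> be measurable, not only those with j in J.\<close>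
    define f :: "real \<Rightarrow> real \<Rightarrow> ennreal" where "f j = (if j \<in> J then indicator (A j) else (\<lambda>_. 1))" for j
    have f: "f j \<in> borel_measurable borel" for j using A by (auto simp: f_def)
    have ind: "indicator ?E x = (\<Prod>j\<in>J. f j (x j))" if "x \<in> extensional {0..s}" for x
    proof (cases "\<forall>j\<in>J. x j \<in> A j")
      case True
      then have "x \<in> ?E" using that J by (auto simp: prod_emb_iff PiE_iff)
      then show ?thesis using True by (simp add: f_def)
    next
      case False
      then obtain j where j: "j \<in> J" "x j \<notin> A j" by blast
      then have "x \<notin> ?E" using J by (auto simp: prod_emb_iff PiE_iff)
      moreover have "(\<Prod>j\<in>J. f j (x j)) = 0"
        using j by (intro prod_zero[OF J(1)] bexI[of _ j]) (simp_all add: f_def)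
      ultimately show ?thesis by simp
    qed
    have val: "shift u s (path s \<omega>) j = W j \<omega> + u * j" "path s \<omega> j = W j \<omega>" if "j \<in> J" for j \<omega>
      using that J by (auto simp: shift_def path_def)
    have "emeasure ?P ?E = (\<integral>\<^sup>+ \<omega>. indicator ?E (shift u s (path s \<omega>)) \<partial>N)"
      by (simp add: nn_integral_distr flip: nn_integral_indicator)
    also have "\<dots> = (\<integral>\<^sup>+ \<omega>. (\<Prod>j\<in>J. f j (W j \<omega> + u * j)) * 1 \<partial>N)"
      by (subst ind) (auto simp: shift_def[of u s] val(1)[symmetric] cong: prod.cong)
    also have "\<dots> = (\<integral>\<^sup>+ \<omega>. (\<Prod>j\<in>J. f j (W j \<omega>)) * 1 * ennreal (expmart u s \<omega>) \<partial>N)"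
      using J by (intro girsanov_cylinder[OF J(1) f s, where g="\<lambda>_. 1"]) auto
    also have "\<dots> = (\<integral>\<^sup>+ \<omega>. indicator ?E (path s \<omega>) * ennreal (expmart u s \<omega>) \<partial>N)"
      by (subst ind) (auto simp: path_def[of s] val(2)[symmetric] cong: prod.cong)
    also have "\<dots> = emeasure ?Q ?E"
      by (simp add: nn_integral_distr nn_integral_density mult.commute flip: nn_integral_indicator)
    finally show "emeasure ?P ?E = emeasure ?Q ?E" .
  qed simp_all
  then have "(\<integral>\<^sup>+ x. k x \<partial>?P) = (\<integral>\<^sup>+ x. k x \<partial>?Q)" by simp
  then show ?thesis
    by (simp add: nn_integral_distr nn_integral_density mult.commute)
qed

end

text \<open>Carries statements about path space over to the filtration: every coordinate is
  measurable for the \<sigma>-algebra pulled back along the path map, which therefore contains the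
  natural one.\<close>

lemma sets_natural_filtration_path:
  assumes "E \<in> sets (natural_filtration P X s)"
  obtains A where "A \<in> sets (Pi\<^sub>M {0..s} (\<lambda>_. borel))" "E = (\<lambda>\<omega>. \<lambda>t\<in>{0..s}. X t \<omega>) -` A \<inter> space P"
proof -
  let ?f = "\<lambda>\<omega>. \<lambda>t\<in>{0..s}. X t \<omega>"
  let ?V = "vimage_algebra (space P) ?f (Pi\<^sub>M {0..s} (\<lambda>_. borel))"
  have f: "?f \<in> space P \<rightarrow> space (Pi\<^sub>M {0..s} (\<lambda>_. borel :: real measure))"
    by (auto simp: space_PiM)
  have "X r \<in> borel_measurable ?V" if r: "0 \<le> r" "r \<le> s" for r
  proof -
    have "(\<lambda>\<omega>. ?f \<omega> r) \<in> borel_measurable ?V"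
      by (rule measurable_compose[OF measurable_vimage_algebra1[OF f] measurable_component_singleton])
         (use r in auto)
    then show ?thesis using r by simp
  qed
  then have "E \<in> sets ?V"
    using assms by (intro subsetD[OF sets_natural_filtration_le[of ?V P s X]]) auto
  then show ?thesis using that by (auto simp: sets_vimage_algebra2[OF f])
qed

section \<open>Bayes formula and the posterior\<close>

locale signal_observation = brownian_motion +
  fixes \<theta> :: "'a \<Rightarrow> real" and p u :: real
  assumes \<theta>_measurable [measurable]: "\<theta> \<in> borel_measurable N"
    and p: "0 < p" "p < 1"
    and prob_\<theta>: "prob {\<omega> \<in> space N. \<theta> \<omega> = 1} = p" "prob {\<omega> \<in> space N. \<theta> \<omega> = 0} = 1 - p"
    and indep: "\<And>i s A. 0 \<le> s \<Longrightarrow> A \<in> sets (paths s) \<Longrightarrow>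
      emeasure N ({\<omega> \<in> space N. \<theta> \<omega> = i} \<inter> (path s -` A \<inter> space N))
      = emeasure N {\<omega> \<in> space N. \<theta> \<omega> = i} * emeasure N (path s -` A \<inter> space N)"
begin

abbreviation hyp :: "real \<Rightarrow> 'a set" where
  "hyp i \<equiv> {\<omega> \<in> space N. \<theta> \<omega> = i}"

lemma hyp_sets [measurable]: "hyp i \<in> sets N"
  by measurable

lemma emeasure_hyp: "emeasure N (hyp 1) = ennreal p" "emeasure N (hyp 0) = ennreal (1 - p)"
  using prob_\<theta> by (simp_all add: emeasure_eq_measure)

lemma AE_hyp: "AE \<omega> in N. \<theta> \<omega> = 1 \<or> \<theta> \<omega> = 0"
proof -
  have "prob (hyp 1 \<union> hyp 0) = prob (hyp 1) + prob (hyp 0)"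
    by (rule finite_measure_Union) auto
  then have "prob (hyp 1 \<union> hyp 0) = 1" by (simp add: prob_\<theta>)
  moreover have "hyp 1 \<union> hyp 0 = {\<omega> \<in> space N. \<theta> \<omega> = 1 \<or> \<theta> \<omega> = 0}" by auto
  moreover have "{\<omega> \<in> space N. \<theta> \<omega> = 1 \<or> \<theta> \<omega> = 0} \<in> sets N" by measurable
  ultimately show ?thesis by (simp add: prob_Collect_eq_1)
qed

lemma nn_integral_indep:
  assumes s: "0 \<le> s" and k [measurable]: "k \<in> borel_measurable (paths s)"
  shows "(\<integral>\<^sup>+ \<omega>. k (path s \<omega>) * indicator (hyp i) \<omega> \<partial>N) = emeasure N (hyp i) * (\<integral>\<^sup>+ \<omega>. k (path s \<omega>) \<partial>N)"
proof -
  let ?P = "distr (density N (indicator (hyp i))) (paths s) (path s)"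
  let ?Q = "scale_measure (emeasure N (hyp i)) (distr N (paths s) (path s))"
  have "?P = ?Q"
  proof (rule measure_eqI)
    fix A assume "A \<in> sets ?P"
    then have A: "A \<in> sets (paths s)" by simp
    have "emeasure ?P A = emeasure (density N (indicator (hyp i))) (path s -` A \<inter> space N)"
      using A by (subst emeasure_distr) auto
    also have "\<dots> = emeasure N (hyp i \<inter> (path s -` A \<inter> space N))"
      using A by (subst emeasure_density)
        (auto simp: nn_integral_indicator[symmetric] simp del: nn_integral_indicator intro!: nn_integral_cong split: split_indicator)
    also have "\<dots> = emeasure ?Q A"
      using A by (simp add: indep[OF s] emeasure_distr)
    finally show "emeasure ?P A = emeasure ?Q A" .
  qed simp
  then have "(\<integral>\<^sup>+ x. k x \<partial>?P) = (\<integral>\<^sup>+ x. k x \<partial>?Q)" by simp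
  then show ?thesis
    by (simp add: nn_integral_distr nn_integral_density nn_integral_scale_measure mult.commute)
qed

definition obs :: "real \<Rightarrow> 'a \<Rightarrow> real" where
  "obs t \<omega> = \<theta> \<omega> * u * t + W t \<omega>"

definition obs_path :: "real \<Rightarrow> 'a \<Rightarrow> real \<Rightarrow> real" where
  "obs_path s \<omega> = (\<lambda>t\<in>{0..s}. obs t \<omega>)"

definition likelihood :: "real \<Rightarrow> real \<Rightarrow> real" where
  "likelihood t x = exp (u * x - u\<^sup>2 * t / 2)"

definition bayes :: "real \<Rightarrow> real \<Rightarrow> real" where
  "bayes t x = p * likelihood t x / (p * likelihood t x + (1 - p))"

lemma bayes_denominator: "0 < p * likelihood t x + (1 - p)"
  using p by (simp add: likelihood_def add_pos_pos)

lemma bayes_bounds: "0 \<le> bayes t x" "bayes t x \<le> 1"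
  using p bayes_denominator[of t x] by (simp_all add: bayes_def likelihood_def)

lemma likelihood_measurable [measurable]: "likelihood t \<in> borel_measurable borel"
  unfolding likelihood_def by measurable

lemma bayes_measurable [measurable]: "bayes t \<in> borel_measurable borel"
  unfolding bayes_def by measurable

lemma obs_measurable [measurable]: "obs t \<in> borel_measurable N"
  unfolding obs_def by measurable

lemma obs_path_measurable [measurable]: "obs_path s \<in> measurable N (paths s)"
  unfolding obs_path_def by (intro measurable_restrict) measurable

lemma obs_path_hyp:
  "\<theta> \<omega> = 1 \<Longrightarrow> obs_path s \<omega> = shift u s (path s \<omega>)"
  "\<theta> \<omega> = 0 \<Longrightarrow> obs_path s \<omega> = path s \<omega>"
  by (auto simp: obs_path_def obs_def shift_def path_def fun_eq_iff)

text \<open>Given \<theta> = 1 the observed path is a shifted Brownian path, which Girsanov trades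
  for the weight p l with l the likelihood; given \<theta> = 0 the weight is 1 - p. The function
  \<open>bayes\<close> is exactly the b that solves b (p l + (1 - p)) = p l.\<close>

lemma bayes_formula:
  assumes s: "0 \<le> s" and k [measurable]: "k \<in> borel_measurable (paths s)"
  shows "(\<integral>\<^sup>+ \<omega>. k (obs_path s \<omega>) * indicator (hyp 1) \<omega> \<partial>N) = (\<integral>\<^sup>+ \<omega>. k (obs_path s \<omega>) * ennreal (bayes s (obs s \<omega>)) \<partial>N)"
proof -
  have [measurable]: "(\<lambda>x. x s) \<in> borel_measurable (paths s)"
    using s by (intro measurable_component_singleton) auto
  let ?b = "\<lambda>x. k x * ennreal (bayes s (x s))"
  have end_val: "path s \<omega> s = W s \<omega>" "obs_path s \<omega> s = obs s \<omega>" for \<omega>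
    using s by (simp_all add: path_def obs_path_def)
  have first: "(\<integral>\<^sup>+ \<omega>. k' (obs_path s \<omega>) * indicator (hyp 1) \<omega> \<partial>N)
      = ennreal p * (\<integral>\<^sup>+ \<omega>. k' (path s \<omega>) * ennreal (expmart u s \<omega>) \<partial>N)"
    if [measurable]: "k' \<in> borel_measurable (paths s)" for k'
  proof -
    have "(\<integral>\<^sup>+ \<omega>. k' (obs_path s \<omega>) * indicator (hyp 1) \<omega> \<partial>N) = (\<integral>\<^sup>+ \<omega>. k' (shift u s (path s \<omega>)) * indicator (hyp 1) \<omega> \<partial>N)"
      by (intro nn_integral_cong) (auto simp: obs_path_hyp split: split_indicator)
    also have "\<dots> = ennreal p * (\<integral>\<^sup>+ \<omega>. k' (shift u s (path s \<omega>)) \<partial>N)"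
      using nn_integral_indep[OF s, of "\<lambda>x. k' (shift u s x)" 1] by (simp add: emeasure_hyp)
    finally show ?thesis by (simp add: girsanov[OF s])
  qed
  \<comment> \<open>Split over the two hypotheses, which exhaust the space up to a null set; on the
    second one the observed path is the Brownian path.\<close>
  have "(\<integral>\<^sup>+ \<omega>. k (obs_path s \<omega>) * ennreal (bayes s (obs s \<omega>)) \<partial>N)
      = (\<integral>\<^sup>+ \<omega>. ?b (obs_path s \<omega>) * indicator (hyp 1) \<omega> + ?b (path s \<omega>) * indicator (hyp 0) \<omega> \<partial>N)"
    using AE_hyp AE_space
    by (intro nn_integral_cong_AE) (auto elim!: eventually_elim2 simp: end_val[symmetric] obs_path_hyp)
  also have "\<dots> = (\<integral>\<^sup>+ \<omega>. ?b (obs_path s \<omega>) * indicator (hyp 1) \<omega> \<partial>N) + (\<integral>\<^sup>+ \<omega>. ?b (path s \<omega>) * indicator (hyp 0) \<omega> \<partial>N)"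
    by (rule nn_integral_add) measurable
  also have "\<dots> = ennreal p * (\<integral>\<^sup>+ \<omega>. ?b (path s \<omega>) * ennreal (expmart u s \<omega>) \<partial>N) + ennreal (1 - p) * (\<integral>\<^sup>+ \<omega>. ?b (path s \<omega>) \<partial>N)"
    using first[of ?b] nn_integral_indep[OF s, of ?b 0] by (simp add: emeasure_hyp)
  also have "\<dots> = (\<integral>\<^sup>+ \<omega>. ennreal p * (?b (path s \<omega>) * ennreal (expmart u s \<omega>)) + ennreal (1 - p) * ?b (path s \<omega>) \<partial>N)"
    by (simp add: nn_integral_add nn_integral_cmult)
  also have "\<dots> = (\<integral>\<^sup>+ \<omega>. ennreal p * (k (path s \<omega>) * ennreal (expmart u s \<omega>)) \<partial>N)"
  proof (intro nn_integral_cong)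
    fix \<omega>
    have lik: "likelihood s (W s \<omega>) = expmart u s \<omega>" by (simp add: likelihood_def expmart_def)
    have "p * (bayes s (W s \<omega>) * expmart u s \<omega>) + (1 - p) * bayes s (W s \<omega>) = bayes s (W s \<omega>) * (p * likelihood s (W s \<omega>) + (1 - p))"
      by (simp add: lik algebra_simps)
    also have "\<dots> = p * expmart u s \<omega>"
      using bayes_denominator[of s "W s \<omega>"] by (simp add: bayes_def lik)
    finally have real_eq: "p * (bayes s (W s \<omega>) * expmart u s \<omega>) + (1 - p) * bayes s (W s \<omega>) = p * expmart u s \<omega>" .
    have "ennreal p * (ennreal (bayes s (W s \<omega>)) * ennreal (expmart u s \<omega>)) + ennreal (1 - p) * ennreal (bayes s (W s \<omega>)) = ennreal p * ennreal (expmart u s \<omega>)"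
      using p bayes_bounds[of s "W s \<omega>"] less_imp_le[OF expmart_pos, of u s \<omega>]
      by (simp flip: ennreal_mult ennreal_plus add: real_eq)
    then have "k (path s \<omega>) * (ennreal p * (ennreal (bayes s (W s \<omega>)) * ennreal (expmart u s \<omega>)) + ennreal (1 - p) * ennreal (bayes s (W s \<omega>)))
       = k (path s \<omega>) * (ennreal p * ennreal (expmart u s \<omega>))" by simp
    then show "ennreal p * (?b (path s \<omega>) * ennreal (expmart u s \<omega>)) + ennreal (1 - p) * ?b (path s \<omega>) = ennreal p * (k (path s \<omega>) * ennreal (expmart u s \<omega>))"
      by (simp add: end_val distrib_left mult_ac)
  qed
  also have "\<dots> = (\<integral>\<^sup>+ \<omega>. k (obs_path s \<omega>) * indicator (hyp 1) \<omega> \<partial>N)"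
    by (simp add: first[OF k] nn_integral_cmult)
  finally show ?thesis by simp
qed

lemma bayes_tendsto:
  assumes \<omega>: "\<omega> \<in> space N" and t: "0 \<le> t"
  shows "(\<lambda>n. bayes (t + 1 / real (Suc n)) (obs (t + 1 / real (Suc n)) \<omega>)) \<longlonglongrightarrow> bayes t (obs t \<omega>)"
proof -
  have lim: "(\<lambda>n. t + 1 / real (Suc n)) \<longlonglongrightarrow> t"
    using tendsto_add[OF tendsto_const LIMSEQ_Suc[OF lim_1_over_n], of t] by simp
  have "(\<lambda>n. W (t + 1 / real (Suc n)) \<omega>) \<longlonglongrightarrow> W t \<omega>"
    by (rule continuous_on_tendsto_compose[OF W_continuous[OF \<omega>] lim]) (use t in auto)
  then have "(\<lambda>n. likelihood (t + 1 / real (Suc n)) (obs (t + 1 / real (Suc n)) \<omega>)) \<longlonglongrightarrow> likelihood t (obs t \<omega>)"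
    unfolding likelihood_def obs_def using lim by (intro tendsto_intros) auto
  then show ?thesis
    unfolding bayes_def using bayes_denominator[of t "obs t \<omega>"] by (intro tendsto_intros) auto
qed

text \<open>The observation may be specified up to indistinguishability only, since null sets are
  adjoined to the filtration anyway.\<close>

lemma cond_exp_augmented:
  assumes X [measurable]: "\<And>t. 0 \<le> t \<Longrightarrow> X t \<in> borel_measurable N"
    and X_eq: "AE \<omega> in N. \<forall>t\<ge>0. X t \<omega> = obs t \<omega>"
    and t: "0 \<le> t"
  shows "AE \<omega> in N. real_cond_exp N (augmented_filtration N X t) (indicator (hyp 1)) \<omega> = bayes t (obs t \<omega>)"
proof -
  let ?F = "\<lambda>s. sigma (space N) (sets (natural_filtration N X s) \<union> null_sets N)"
  let ?A = "augmented_filtration N X t"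
  have nat_sub: "sets (natural_filtration N X s) \<subseteq> sets N" for s
    by (rule sets_natural_filtration_le) (auto intro: X)
  have base_sub: "sets (natural_filtration N X s) \<union> null_sets N \<subseteq> Pow (space N)" for s
    using nat_sub[of s] sets.sets_into_space by (auto dest: null_setsD2)
  have F_sets: "sets (?F s) = sigma_sets (space N) (sets (natural_filtration N X s) \<union> null_sets N)" for s
    by (rule sets_measure_of[OF base_sub])
  have F_space: "space (?F s) = space N" for s by (rule space_measure_of[OF base_sub])
  have F_sub: "sets (?F s) \<subseteq> sets N" for s
    unfolding F_sets using nat_sub[of s] by (intro sets.sigma_sets_subset) (auto dest: null_setsD2)
  have inter_sub: "(\<Inter>s\<in>{t<..}. sets (?F s)) \<subseteq> Pow (space N)"
    using F_sub[of "t + 1"] sets.space_closed[of N] by fastforce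
  have A_sets: "sets ?A = sigma_sets (space N) (\<Inter>s\<in>{t<..}. sets (?F s))"
    unfolding augmented_filtration_def by (rule sets_measure_of[OF inter_sub])
  have A_space: "space ?A = space N"
    unfolding augmented_filtration_def by (rule space_measure_of[OF inter_sub])
  have A_F: "sets ?A \<subseteq> sets (?F s)" if "t < s" for s
  proof -
    have "(\<Inter>s\<in>{t<..}. sets (?F s)) \<subseteq> sets (?F s)" using that by (intro INF_lower) auto
    then have "sigma_sets (space (?F s)) (\<Inter>s\<in>{t<..}. sets (?F s)) \<subseteq> sets (?F s)"
      by (rule sets.sigma_sets_subset)
    then show ?thesis unfolding A_sets F_space .
  qed
  have subalg: "subalgebra N ?A"
    using A_F[of "t + 1"] F_sub[of "t + 1"] by (auto simp: subalgebra_def A_space)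
  interpret sigma_finite_subalgebra N ?A
    by (rule finite_measure_subalgebra_is_sigma_finite)
       (use subalg in \<open>auto simp: finite_measure_subalgebra_def finite_measure_subalgebra_axioms_def intro: finite_measure_axioms\<close>)
  \<comment> \<open>Null sets do no harm: the events that differ from one of the natural filtration
    by a null set form a \<sigma>-algebra, which contains both kinds of generators.\<close>
  have modulo_null: "\<exists>E'\<in>sets (natural_filtration N X s). AE \<omega> in N. \<omega> \<in> E \<longleftrightarrow> \<omega> \<in> E'"
    if "E \<in> sets (?F s)" for E s
    using that unfolding F_sets
  proof (induction rule: sigma_sets.induct)
    case (Basic E)
    show ?case
    proof (cases "E \<in> null_sets N")
      case True
      then have "AE \<omega> in N. \<omega> \<notin> E" by (rule AE_not_in)
      then show ?thesis by (intro bexI[of _ "{}"]) auto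
    next
      case False
      then show ?thesis using Basic by (intro bexI[of _ E]) auto
    qed
  next
    case Empty
    show ?case by (intro bexI[of _ "{}"]) auto
  next
    case (Compl E)
    then obtain E' where E': "E' \<in> sets (natural_filtration N X s)" "AE \<omega> in N. \<omega> \<in> E \<longleftrightarrow> \<omega> \<in> E'" by blast
    from E'(2) have "AE \<omega> in N. \<omega> \<in> space N - E \<longleftrightarrow> \<omega> \<in> space N - E'" by eventually_elim auto
    moreover have "space N - E' \<in> sets (natural_filtration N X s)"
      using sets.compl_sets[OF E'(1)] by simp
    ultimately show ?case by blast
  next
    case (Union E)
    then have "\<forall>i. \<exists>E'. E' \<in> sets (natural_filtration N X s) \<and> (AE \<omega> in N. \<omega> \<in> E i \<longleftrightarrow> \<omega> \<in> E')" by blast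
    then obtain E' where E': "\<And>i. E' i \<in> sets (natural_filtration N X s)" "\<And>i. AE \<omega> in N. \<omega> \<in> E i \<longleftrightarrow> \<omega> \<in> E' i"
      by metis
    have "AE \<omega> in N. \<forall>i. \<omega> \<in> E i \<longleftrightarrow> \<omega> \<in> E' i" using E'(2) by (simp add: AE_all_countable)
    then have "AE \<omega> in N. \<omega> \<in> (\<Union>i. E i) \<longleftrightarrow> \<omega> \<in> (\<Union>i. E' i)" by eventually_elim auto
    moreover have "(\<Union>i. E' i) \<in> sets (natural_filtration N X s)" using E'(1) by blast
    ultimately show ?case by blast
  qed
  have bayes_on: "(\<integral> \<omega>. indicator E \<omega> * indicator (hyp 1) \<omega> \<partial>N) = (\<integral> \<omega>. indicator E \<omega> * bayes s (obs s \<omega>) \<partial>N)"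
    if E: "E \<in> sets (?F s)" and s: "0 \<le> s" for E s
  proof -
    obtain E' where E': "E' \<in> sets (natural_filtration N X s)" "AE \<omega> in N. \<omega> \<in> E \<longleftrightarrow> \<omega> \<in> E'"
      using modulo_null[OF E] by blast
    obtain C where C: "C \<in> sets (paths s)" "E' = (\<lambda>\<omega>. \<lambda>t\<in>{0..s}. X t \<omega>) -` C \<inter> space N"
      using sets_natural_filtration_path[OF E'(1)] by blast
    note [measurable] = C(1) subsetD[OF F_sub E]
    have E_iff: "AE \<omega> in N. indicator E \<omega> = (indicator C (obs_path s \<omega>) :: ennreal)"
      using E'(2) X_eq AE_space
    proof eventually_elim
      case (elim \<omega>)
      have "(\<lambda>t\<in>{0..s}. X t \<omega>) = obs_path s \<omega>" using elim(2) by (auto simp: obs_path_def fun_eq_iff)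
      then show ?case using elim C(2) by (auto split: split_indicator)
    qed
    have "ennreal (\<integral> \<omega>. indicator E \<omega> * indicator (hyp 1) \<omega> \<partial>N) = (\<integral>\<^sup>+ \<omega>. ennreal (indicator E \<omega> * indicator (hyp 1) \<omega>) \<partial>N)"
      by (rule nn_integral_eq_integral[symmetric])
         (auto intro!: integrable_const_bound[where B=1] split: split_indicator)
    also have "\<dots> = (\<integral>\<^sup>+ \<omega>. indicator C (obs_path s \<omega>) * indicator (hyp 1) \<omega> \<partial>N)"
      using E_iff by (intro nn_integral_cong_AE, eventually_elim) (auto simp: ennreal_mult' ennreal_indicator)
    also have "\<dots> = (\<integral>\<^sup>+ \<omega>. indicator C (obs_path s \<omega>) * ennreal (bayes s (obs s \<omega>)) \<partial>N)"
      using C(1) by (intro bayes_formula s) auto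
    also have "\<dots> = (\<integral>\<^sup>+ \<omega>. ennreal (indicator E \<omega> * bayes s (obs s \<omega>)) \<partial>N)"
      using E_iff by (intro nn_integral_cong_AE, eventually_elim) (auto simp: ennreal_mult' ennreal_indicator)
    also have "\<dots> = ennreal (\<integral> \<omega>. indicator E \<omega> * bayes s (obs s \<omega>) \<partial>N)"
      using bayes_bounds
      by (intro nn_integral_eq_integral) (auto intro!: integrable_const_bound[where B=1] split: split_indicator)
    finally show ?thesis
      using bayes_bounds by (subst (asm) ennreal_inj) (auto intro!: integral_nonneg_AE)
  qed
  \<comment> \<open>An event of the right limit belongs to the completed filtration at every time t
    + 1 / (n + 1). Bayes' formula holds at these times and passes to t by path continuity and
    bounded convergence.\<close>
  have bayes_on_A: "(\<integral> \<omega>. indicator E \<omega> * indicator (hyp 1) \<omega> \<partial>N) = (\<integral> \<omega>. indicator E \<omega> * bayes t (obs t \<omega>) \<partial>N)"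
    if E: "E \<in> sets ?A" for E
  proof -
    have E_N [measurable]: "E \<in> sets N" using E subalg by (auto simp: subalgebra_def)
    have "(\<lambda>n. \<integral> \<omega>. indicator E \<omega> * bayes (t + 1 / real (Suc n)) (obs (t + 1 / real (Suc n)) \<omega>) \<partial>N)
        \<longlonglongrightarrow> (\<integral> \<omega>. indicator E \<omega> * bayes t (obs t \<omega>) \<partial>N)"
      using bayes_bounds
      by (intro integral_dominated_convergence[where w="\<lambda>_. 1"])
         (auto intro!: tendsto_mult bayes_tendsto t split: split_indicator simp del: of_nat_Suc)
    moreover have "(\<integral> \<omega>. indicator E \<omega> * bayes (t + 1 / real (Suc n)) (obs (t + 1 / real (Suc n)) \<omega>) \<partial>N)
      = (\<integral> \<omega>. indicator E \<omega> * indicator (hyp 1) \<omega> \<partial>N)" for n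
      using t by (intro bayes_on[symmetric] subsetD[OF A_F E]) auto
    ultimately show ?thesis by (simp add: LIMSEQ_const_iff)
  qed
  have X_A [measurable]: "X t \<in> borel_measurable ?A"
  proof (rule measurableI)
    fix B :: "real set" assume B: "B \<in> sets borel"
    have "X t -` B \<inter> space N \<in> sets (?F s)" if "t < s" for s
    proof -
      have "X t \<in> borel_measurable (natural_filtration N X s)"
        using that t by (intro measurable_natural_filtration) auto
      from measurable_sets[OF this B] show ?thesis unfolding F_sets by auto
    qed
    then show "X t -` B \<inter> space ?A \<in> sets ?A"
      unfolding A_space A_sets by (intro sigma_sets.Basic) auto
  qed simp
  have X_t: "AE \<omega> in N. X t \<omega> = obs t \<omega>" using X_eq t by (auto elim: eventually_mono)
  have X_N [measurable]: "X t \<in> borel_measurable N" using t by (rule X)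
  \<comment> \<open>The version is written with \<open>X t\<close>, which generates the filtration
    and is thus measurable for \<open>?A\<close>; \<open>obs t\<close> replaces it only afterwards,
    almost surely.\<close>
  have "AE \<omega> in N. real_cond_exp N ?A (indicator (hyp 1)) \<omega> = bayes t (X t \<omega>)"
  proof (rule real_cond_exp_charact)
    fix E assume E: "E \<in> sets ?A"
    then have [measurable]: "E \<in> sets N" using subalg by (auto simp: subalgebra_def)
    have "(LINT \<omega>:E|N. indicator (hyp 1) \<omega>) = (\<integral> \<omega>. indicator E \<omega> * bayes t (obs t \<omega>) \<partial>N)"
      using bayes_on_A[OF E] by (simp add: set_lebesgue_integral_def)
    also have "\<dots> = (\<integral> \<omega>. indicator E \<omega> * bayes t (X t \<omega>) \<partial>N)"
      using X_t by (intro integral_cong_AE) (auto elim: eventually_mono)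
    finally show "(LINT \<omega>:E|N. indicator (hyp 1) \<omega>) = (LINT \<omega>:E|N. bayes t (X t \<omega>))"
      by (simp add: set_lebesgue_integral_def)
  next
    show "integrable N (indicator (hyp 1) :: 'a \<Rightarrow> real)" by (intro integrable_const_bound[where B=1]) auto
    show "integrable N (\<lambda>\<omega>. bayes t (X t \<omega>))"
      using bayes_bounds by (intro integrable_const_bound[where B=1]) auto
  qed measurable
  then show ?thesis using X_t by eventually_elim simp
qed

end

section \<open>Log-odds coordinates\<close>

text \<open>The entry point of completeness: \<tau> and d are first known only to agree almost
  surely with measurable objects, and this makes their own events measurable.\<close>

lemma (in complete_measure) sets_of_AE:
  assumes A': "A' \<in> sets M" and A: "A \<subseteq> space M" and eq: "AE x in M. x \<in> A \<longleftrightarrow> x \<in> A'"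
  shows "A \<in> sets M"
proof -
  obtain Z where Z: "{x \<in> space M. \<not> (x \<in> A \<longleftrightarrow> x \<in> A')} \<subseteq> Z" "Z \<in> null_sets M"
    using eq by (rule AE_E3) (auto simp: null_setsI)
  have "A \<inter> Z \<in> sets M" using Z(2) by (rule complete[rotated]) auto
  moreover have "A = (A' - Z) \<union> (A \<inter> Z)" using Z(1) A sets.sets_into_space[OF A'] by auto
  ultimately show ?thesis using A' Z(2) by (metis null_setsD2 sets.Diff sets.Un)
qed

lemma (in complete_measure) borel_measurable_of_AE:
  assumes g: "g \<in> borel_measurable M" and eq: "AE x in M. f x = g x"
  shows "f \<in> borel_measurable M"
proof (rule measurableI)
  fix B :: "'b set" assume B: "B \<in> sets borel"
  show "f -` B \<inter> space M \<in> sets M"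
  proof (rule sets_of_AE[OF measurable_sets[OF g B]])
    show "AE x in M. x \<in> f -` B \<inter> space M \<longleftrightarrow> x \<in> g -` B \<inter> space M"
      using eq by eventually_elim auto
  qed simp
qed simp

lemma has_mean_cong_AE:
  assumes "has_mean N T m" "T' \<in> borel_measurable N" "AE \<omega> in N. T' \<omega> = T \<omega>"
  shows "has_mean N T' m"
  using assms nn_integral_cong_AE[OF assms(3)] by (simp add: has_mean_def)

lemma has_density_on_pos_cong_AE:
  assumes d: "has_density_on_pos N T f" and T': "T' \<in> borel_measurable N" and eq: "AE \<omega> in N. T' \<omega> = T \<omega>"
  shows "has_density_on_pos N T' f"
proof -
  have "AE \<omega> in N. T' \<omega> < \<infinity>"
    using d eq unfolding has_density_on_pos_def by (auto elim!: eventually_elim2)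
  moreover have "distributed N lborel (\<lambda>\<omega>. enn2real (T' \<omega>)) (\<lambda>t. ennreal (f t) * indicator {0<..} t)"
  proof -
    have D: "distributed N lborel (\<lambda>\<omega>. enn2real (T \<omega>)) (\<lambda>t. ennreal (f t) * indicator {0<..} t)"
      using d by (simp add: has_density_on_pos_def)
    have m: "(\<lambda>\<omega>. enn2real (T' \<omega>)) \<in> measurable N lborel" using T' by simp
    have "distr N lborel (\<lambda>\<omega>. enn2real (T' \<omega>)) = distr N lborel (\<lambda>\<omega>. enn2real (T \<omega>))"
      using eq distributed_measurable[OF D] m by (intro distr_cong_AE) (auto elim!: eventually_mono)
    then show ?thesis using D m by (simp add: distributed_def)
  qed
  ultimately show ?thesis using d by (simp add: has_density_on_pos_def)
qed

section \<open>From posterior probabilities to log-odds\<close>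

definition logistic :: "real \<Rightarrow> real" where
  "logistic z = 1 / (1 + exp (- z))"

lemma logistic_less: "logistic z < logistic y \<longleftrightarrow> z < y"
proof -
  have "0 < 1 + exp (- z)" "0 < 1 + exp (- y)" by (simp_all add: add_pos_pos)
  then show ?thesis by (simp add: logistic_def divide_simps)
qed

lemma logistic_eq: "logistic z = logistic y \<longleftrightarrow> z = y"
  using logistic_less[of z y] logistic_less[of y z] by auto

lemma logistic_minus: "logistic (- z) = 1 - logistic z"
proof -
  have "0 < 1 + exp z" by (simp add: add_pos_pos)
  then show ?thesis by (simp add: logistic_def exp_minus field_simps)
qed

lemma logistic_ln_odds:
  assumes "0 < q" "q < 1"
  shows "logistic (ln (q / (1 - q))) = q"
proof -
  have e: "exp (- ln (q / (1 - q))) = (1 - q) / q" using assms by (simp add: exp_minus)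
  show ?thesis unfolding logistic_def e using assms by (simp add: field_simps)
qed

lemma exit_time_logistic:
  assumes b: "logistic b = 1 - A" and post: "\<And>t. 0 \<le> t \<Longrightarrow> post t \<omega> = logistic (f t)"
  shows "exit_time post A \<omega> = exit_of b f"
proof -
  have A: "A = logistic (- b)" "1 - A = logistic b" using b by (simp_all add: logistic_minus)
  have "{t. 0 \<le> t \<and> post t \<omega> \<notin> {A<..<1 - A}} = {t. 0 \<le> t \<and> f t \<notin> {- b<..<b}}"
    unfolding A(2) by (subst A(1)) (auto simp: post logistic_less)
  then show ?thesis by (simp add: exit_time_def exit_of_def)
qed

context drifted_brownian_motion
begin

lemma exit_time_eq:
  assumes "logistic b = 1 - A" "AE \<omega> in N. \<forall>t\<ge>0. post t \<omega> = logistic (L t \<omega>)"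
  shows "AE \<omega> in N. exit_time post A \<omega> = T \<omega>"
  using assms(2) by eventually_elim (auto simp: T_def intro!: exit_time_logistic assms(1))

text \<open>At the exit the posterior is exactly A or 1 - A. Because h separates these two values,
  the decision reveals the side of the exit; the event that no exit occurs is null by
  \<open>T_finite\<close>.\<close>

lemma decision_eq:
  assumes b: "logistic b = 1 - A" and post: "AE \<omega> in N. \<forall>t\<ge>0. post t \<omega> = logistic (L t \<omega>)"
    and h: "h A \<noteq> h (1 - A)"
  shows "AE \<omega> in N. decision h post A \<omega> \<in> {h A, h (1 - A)} \<and> (decision h post A \<omega> = h (1 - A) \<longleftrightarrow> \<omega> \<in> exits_at b)"
  using post exit_time_eq[OF b post] T_finite AE_space
proof eventually_elim
  case (elim \<omega>)
  have A: "logistic (- b) = A" using b by (simp add: logistic_minus)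
  from \<open>\<omega> \<in> space N\<close> show ?case
  proof (cases rule: T_cases)
    case never
    then show ?thesis using elim by simp
  next
    case (exit t)
    have d: "decision h post A \<omega> = h (logistic (L t \<omega>))"
      using elim exit by (simp add: decision_def)
    have "L t \<omega> = b \<or> L t \<omega> = - b" using exit(3) by linarith
    then show ?thesis
    proof
      assume "L t \<omega> = b"
      then show ?thesis using d b exit elim by (simp add: exits_at_def)
    next
      assume "L t \<omega> = - b"
      then show ?thesis using d A h exit elim b_pos by (simp add: exits_at_def)
    qed
  qed
qed

end

section \<open>The posterior and the conditional measures\<close>

context signal_observation
begin

lemma bayes_logistic: "bayes t x = logistic (ln (p / (1 - p)) + u * x - u\<^sup>2 * t / 2)"
proof -
  define l where "l = likelihood t x"
  have l: "0 < l" by (simp add: l_def likelihood_def)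
  have "exp (- (ln (p / (1 - p)) + u * x - u\<^sup>2 * t / 2)) = exp (- ln (p / (1 - p))) * exp (- (u * x - u\<^sup>2 * t / 2))"
    unfolding mult_exp_exp by (simp add: algebra_simps)
  also have "exp (- ln (p / (1 - p))) = inverse (p / (1 - p))"
    using p unfolding exp_minus by (subst exp_ln) auto
  also have "exp (- (u * x - u\<^sup>2 * t / 2)) = inverse l"
    unfolding exp_minus l_def likelihood_def ..
  finally have e: "exp (- (ln (p / (1 - p)) + u * x - u\<^sup>2 * t / 2)) = inverse (p / (1 - p)) * inverse l" .
  have "0 < p * l" using p l by simp
  then show ?thesis
    unfolding bayes_def logistic_def e l_def[symmetric] using p l by (simp add: divide_simps)
qed

lemma emeasure_hyp_nonzero: "i = 0 \<or> i = 1 \<Longrightarrow> emeasure N (hyp i) \<noteq> 0"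
  using p by (elim disjE) (simp_all add: emeasure_hyp ennreal_eq_0_iff)

lemma emeasure_given:
  assumes i: "i = 0 \<or> i = 1" and t: "0 \<le> t" and E: "E \<in> sets (G t)"
  shows "emeasure (given N \<theta> i) E = emeasure N E"
proof -
  obtain C where C: "C \<in> sets (paths t)" "E = (\<lambda>\<omega>. \<lambda>r\<in>{0..t}. W r \<omega>) -` C \<inter> space N"
    using sets_natural_filtration_path[OF E] by blast
  then have E_eq: "E = path t -` C \<inter> space N" by (simp add: path_def[abs_def])
  have h: "emeasure N (hyp i) \<noteq> 0" by (rule emeasure_hyp_nonzero[OF i])
  have "emeasure (given N \<theta> i) E = emeasure N (hyp i \<inter> E) / emeasure N (hyp i)"
    unfolding given_def using G_sets_N[OF E] by (intro emeasure_uniform_measure) auto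
  also have "\<dots> = emeasure N (hyp i) * emeasure N E / emeasure N (hyp i)"
    using indep[OF t C(1)] by (simp add: E_eq)
  also have "\<dots> = emeasure N E"
    unfolding mult.commute[of "emeasure N (hyp i)"] using h by (intro ennreal_mult_divide_eq) auto
  finally show ?thesis .
qed

lemma sets_given [simp, measurable_cong]: "sets (given N \<theta> i) = sets N"
  by (simp add: given_def)

lemma space_given [simp]: "space (given N \<theta> i) = space N"
  by (simp add: given_def)

text \<open>Every event in the product formula for increments up to time t lies in
  \<open>G t\<close>, and by independence conditioning on \<theta> leaves the probabilities of such
  events unchanged.\<close>

lemma brownian_motion_given:
  assumes i: "i = 0 \<or> i = 1"
  shows "brownian_motion (given N \<theta> i) W"
proof (intro brownian_motion.intro brownian_motion_axioms.intro)
  have "emeasure N (hyp i) \<noteq> 0" by (rule emeasure_hyp_nonzero[OF i])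
  then show "prob_space (given N \<theta> i)"
    unfolding given_def by (intro prob_space_uniform_measure) auto
  have nf: "natural_filtration (given N \<theta> i) W = G"
    by (simp add: natural_filtration_def fun_eq_iff)
  fix s t :: real and A and B :: "real set"
  assume st: "0 \<le> s" "s < t" and A: "A \<in> sets (natural_filtration (given N \<theta> i) W s)" and B: "B \<in> sets borel"
  have A': "A \<in> sets (G s)" using A by (simp add: nf)
  have "A \<in> sets (G t)"
    using st by (intro subsetD[OF sets_natural_filtration_le[of "G t" N s W] A'] measurable_G) auto
  moreover have "(\<lambda>\<omega>. W t \<omega> - W s \<omega>) -` B \<inter> space N \<in> sets (G t)"
  proof -
    have "(\<lambda>\<omega>. W t \<omega> - W s \<omega>) \<in> borel_measurable (G t)"
      using st by (intro borel_measurable_diff measurable_G) auto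
    from measurable_sets[OF this B] show ?thesis by simp
  qed
  ultimately have "A \<inter> ((\<lambda>\<omega>. W t \<omega> - W s \<omega>) -` B \<inter> space N) \<in> sets (G t)" by (rule sets.Int)
  then have "emeasure (given N \<theta> i) (A \<inter> ((\<lambda>\<omega>. W t \<omega> - W s \<omega>) -` B \<inter> space N))
      = emeasure N (A \<inter> ((\<lambda>\<omega>. W t \<omega> - W s \<omega>) -` B \<inter> space N))"
    using st by (intro emeasure_given[OF i, of t]) auto
  also have "\<dots> = emeasure N A * emeasure (density lborel (normal_density 0 (sqrt (t - s)))) B"
    by (rule W_increment[OF st A' B])
  also have "emeasure N A = emeasure (given N \<theta> i) A"
    by (rule emeasure_given[OF i st(1) A', symmetric])
  finally show "emeasure (given N \<theta> i) (A \<inter> ((\<lambda>\<omega>. W t \<omega> - W s \<omega>) -` B \<inter> space (given N \<theta> i)))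
      = emeasure (given N \<theta> i) A * emeasure (density lborel (normal_density 0 (sqrt (t - s)))) B" by simp
next
  show "W t \<in> borel_measurable (given N \<theta> i)" for t
    using W_measurable by (subst measurable_cong_sets[OF sets_given refl])
  show "W 0 \<omega> = 0" if "\<omega> \<in> space (given N \<theta> i)" for \<omega> using that by (simp add: W_zero)
  show "continuous_on {0..} (\<lambda>t. W t \<omega>)" if "\<omega> \<in> space (given N \<theta> i)" for \<omega> using that by (simp add: W_continuous)
qed

lemma AE_given:
  assumes i: "i = 0 \<or> i = 1"
  shows "(AE \<omega> in given N \<theta> i. Q \<omega>) \<longleftrightarrow> (AE \<omega> in N. \<theta> \<omega> = i \<longrightarrow> Q \<omega>)"
proof -
  have "emeasure N (hyp i) \<noteq> 0" by (rule emeasure_hyp_nonzero[OF i])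
  then have "(AE \<omega> in given N \<theta> i. Q \<omega>) \<longleftrightarrow> (AE \<omega> in N. \<omega> \<in> hyp i \<longrightarrow> Q \<omega>)"
    unfolding given_def by (rule AE_uniform_measure) (simp add: emeasure_eq_measure)
  also have "\<dots> \<longleftrightarrow> (AE \<omega> in N. \<theta> \<omega> = i \<longrightarrow> Q \<omega>)"
    by (rule AE_cong) simp
  finally show ?thesis .
qed

text \<open>The conditional expectation determines \<open>post t\<close> only up to a null set
  depending on t. Countably many rational times share one null set, and continuity of both sides
  extends the equality to all times at once.\<close>

lemma posterior_eq:
  assumes post: "posterior_process N \<theta> X post"
    and X: "\<And>t. 0 \<le> t \<Longrightarrow> X t \<in> borel_measurable N"
    and X_eq: "AE \<omega> in N. \<forall>t\<ge>0. X t \<omega> = obs t \<omega>"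
  shows "AE \<omega> in N. \<forall>t\<ge>0. post t \<omega> = bayes t (obs t \<omega>)"
proof -
  have ae: "AE \<omega> in N. post t \<omega> = bayes t (obs t \<omega>)" if t: "0 \<le> t" for t
  proof -
    have "AE \<omega> in N. post t \<omega> = real_cond_exp N (augmented_filtration N X t) (indicator (hyp 1)) \<omega>"
      using post t by (simp add: posterior_process_def)
    moreover have "AE \<omega> in N. real_cond_exp N (augmented_filtration N X t) (indicator (hyp 1)) \<omega> = bayes t (obs t \<omega>)"
      using X X_eq t by (rule cond_exp_augmented)
    ultimately show ?thesis by eventually_elim simp
  qed
  have "AE \<omega> in N. \<forall>q\<in>\<rat> \<inter> {0..}. post q \<omega> = bayes q (obs q \<omega>)"
    by (rule AE_ball_countable') (use ae in \<open>auto intro: countable_Int1 countable_rat\<close>)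
  moreover have "AE \<omega> in N. continuous_on {0..} (\<lambda>t. post t \<omega>)"
    using post by (simp add: posterior_process_def)
  ultimately show ?thesis
    using AE_space
  proof eventually_elim
    case (elim \<omega>)
    have cont: "continuous_on {0..} (\<lambda>t. bayes t (obs t \<omega>))"
      unfolding bayes_def likelihood_def obs_def
      using bayes_denominator W_continuous[OF elim(3)]
      by (intro continuous_intros) (auto simp: likelihood_def less_imp_neq[THEN not_sym])
    show ?case
    proof (intro allI impI)
      fix t :: real assume t: "0 \<le> t"
      \<comment> \<open>Approximation from the right keeps the rational times in the half-line on
        which the paths are continuous.\<close>
      have "\<forall>n. \<exists>q. q \<in> \<rat> \<and> t < q \<and> q < t + 1 / real (Suc n)"
        using Rats_dense_in_real[of t "t + 1 / real (Suc n)" for n] by auto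
      then obtain q where "\<forall>n. q n \<in> \<rat> \<and> t < q n \<and> q n < t + 1 / real (Suc n)"
        by (rule choice[THEN exE])
      then have q: "\<And>n. q n \<in> \<rat>" "\<And>n. t < q n" "\<And>n. q n < t + 1 / real (Suc n)" by blast+
      have lim: "q \<longlonglongrightarrow> t"
      proof (rule tendsto_sandwich[of "\<lambda>_. t" _ _ "\<lambda>n. t + 1 / real (Suc n)"])
        show "(\<lambda>n. t + 1 / real (Suc n)) \<longlonglongrightarrow> t"
          using tendsto_add[OF tendsto_const LIMSEQ_Suc[OF lim_1_over_n], of t] by simp
      qed (use q in \<open>auto intro!: always_eventually less_imp_le\<close>)
      have q0: "0 \<le> q n" for n using q(2)[of n] t by simp
      have "(\<lambda>n. post (q n) \<omega>) \<longlonglongrightarrow> post t \<omega>"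
        by (rule continuous_on_tendsto_compose[OF elim(2) lim]) (use t q0 in auto)
      moreover have "(\<lambda>n. bayes (q n) (obs (q n) \<omega>)) \<longlonglongrightarrow> bayes t (obs t \<omega>)"
        by (rule continuous_on_tendsto_compose[OF cont lim]) (use t q0 in auto)
      moreover have "post (q n) \<omega> = bayes (q n) (obs (q n) \<omega>)" for n
        using elim(1) q(1)[of n] q0[of n] by auto
      ultimately show "post t \<omega> = bayes t (obs t \<omega>)"
        by (simp only:) (rule LIMSEQ_unique)
    qed
  qed
qed

end

section \<open>Distinctness of the two decisions and closed forms in the odds\<close>

lemma deriv_Psi_pos:
  assumes "0 < A" "A < 1 / 2"
  shows "0 < deriv Psi A"
proof -
  have odds: "DERIV (\<lambda>p. p / (1 - p)) A :> (1 * (1 - A) - A * (0 - 1)) / ((1 - A) * (1 - A))"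
    using assms by (intro DERIV_divide DERIV_diff DERIV_ident DERIV_const) auto
  have "DERIV (\<lambda>p. (1 - 2 * p) * ln (p / (1 - p))) A :>
      (0 - 2 * 1) * ln (A / (1 - A)) + inverse (A / (1 - A)) * ((1 * (1 - A) - A * (0 - 1)) / ((1 - A) * (1 - A))) * (1 - 2 * A)"
    using assms by (intro DERIV_mult DERIV_diff DERIV_const DERIV_cmult DERIV_ident DERIV_chain2[OF DERIV_ln odds]) auto
  moreover have "Psi = (\<lambda>p. (1 - 2 * p) * ln (p / (1 - p)))" by (simp add: Psi_def fun_eq_iff)
  ultimately have "deriv Psi A = (0 - 2 * 1) * ln (A / (1 - A)) + inverse (A / (1 - A)) * ((1 * (1 - A) - A * (0 - 1)) / ((1 - A) * (1 - A))) * (1 - 2 * A)"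
    by (simp only: DERIV_imp_deriv)
  moreover have "0 < (0 - 2 * 1) * ln (A / (1 - A))"
    using ln_less_zero[of "A / (1 - A)"] assms by (simp add: divide_simps)
  moreover have "0 < inverse (A / (1 - A)) * ((1 * (1 - A) - A * (0 - 1)) / ((1 - A) * (1 - A))) * (1 - 2 * A)"
    using assms by (intro mult_pos_pos divide_pos_pos) auto
  ultimately show ?thesis by (simp only: add_pos_pos)
qed

text \<open>If the two decisions coincided, the affine function \<open>f(\<cdot>, h A)\<close> would be constant and
  touch \<open>g\<close> from above at \<open>A\<close>, so \<open>g' A = 0\<close>, contradicting \<open>\<Psi>' A > 0\<close>.\<close>

lemma decisions_distinct:
  assumes A: "0 < A" "A < 1 / 2" and M: "0 < (M::real)"
    and deriv: "((\<lambda>q. expected_loss L q (h q)) has_real_derivative 2 * M * deriv Psi A) (at A)"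
    and h: "\<And>q. q \<in> {0..1} \<Longrightarrow> is_arg_min (expected_loss L q) (\<lambda>y. y \<in> D) (h q)"
    and sym: "expected_loss L (1 - A) (h (1 - A)) = expected_loss L A (h A)"
  shows "h A \<noteq> h (1 - A)"
proof
  assume eq: "h A = h (1 - A)"
  have "(L 1 (h A) - L 0 (h A)) * (1 - 2 * A) = 0"
    using sym unfolding eq[symmetric] expected_loss_def by (simp add: algebra_simps)
  then have const: "L 1 (h A) = L 0 (h A)" using A by simp
  have le: "expected_loss L q (h q) \<le> expected_loss L A (h A)" if q: "q \<in> {0..1}" for q
  proof -
    have "h A \<in> D" using h[of A] A by (simp add: is_arg_min_def)
    then have "expected_loss L q (h q) \<le> expected_loss L q (h A)"
      using h[OF q] by (auto simp: is_arg_min_def not_less)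
    also have "\<dots> = expected_loss L A (h A)" by (simp add: expected_loss_def const algebra_simps)
    finally show ?thesis .
  qed
  have "2 * M * deriv Psi A = 0"
  \<comment> \<open>The radius A keeps the comparison points between 0 and 2 A, hence inside the
    unit interval because A < 1/2.\<close>
  proof (rule DERIV_local_max[OF deriv A(1)], intro allI impI)
    fix y assume "\<bar>A - y\<bar> < A"
    then show "expected_loss L y (h y) \<le> expected_loss L A (h A)"
      using A by (intro le) auto
  qed
  then show False using deriv_Psi_pos[OF A] M by simp
qed

lemma exp_times_sinh: "exp x * sinh y = (exp (x + y) - exp (x - y)) / (2::real)"
  by (simp add: sinh_field_def right_diff_distrib mult_exp_exp)

text \<open>Multiplying the exponential into sinh joins half sums and half differences into full
  exponents: the first numerator becomes (exp b - exp (- x0)) / 2, so everything is rational in A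
  and p.\<close>

lemma exit_probability_odds:
  fixes A p :: real
  assumes "0 < A" "A < 1 / 2" "0 < p" "p < 1"
  defines "b \<equiv> ln ((1 - A) / A)" and "x0 \<equiv> ln (p / (1 - p))"
  shows "exp ((b - x0) / 2) * (sinh ((b + x0) / 2) / sinh b) = (1 - A) * (p - A) / ((1 - 2 * A) * p)"
    and "exp (- ((b - x0) / 2)) * (sinh ((b + x0) / 2) / sinh b) = A * (p - A) / ((1 - 2 * A) * (1 - p))"
proof -
  have e: "exp b = (1 - A) / A" "exp (- b) = A / (1 - A)" "exp x0 = p / (1 - p)" "exp (- x0) = (1 - p) / p"
    using assms by (auto simp: b_def x0_def exp_minus)
  have d: "(1 - A) / A - A / (1 - A) = (1 - 2 * A) / (A * (1 - A))"
    using assms by (simp add: field_simps)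
  have "exp ((b - x0) / 2) * sinh ((b + x0) / 2) = (exp b - exp (- x0)) / 2"
    unfolding exp_times_sinh by (simp add: add_divide_distrib diff_divide_distrib)
  also have "exp b - exp (- x0) = (p - A) / (A * p)"
    unfolding e using assms by (simp add: field_simps)
  finally have n1: "exp ((b - x0) / 2) * sinh ((b + x0) / 2) = (p - A) / (A * p) / 2" .
  have "exp (- ((b - x0) / 2)) * sinh ((b + x0) / 2) = (exp x0 - exp (- b)) / 2"
    unfolding exp_times_sinh by (simp add: add_divide_distrib diff_divide_distrib)
  also have "exp x0 - exp (- b) = (p - A) / ((1 - p) * (1 - A))"
    unfolding e using assms by (simp add: field_simps)
  finally have n2: "exp (- ((b - x0) / 2)) * sinh ((b + x0) / 2) = (p - A) / ((1 - p) * (1 - A)) / 2" .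
  have s: "sinh b = (1 - 2 * A) / (A * (1 - A)) / 2"
    unfolding sinh_field_def e d ..
  show "exp ((b - x0) / 2) * (sinh ((b + x0) / 2) / sinh b) = (1 - A) * (p - A) / ((1 - 2 * A) * p)"
    unfolding times_divide_eq_right n1 s using assms by (simp add: divide_simps)
  show "exp (- ((b - x0) / 2)) * (sinh ((b + x0) / 2) / sinh b) = A * (p - A) / ((1 - 2 * A) * (1 - p))"
    unfolding times_divide_eq_right n2 s using assms by (simp add: divide_simps)
qed

text \<open>Each exponential times sinh splits into two products of powers of R and r. The shifts by
  1/2 in the exponents stem from the drift weights in front of sinh.\<close>

lemma laplace_transform_powr:
  fixes R r \<beta> :: real
  assumes R: "0 < R" and r: "0 < r"
  defines "b \<equiv> ln R" and "x0 \<equiv> ln r"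
  shows "exp ((b - x0) / 2) * (sinh (\<beta> * (b + x0)) / sinh (2 * \<beta> * b)) + exp (- ((b + x0) / 2)) * (sinh (\<beta> * (b - x0)) / sinh (2 * \<beta> * b))
    = ((R powr (\<beta> - 1/2) - R powr (- \<beta> + 1/2)) * r powr (- \<beta> - 1/2)
           + (R powr (\<beta> + 1/2) - R powr (- \<beta> - 1/2)) * r powr (\<beta> - 1/2))
          / (R powr (2 * \<beta>) - R powr (- 2 * \<beta>))" (is "?l1 = ?r1")
    and "exp (- ((b - x0) / 2)) * (sinh (\<beta> * (b + x0)) / sinh (2 * \<beta> * b)) + exp ((b + x0) / 2) * (sinh (\<beta> * (b - x0)) / sinh (2 * \<beta> * b))
    = ((R powr (\<beta> + 1/2) - R powr (- \<beta> - 1/2)) * r powr (- \<beta> + 1/2)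
           + (R powr (\<beta> - 1/2) - R powr (- \<beta> + 1/2)) * r powr (\<beta> + 1/2))
          / (R powr (2 * \<beta>) - R powr (- 2 * \<beta>))" (is "?l2 = ?r2")
proof -
  have powr: "R powr z = exp (z * b)" "r powr z = exp (z * x0)" for z
    using R r by (simp_all add: powr_def b_def x0_def)
  have s: "sinh (2 * \<beta> * b) = (R powr (2 * \<beta>) - R powr (- 2 * \<beta>)) / 2"
    unfolding powr sinh_field_def by simp
  have half: "x / 2 + y / 2 = (x + y) / 2" "x / 2 / (y / 2) = x / y" for x y :: real
    by (simp_all add: add_divide_distrib)
  have prods:
    "R powr (\<beta> + 1/2) * r powr (\<beta> - 1/2) = exp ((b - x0) / 2 + \<beta> * (b + x0))"
    "R powr (- \<beta> + 1/2) * r powr (- \<beta> - 1/2) = exp ((b - x0) / 2 - \<beta> * (b + x0))"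
    "R powr (\<beta> - 1/2) * r powr (- \<beta> - 1/2) = exp (- ((b + x0) / 2) + \<beta> * (b - x0))"
    "R powr (- \<beta> - 1/2) * r powr (\<beta> - 1/2) = exp (- ((b + x0) / 2) - \<beta> * (b - x0))"
    "R powr (\<beta> - 1/2) * r powr (\<beta> + 1/2) = exp (- ((b - x0) / 2) + \<beta> * (b + x0))"
    "R powr (- \<beta> - 1/2) * r powr (- \<beta> + 1/2) = exp (- ((b - x0) / 2) - \<beta> * (b + x0))"
    "R powr (\<beta> + 1/2) * r powr (- \<beta> + 1/2) = exp ((b + x0) / 2 + \<beta> * (b - x0))"
    "R powr (- \<beta> + 1/2) * r powr (\<beta> + 1/2) = exp ((b + x0) / 2 - \<beta> * (b - x0))"
    unfolding powr mult_exp_exp by (rule arg_cong[where f=exp], simp add: field_simps)+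
  have "?l1 = (exp ((b - x0) / 2) * sinh (\<beta> * (b + x0)) + exp (- ((b + x0) / 2)) * sinh (\<beta> * (b - x0))) / sinh (2 * \<beta> * b)"
    by (simp add: add_divide_distrib)
  also have "exp ((b - x0) / 2) * sinh (\<beta> * (b + x0)) + exp (- ((b + x0) / 2)) * sinh (\<beta> * (b - x0))
    = ((R powr (\<beta> - 1/2) - R powr (- \<beta> + 1/2)) * r powr (- \<beta> - 1/2)
           + (R powr (\<beta> + 1/2) - R powr (- \<beta> - 1/2)) * r powr (\<beta> - 1/2)) / 2"
    unfolding exp_times_sinh half left_diff_distrib prods by simp
  finally show "?l1 = ?r1" unfolding s half .
  have "?l2 = (exp (- ((b - x0) / 2)) * sinh (\<beta> * (b + x0)) + exp ((b + x0) / 2) * sinh (\<beta> * (b - x0))) / sinh (2 * \<beta> * b)"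
    by (simp add: add_divide_distrib)
  also have "exp (- ((b - x0) / 2)) * sinh (\<beta> * (b + x0)) + exp ((b + x0) / 2) * sinh (\<beta> * (b - x0))
    = ((R powr (\<beta> + 1/2) - R powr (- \<beta> - 1/2)) * r powr (- \<beta> + 1/2)
           + (R powr (\<beta> - 1/2) - R powr (- \<beta> + 1/2)) * r powr (\<beta> + 1/2)) / 2"
    unfolding exp_times_sinh half left_diff_distrib prods by simp
  finally show "?l2 = ?r2" unfolding s half .
qed

section \<open>Continuous modification and independence\<close>

text \<open>Setting the paths to 0 on the exceptional null set keeps them adapted, because the usual
  conditions put null sets into \<open>F 0\<close>. The natural filtration of the modification thus
  lies inside F, and independence of increments is inherited.\<close>

lemma continuous_modification:
  assumes P: "prob_space P" and F: "usual_filtration P F" and W: "standard_brownian_motion P F W"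
  obtains W' where "brownian_motion P W'" "AE \<omega> in P. \<forall>t\<ge>0. W' t \<omega> = W t \<omega>"
proof -
  interpret prob_space P by fact
  from F[unfolded usual_filtration_def] have subalgs: "\<forall>t\<ge>0. subalgebra P (F t)"
    and increasing: "\<forall>s t. 0 \<le> s \<longrightarrow> s \<le> t \<longrightarrow> sets (F s) \<subseteq> sets (F t)"
    and nulls: "null_sets P \<subseteq> sets (F 0)"
    by - (elim conjE, assumption)+
  from W[unfolded standard_brownian_motion_def] have adapted: "\<forall>t\<ge>0. W t \<in> borel_measurable (F t)"
    and AE0: "AE \<omega> in P. W 0 \<omega> = 0" "AE \<omega> in P. continuous_on {0..} (\<lambda>t. W t \<omega>)"
    and increments: "\<forall>s t. 0 \<le> s \<longrightarrow> s < t \<longrightarrow>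
        distributed P lborel (\<lambda>\<omega>. W t \<omega> - W s \<omega>) (\<lambda>x. ennreal (normal_density 0 (sqrt (t - s)) x)) \<and>
        indep_set (sets (F s)) (sets (vimage_algebra (space P) (\<lambda>\<omega>. W t \<omega> - W s \<omega>) borel))"
    by - (elim conjE, assumption)+
  from AE0 have "AE \<omega> in P. W 0 \<omega> = 0 \<and> continuous_on {0..} (\<lambda>t. W t \<omega>)" by (rule AE_conjI)
  then obtain Z where Z: "\<And>\<omega>. \<omega> \<in> space P - Z \<Longrightarrow> W 0 \<omega> = 0 \<and> continuous_on {0..} (\<lambda>t. W t \<omega>)" "Z \<in> null_sets P"
    by (rule AE_E3) blast
  \<comment> \<open>The value 0 at negative times gives measurability at every real index, as the
    locale demands.\<close>
  define W' where "W' t \<omega> = (if 0 \<le> t \<and> \<omega> \<notin> Z then W t \<omega> else 0)" for t \<omega>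
  have subalg: "subalgebra P (F t)" if "0 \<le> t" for t
    using subalgs that by simp
  have F_mono: "sets (F s) \<subseteq> sets (F t)" if "0 \<le> s" "s \<le> t" for s t
    using increasing that by blast
  have Z_F: "Z \<in> sets (F t)" if "0 \<le> t" for t
  proof -
    from Z(2) nulls F_mono[OF order_refl that] show ?thesis by blast
  qed
  have W_F: "W t \<in> borel_measurable (F t)" if "0 \<le> t" for t
    using adapted that by simp
  have space_F: "space (F t) = space P" if "0 \<le> t" for t
    using subalg[OF that] by (simp add: subalgebra_def)
  have W'_F: "W' s \<in> borel_measurable (F t)" if st: "0 \<le> s" "s \<le> t" for s t
  proof -
    have t: "0 \<le> t" using st by simp
    have [measurable]: "W s \<in> borel_measurable (F t)"
      using F_mono[OF st] space_F[OF st(1)] space_F[OF t]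
      by (intro measurable_from_subalg[OF _ W_F[OF st(1)]]) (simp add: subalgebra_def)
    note [measurable] = Z_F[OF t]
    show ?thesis unfolding W'_def by measurable
  qed
  have W'_AE: "AE \<omega> in P. \<forall>t\<ge>0. W' t \<omega> = W t \<omega>"
    using AE_not_in[OF Z(2)] by eventually_elim (simp add: W'_def)
  have "brownian_motion P W'"
  proof (intro brownian_motion.intro brownian_motion_axioms.intro)
    show "W' t \<in> borel_measurable P" for t
    proof (cases "0 \<le> t")
      case True
      then show ?thesis by (intro measurable_from_subalg[OF subalg W'_F[OF _ order_refl]])
    next
      case False
      then have "W' t = (\<lambda>_. 0)" by (simp add: W'_def fun_eq_iff)
      then show ?thesis by simp
    qed
    show "W' 0 \<omega> = 0" if "\<omega> \<in> space P" for \<omega>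
      using that Z(1)[of \<omega>] by (auto simp: W'_def)
    show "continuous_on {0..} (\<lambda>t. W' t \<omega>)" if "\<omega> \<in> space P" for \<omega>
    proof (cases "\<omega> \<in> Z")
      case False
      then have "continuous_on {0..} (\<lambda>t. W t \<omega>)" using Z(1)[of \<omega>] that by blast
      then show ?thesis
        by (rule continuous_on_eq) (simp add: W'_def False)
    qed (simp add: W'_def)
    fix s t :: real and A and B :: "real set"
    assume st: "0 \<le> s" "s < t" and A: "A \<in> sets (natural_filtration P W' s)" and B: "B \<in> sets borel"
    have A_F: "A \<in> sets (F s)"
      using st by (intro subsetD[OF sets_natural_filtration_le[of "F s" P s W'] A]) (auto simp: space_F W'_F)
    have t: "0 \<le> t" using st by simp
    have WP: "W r \<in> borel_measurable P" if "0 \<le> r" for r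
      by (rule measurable_from_subalg[OF subalg[OF that] W_F[OF that]])
    note [measurable] = WP[OF st(1)] WP[OF t]
    have A_P [measurable]: "A \<in> sets P" using A_F subalg[OF st(1)] by (auto simp: subalgebra_def)
    have W'P: "W' r \<in> borel_measurable P" if "0 \<le> r" for r
      using that by (intro measurable_from_subalg[OF subalg W'_F[OF _ order_refl]])
    note [measurable] = W'P[OF st(1)] W'P[OF t]
    let ?D = "\<lambda>\<omega>. W t \<omega> - W s \<omega>"
    have dist: "distributed P lborel ?D (\<lambda>x. ennreal (normal_density 0 (sqrt (t - s)) x))"
      and ind: "indep_set (sets (F s)) (sets (vimage_algebra (space P) ?D borel))"
      using increments st by simp_all
    have D_sets: "?D -` B \<inter> space P \<in> sets (vimage_algebra (space P) ?D borel)"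
      using B by (intro in_vimage_algebra) auto
    have "emeasure P (A \<inter> ((\<lambda>\<omega>. W' t \<omega> - W' s \<omega>) -` B \<inter> space P)) = emeasure P (A \<inter> (?D -` B \<inter> space P))"
    proof (rule emeasure_eq_AE)
      show "AE \<omega> in P. \<omega> \<in> A \<inter> ((\<lambda>\<omega>. W' t \<omega> - W' s \<omega>) -` B \<inter> space P) \<longleftrightarrow> \<omega> \<in> A \<inter> (?D -` B \<inter> space P)"
        using W'_AE by eventually_elim (use st in auto)
    qed (use B in measurable)
    also have "\<dots> = emeasure P A * emeasure P (?D -` B \<inter> space P)"
      using indep_setD[OF ind A_F D_sets] by (simp add: emeasure_eq_measure ennreal_mult'')
    also have "emeasure P (?D -` B \<inter> space P) = emeasure (distr P lborel ?D) B"
      using B by (simp add: emeasure_distr)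
    also have "distr P lborel ?D = density lborel (normal_density 0 (sqrt (t - s)))"
      using dist by (simp add: distributed_def)
    finally show "emeasure P (A \<inter> ((\<lambda>\<omega>. W' t \<omega> - W' s \<omega>) -` B \<inter> space P))
      = emeasure P A * emeasure (density lborel (normal_density 0 (sqrt (t - s)))) B" .
  qed unfold_locales
  then show ?thesis using W'_AE by (rule that)
qed

text \<open>Independence is given for the whole path of the original process. A path event up to s
  is an event of the whole path by restriction, and passing to the modification changes it only on a
  null set.\<close>

lemma (in brownian_motion) independent_path:
  fixes \<theta> :: "'a \<Rightarrow> real"
  assumes \<theta>: "\<theta> \<in> borel_measurable N"
    and W0 [measurable]: "\<And>t. 0 \<le> t \<Longrightarrow> W0 t \<in> borel_measurable N"
    and W0_eq: "AE \<omega> in N. \<forall>t\<ge>0. W t \<omega> = W0 t \<omega>"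
    and ind: "indep_set (sets (vimage_algebra (space N) \<theta> borel))
          (sets (vimage_algebra (space N) (\<lambda>\<omega>. \<lambda>t\<in>{0..}. W0 t \<omega>) (Pi\<^sub>M {0..} (\<lambda>_. borel))))"
    and s: "0 \<le> s" and A [measurable]: "A \<in> sets (paths s)"
  shows "emeasure N ({\<omega> \<in> space N. \<theta> \<omega> = i} \<inter> (path s -` A \<inter> space N))
    = emeasure N {\<omega> \<in> space N. \<theta> \<omega> = i} * emeasure N (path s -` A \<inter> space N)"
proof -
  note [measurable] = \<theta>
  let ?w = "\<lambda>\<omega>. \<lambda>t\<in>{0..}. W0 t \<omega>"
  let ?PI = "Pi\<^sub>M {0..} (\<lambda>_. borel :: real measure)"
  have w_meas [measurable]: "?w \<in> measurable N ?PI"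
    by (intro measurable_restrict) (auto intro: W0)
  define C where "C = {x \<in> space ?PI. restrict x {0..s} \<in> A}"
  have [measurable]: "(\<lambda>x. restrict x {0..s}) \<in> measurable ?PI (paths s)"
    by (intro measurable_restrict_subset) auto
  have C [measurable]: "C \<in> sets ?PI" unfolding C_def by measurable
  let ?E = "?w -` C \<inter> space N"
  have w_space: "?w \<in> space N \<rightarrow> space ?PI" by (auto simp: space_PiM)
  have E_sets: "?E \<in> sets (vimage_algebra (space N) ?w ?PI)"
    by (rule in_vimage_algebra[OF C])
  have h_sets: "{\<omega> \<in> space N. \<theta> \<omega> = i} \<in> sets (vimage_algebra (space N) \<theta> borel)"
  proof -
    have eq: "{\<omega> \<in> space N. \<theta> \<omega> = i} = \<theta> -` {i} \<inter> space N" by auto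
    show ?thesis unfolding eq by (rule in_vimage_algebra) simp
  qed
  have eq: "AE \<omega> in N. \<omega> \<in> path s -` A \<inter> space N \<longleftrightarrow> \<omega> \<in> ?E"
    using W0_eq AE_space
  proof eventually_elim
    case (elim \<omega>)
    have "restrict (?w \<omega>) {0..s} = path s \<omega>" using elim(1) by (auto simp: path_def fun_eq_iff)
    then show ?case using elim(2) w_space by (auto simp: C_def)
  qed
  have "emeasure N ({\<omega> \<in> space N. \<theta> \<omega> = i} \<inter> (path s -` A \<inter> space N)) = emeasure N ({\<omega> \<in> space N. \<theta> \<omega> = i} \<inter> ?E)"
    by (rule emeasure_eq_AE) (use eq in \<open>auto elim: eventually_mono\<close>)
  also have "\<dots> = emeasure N {\<omega> \<in> space N. \<theta> \<omega> = i} * emeasure N ?E"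
    using indep_setD[OF ind h_sets E_sets] by (simp add: emeasure_eq_measure ennreal_mult'')
  also have "emeasure N ?E = emeasure N (path s -` A \<inter> space N)"
    by (rule emeasure_eq_AE) (use eq in \<open>auto elim: eventually_mono\<close>)
  finally show ?thesis .
qed

context signal_observation
begin

text \<open>Q is not assumed measurable; completeness makes its part on the hypothesis an
  event.\<close>

lemma cond_prob_given:
  assumes i: "i = 0 \<or> i = 1" and complete: "complete_measure N"
    and E: "E \<in> sets N" and eq: "AE \<omega> in given N \<theta> i. Q \<omega> \<longleftrightarrow> \<omega> \<in> E"
  shows "\<P>(\<omega> in N. Q \<omega> \<bar> \<theta> \<omega> = i) = measure (given N \<theta> i) E"
proof -
  interpret complete_measure N by fact
  have ae: "AE \<omega> in N. \<omega> \<in> {\<omega> \<in> space N. Q \<omega> \<and> \<theta> \<omega> = i} \<longleftrightarrow> \<omega> \<in> hyp i \<inter> E"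
    using eq[unfolded AE_given[OF i]] AE_space by eventually_elim auto
  have "{\<omega> \<in> space N. Q \<omega> \<and> \<theta> \<omega> = i} \<in> sets N"
    by (rule sets_of_AE[OF _ _ ae]) (use E in auto)
  then have "prob {\<omega> \<in> space N. Q \<omega> \<and> \<theta> \<omega> = i} = prob (hyp i \<inter> E)"
    using E by (intro finite_measure_eq_AE[OF ae]) auto
  moreover have "measure (given N \<theta> i) E = prob (hyp i \<inter> E) / prob (hyp i)"
    unfolding given_def using emeasure_hyp_nonzero[OF i] E by (intro measure_uniform_measure) auto
  ultimately show ?thesis by (simp add: cond_prob_def)
qed

lemma drifted_given:
  assumes "i = 0 \<or> i = 1" "u \<noteq> 0" "\<epsilon> = 1 \<or> \<epsilon> = - 1" "\<bar>x0\<bar> < b"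
  shows "drifted_brownian_motion (given N \<theta> i) W x0 u \<epsilon> b"
  using assms brownian_motion_given[of i]
  by (intro drifted_brownian_motion.intro drifted_brownian_motion_axioms.intro)

end

section \<open>Conditional laws of the decision and of the stopping time\<close>

theorem proposition5p1:
  fixes P :: "'a measure" and F :: "real \<Rightarrow> 'a measure"
    and \<theta> :: "'a \<Rightarrow> real" and W :: "real \<Rightarrow> 'a \<Rightarrow> real" and post :: "real \<Rightarrow> 'a \<Rightarrow> real"
    and U D :: "real set" and \<phi> \<eta> h g :: "real \<Rightarrow> real" and L :: "real \<Rightarrow> real \<Rightarrow> real"
    and p c u M A R r :: real
    and X :: "real \<Rightarrow> 'a \<Rightarrow> real" and \<tau> :: "'a \<Rightarrow> ennreal" and d :: "'a \<Rightarrow> real"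
    and \<beta> :: "real \<Rightarrow> real"
  defines "X \<equiv> \<lambda>t \<omega>. \<theta> \<omega> * u * t + W t \<omega>"
    and "\<eta> \<equiv> \<lambda>v. (\<phi> v + c) / v\<^sup>2"
    and "M \<equiv> (INF v\<in>U. \<eta> v)"
    and "g \<equiv> \<lambda>q. expected_loss L q (h q)"
    and "\<tau> \<equiv> exit_time post A"
    and "d \<equiv> decision h post A"
    and "R \<equiv> (1 - A) / A"
    and "r \<equiv> p / (1 - p)"
    and "\<beta> \<equiv> \<lambda>\<alpha>. sqrt (2 * \<alpha> / u\<^sup>2 + 1 / 4)"
  \<comment> \<open>probabilistic setting\<close>
  assumes "prob_space P" and "usual_filtration P F"
    and "\<theta> \<in> borel_measurable P"
    and "0 < p" and "p < 1"
    and "\<P>(\<omega> in P. \<theta> \<omega> = 1) = p" and "\<P>(\<omega> in P. \<theta> \<omega> = 0) = 1 - p"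
    and "standard_brownian_motion P F W"
    and "prob_space.indep_set P (sets (vimage_algebra (space P) \<theta> borel))
          (sets (vimage_algebra (space P) (\<lambda>\<omega>. \<lambda>t\<in>{0..}. W t \<omega>) (Pi\<^sub>M {0..} (\<lambda>_. borel))))"
    and "posterior_process P \<theta> X post"
  \<comment> \<open>control problem\<close>
    and "U \<subseteq> UNIV - {0}" and "U \<noteq> {}" and "U \<in> sets borel"
    and "\<phi> \<in> borel_measurable (restrict_space borel U)"
    and "0 < c"
    and "is_arg_min \<eta> (\<lambda>v. v \<in> U) u"
    and "0 < M"
  \<comment> \<open>loss and decision rule\<close>
    and "D \<subseteq> {0..1}" and "compact D"
    and "\<And>x y. x \<in> {0, 1} \<Longrightarrow> y \<in> {0..1} \<Longrightarrow> 0 \<le> L x y \<and> (L x y = 0 \<longleftrightarrow> x = y)"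
    and "\<And>x. x \<in> {0, 1} \<Longrightarrow> continuous_on D (L x)"
    and "h \<in> borel_measurable (restrict_space borel {0..1})"
    and "\<And>q. q \<in> {0..1} \<Longrightarrow> is_arg_min (expected_loss L q) (\<lambda>y. y \<in> D) (h q)"
    and "\<And>q. q \<in> {0..1} \<Longrightarrow> g (1 - q) = g q"
    and "concave_on {0..1} g" and "g 0 = 0" and "g 1 = 0"
    and "(\<exists>\<kappa>>0. \<forall>q\<in>{0..1}. g q = \<kappa> * min q (1 - q)) \<or>
         (C2_on {0<..<1} g \<and>
          strict_antimono_on {0<..<1/2} (\<lambda>q. q\<^sup>2 * (1 - q)\<^sup>2 * deriv (deriv g) q) \<and>
          strict_mono_on {1/2<..<1} (\<lambda>q. q\<^sup>2 * (1 - q)\<^sup>2 * deriv (deriv g) q))"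
  \<comment> \<open>boundary\<close>
    and "A \<in> boundary_solutions g M" and "\<And>x. x \<in> boundary_solutions g M \<Longrightarrow> A \<le> x"
    and "A < 1 / 2"
    and "A < p" and "p < 1 - A"
  shows
    "(AE \<omega> in P. d \<omega> \<in> {h A, h (1 - A)}) \<and>
     \<P>(\<omega> in P. d \<omega> = h (1 - A) \<bar> \<theta> \<omega> = 1) = (1 - A) * (p - A) / ((1 - 2 * A) * p) \<and>
     \<P>(\<omega> in P. d \<omega> = h (1 - A) \<bar> \<theta> \<omega> = 0) = A * (p - A) / ((1 - 2 * A) * (1 - p)) \<and>
     has_mean (given P \<theta> 1) \<tau>
       (2 / u\<^sup>2 * (2 * ln ((1 - A) / A) * ((1 - A) * (p - A) / ((1 - 2 * A) * p))
                  - ln ((1 - A) * p / (A * (1 - p))))) \<and>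
     has_mean (given P \<theta> 0) \<tau>
       (2 / u\<^sup>2 * (ln ((1 - A) * p / (A * (1 - p)))
                  - 2 * ln ((1 - A) / A) * (A * (p - A) / ((1 - 2 * A) * (1 - p))))) \<and>
     (\<forall>\<alpha>>0.
        (\<integral> \<omega>. exp_neg \<alpha> (\<tau> \<omega>) \<partial>given P \<theta> 1) =
          ((R powr (\<beta> \<alpha> - 1/2) - R powr (- \<beta> \<alpha> + 1/2)) * r powr (- \<beta> \<alpha> - 1/2)
           + (R powr (\<beta> \<alpha> + 1/2) - R powr (- \<beta> \<alpha> - 1/2)) * r powr (\<beta> \<alpha> - 1/2))
          / (R powr (2 * \<beta> \<alpha>) - R powr (- 2 * \<beta> \<alpha>)) \<and>
        (\<integral> \<omega>. exp_neg \<alpha> (\<tau> \<omega>) \<partial>given P \<theta> 0) =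
          ((R powr (\<beta> \<alpha> + 1/2) - R powr (- \<beta> \<alpha> - 1/2)) * r powr (- \<beta> \<alpha> + 1/2)
           + (R powr (\<beta> \<alpha> - 1/2) - R powr (- \<beta> \<alpha> + 1/2)) * r powr (\<beta> \<alpha> + 1/2))
          / (R powr (2 * \<beta> \<alpha>) - R powr (- 2 * \<beta> \<alpha>))) \<and>
     has_density_on_pos (given P \<theta> 1) \<tau>
       (\<lambda>t. exp (- (u\<^sup>2 * t / 8)) *
            (sqrt (A * (1 - p) / ((1 - A) * p)) * image_series u R r t
             + sqrt ((1 - A) * (1 - p) / (A * p)) * image_series u R (1 / r) t)) \<and>
     has_density_on_pos (given P \<theta> 0) \<tau>
       (\<lambda>t. exp (- (u\<^sup>2 * t / 8)) *
            (sqrt ((1 - A) * p / (A * (1 - p))) * image_series u R r t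
             + sqrt (A * p / ((1 - A) * (1 - p))) * image_series u R (1 / r) t))"
proof -
  interpret P: prob_space P by fact
  have complete_P: "complete_measure P"
    using \<open>usual_filtration P F\<close> unfolding usual_filtration_def by (rule conjunct1)
  interpret complete_measure P by fact
  have A: "0 < A" "A < 1 / 2" and g_deriv: "(g has_real_derivative 2 * M * deriv Psi A) (at A)"
    using \<open>A \<in> boundary_solutions g M\<close> \<open>A < 1 / 2\<close> by (simp_all add: boundary_solutions_def)
  have u: "u \<noteq> 0"
    using \<open>is_arg_min \<eta> (\<lambda>v. v \<in> U) u\<close> \<open>U \<subseteq> UNIV - {0}\<close> by (auto simp: is_arg_min_def)
  have p: "0 < p" "p < 1" by fact+
  have h_ne: "h A \<noteq> h (1 - A)"
  proof (rule decisions_distinct[OF A \<open>0 < M\<close> g_deriv[unfolded g_def]])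
    show "is_arg_min (expected_loss L q) (\<lambda>y. y \<in> D) (h q)" if "q \<in> {0..1}" for q
      using that by fact
    have "A \<in> {0..1}" using A by simp
    from \<open>\<And>q. q \<in> {0..1} \<Longrightarrow> g (1 - q) = g q\<close>[OF this]
    show "expected_loss L (1 - A) (h (1 - A)) = expected_loss L A (h A)" by (simp add: g_def)
  qed
  obtain W' where W': "brownian_motion P W'" and W'_eq: "AE \<omega> in P. \<forall>t\<ge>0. W' t \<omega> = W t \<omega>"
    using continuous_modification[OF \<open>prob_space P\<close> \<open>usual_filtration P F\<close> \<open>standard_brownian_motion P F W\<close>] by blast
  have W_P: "W t \<in> borel_measurable P" if "0 \<le> t" for t
  proof -
    have "W t \<in> borel_measurable (F t)"
      using \<open>standard_brownian_motion P F W\<close> that unfolding standard_brownian_motion_def by (elim conjE) simp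
    moreover from \<open>usual_filtration P F\<close> have "\<forall>t\<ge>0. subalgebra P (F t)"
      unfolding usual_filtration_def by (elim conjE)
    ultimately show ?thesis using that by (auto intro: measurable_from_subalg)
  qed
  have ind: "P.indep_set (sets (vimage_algebra (space P) \<theta> borel))
      (sets (vimage_algebra (space P) (\<lambda>\<omega>. \<lambda>t\<in>{0..}. W t \<omega>) (Pi\<^sub>M {0..} (\<lambda>_. borel))))"
    by fact
  interpret S: signal_observation P W' \<theta> p u
  proof (intro signal_observation.intro signal_observation_axioms.intro W' p)
    show "emeasure P ({\<omega> \<in> space P. \<theta> \<omega> = i} \<inter> (brownian_motion.path W' s -` B \<inter> space P))
        = emeasure P {\<omega> \<in> space P. \<theta> \<omega> = i} * emeasure P (brownian_motion.path W' s -` B \<inter> space P)"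
      if "0 \<le> s" "B \<in> sets (Pi\<^sub>M {0..s} (\<lambda>_. borel))" for i s B
      by (rule brownian_motion.independent_path[OF W' \<open>\<theta> \<in> borel_measurable P\<close> _ W'_eq ind])
        (auto intro: W_P that)
  qed fact+
  define b where "b = ln ((1 - A) / A)"
  define x0 where "x0 = ln (p / (1 - p))"
  have R: "0 < R" "ln R = b" "exp b = R" using A by (auto simp: R_def b_def)
  have r: "0 < r" "ln r = x0" "exp x0 = r" "exp (- x0) = 1 / r"
    using p by (auto simp: r_def x0_def exp_minus)
  have b_logistic: "logistic b = 1 - A"
    using logistic_ln_odds[of "1 - A"] A by (simp add: b_def)
  have x0: "\<bar>x0\<bar> < b"
  proof -
    have "logistic (- b) = A" "logistic x0 = p"
      using b_logistic logistic_ln_odds[OF p] by (simp_all add: logistic_minus x0_def)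
    then have "- b < x0" "x0 < b"
      using \<open>A < p\<close> \<open>p < 1 - A\<close> b_logistic logistic_less[of "- b" x0] logistic_less[of x0 b] by simp_all
    then show ?thesis by (simp add: abs_less_iff)
  qed
  \<comment> \<open>On \<theta> = 1 the observation contributes u^2 t to u X, which against the
    correction - u^2 t / 2 leaves drift u^2 / 2; on \<theta> = 0 only the correction remains. Hence
    the signs 1 and - 1.\<close>
  interpret D1: drifted_brownian_motion "given P \<theta> 1" W' x0 u 1 b
    by (rule S.drifted_given) (use u x0 in auto)
  interpret D0: drifted_brownian_motion "given P \<theta> 0" W' x0 u "- 1" b
    by (rule S.drifted_given) (use u x0 in auto)
  have post: "AE \<omega> in P. \<forall>t\<ge>0. post t \<omega> = S.bayes t (S.obs t \<omega>)"
  proof (rule S.posterior_eq[OF \<open>posterior_process P \<theta> X post\<close>])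
    show "X t \<in> borel_measurable P" if "0 \<le> t" for t
      unfolding X_def using that W_P \<open>\<theta> \<in> borel_measurable P\<close> by measurable
    show "AE \<omega> in P. \<forall>t\<ge>0. X t \<omega> = S.obs t \<omega>"
      using W'_eq by eventually_elim (simp add: X_def S.obs_def)
  qed
  have post1: "AE \<omega> in given P \<theta> 1. \<forall>t\<ge>0. post t \<omega> = logistic (D1.L t \<omega>)"
    unfolding S.AE_given[OF disjI2[OF refl]] using post
  proof eventually_elim
    case (elim \<omega>)
    then show ?case
      by (simp add: S.bayes_logistic S.obs_def D1.L_def logistic_eq power2_eq_square field_simps flip: x0_def)
  qed
  have post0: "AE \<omega> in given P \<theta> 0. \<forall>t\<ge>0. post t \<omega> = logistic (D0.L t \<omega>)"
    unfolding S.AE_given[OF disjI1[OF refl]] using post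
  proof eventually_elim
    case (elim \<omega>)
    then show ?case
      by (simp add: S.bayes_logistic S.obs_def D0.L_def logistic_eq power2_eq_square field_simps flip: x0_def)
  qed
  have \<tau>1: "AE \<omega> in given P \<theta> 1. \<tau> \<omega> = D1.T \<omega>" and \<tau>0: "AE \<omega> in given P \<theta> 0. \<tau> \<omega> = D0.T \<omega>"
    unfolding \<tau>_def by (rule D1.exit_time_eq[OF b_logistic post1] D0.exit_time_eq[OF b_logistic post0])+
  \<comment> \<open>As an infimum over uncountably many times of a process continuous only almost
    surely, \<tau> is not visibly measurable. It agrees almost surely with the exit times of the two
    drifted motions glued along \<theta>, and completeness does the rest.\<close>
  have \<tau>_P: "\<tau> \<in> borel_measurable P"
  proof (rule borel_measurable_of_AE)
    have [measurable]: "D1.T \<in> borel_measurable P" "D0.T \<in> borel_measurable P" "\<theta> \<in> borel_measurable P"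
      using D1.T_measurable D0.T_measurable \<open>\<theta> \<in> borel_measurable P\<close>
      by (simp_all cong: measurable_cong_sets)
    show "(\<lambda>\<omega>. if \<theta> \<omega> = 1 then D1.T \<omega> else D0.T \<omega>) \<in> borel_measurable P" by measurable
    show "AE \<omega> in P. \<tau> \<omega> = (if \<theta> \<omega> = 1 then D1.T \<omega> else D0.T \<omega>)"
      using \<tau>1[unfolded S.AE_given[OF disjI2[OF refl]]] \<tau>0[unfolded S.AE_given[OF disjI1[OF refl]]] S.AE_hyp
      by eventually_elim auto
  qed
  have \<tau>_given: "\<tau> \<in> borel_measurable (given P \<theta> i)" for i
    using \<tau>_P by (simp cong: measurable_cong_sets)
  have d1: "AE \<omega> in given P \<theta> 1. d \<omega> \<in> {h A, h (1 - A)} \<and> (d \<omega> = h (1 - A) \<longleftrightarrow> \<omega> \<in> D1.exits_at b)"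
    unfolding d_def by (rule D1.decision_eq[OF b_logistic post1 h_ne])
  have d0: "AE \<omega> in given P \<theta> 0. d \<omega> \<in> {h A, h (1 - A)} \<and> (d \<omega> = h (1 - A) \<longleftrightarrow> \<omega> \<in> D0.exits_at b)"
    unfolding d_def by (rule D0.decision_eq[OF b_logistic post0 h_ne])
  have q1: "measure (given P \<theta> 1) (D1.exits_at b) = (1 - A) * (p - A) / ((1 - 2 * A) * p)"
    using D1.prob_exits_at_b exit_probability_odds(1)[OF A p] by (simp add: b_def x0_def)
  have q0: "measure (given P \<theta> 0) (D0.exits_at b) = A * (p - A) / ((1 - 2 * A) * (1 - p))"
    using D0.prob_exits_at_b exit_probability_odds(2)[OF A p]
    by (simp add: minus_divide_left b_def x0_def)
  have bx: "ln ((1 - A) * p / (A * (1 - p))) = b + x0"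
  proof -
    have "(1 - A) * p / (A * (1 - p)) = exp (b + x0)"
      unfolding exp_add R r by (simp add: R_def r_def)
    then show ?thesis by simp
  qed
  have sqrt_exp: "sqrt (exp z) = exp (z / 2)" for z :: real
    by (rule real_sqrt_unique) (simp_all add: power2_eq_square mult_exp_exp)
  \<comment> \<open>In terms of b = ln R and x0 = ln r, the square roots of the statement become the
    drift weights at the two ends of the interval.\<close>
  have odds: "A * (1 - p) / ((1 - A) * p) = exp (- (b + x0))" "(1 - A) * (1 - p) / (A * p) = exp (b - x0)"
    "(1 - A) * p / (A * (1 - p)) = exp (b + x0)" "A * p / ((1 - A) * (1 - p)) = exp (- (b - x0))"
    unfolding exp_minus exp_add exp_diff R r using A p by (simp_all add: R_def r_def)
  \<comment> \<open>The factors 1 and - 1 are spelled out to match the density lemma at \<epsilon> =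
    1 and \<epsilon> = - 1.\<close>
  have halves: "- (b + x0) / 2 = - (1 * (b + x0) / 2)" "(b - x0) / 2 = 1 * (b - x0) / 2"
    "(b + x0) / 2 = - (- 1 * (b + x0) / 2)" "- (b - x0) / 2 = - 1 * (b - x0) / 2"
    by (simp_all add: field_simps)
  show ?thesis
  proof (intro conjI allI impI)
    show "AE \<omega> in P. d \<omega> \<in> {h A, h (1 - A)}"
      using d1[unfolded S.AE_given[OF disjI2[OF refl]]] d0[unfolded S.AE_given[OF disjI1[OF refl]]] S.AE_hyp
      by eventually_elim auto
    have "D1.exits_at b \<in> sets P" "D0.exits_at b \<in> sets P"
      using D1.exits_at_sets[of b] D0.exits_at_sets[of b] by simp_all
    then show "\<P>(\<omega> in P. d \<omega> = h (1 - A) \<bar> \<theta> \<omega> = 1) = (1 - A) * (p - A) / ((1 - 2 * A) * p)"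
      "\<P>(\<omega> in P. d \<omega> = h (1 - A) \<bar> \<theta> \<omega> = 0) = A * (p - A) / ((1 - 2 * A) * (1 - p))"
      unfolding q1[symmetric] q0[symmetric]
      using d1 d0 by (auto intro!: S.cond_prob_given complete_P elim: eventually_mono)
    show "has_mean (given P \<theta> 1) \<tau>
       (2 / u\<^sup>2 * (2 * ln ((1 - A) / A) * ((1 - A) * (p - A) / ((1 - 2 * A) * p))
                  - ln ((1 - A) * p / (A * (1 - p)))))"
      unfolding bx q1[symmetric] b_def[symmetric]
      by (rule has_mean_cong_AE[OF _ \<tau>_given \<tau>1]) (use D1.T_has_mean in simp)
    have "has_mean (given P \<theta> 0) \<tau> (- 1 * (2 / u\<^sup>2) * (2 * b * measure (given P \<theta> 0) (D0.exits_at b) - (b + x0)))"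
      by (rule has_mean_cong_AE[OF D0.T_has_mean \<tau>_given \<tau>0])
    also have "- 1 * (2 / u\<^sup>2) * (2 * b * measure (given P \<theta> 0) (D0.exits_at b) - (b + x0))
      = 2 / u\<^sup>2 * ((b + x0) - 2 * b * measure (given P \<theta> 0) (D0.exits_at b))"
      by (simp add: algebra_simps)
    finally show "has_mean (given P \<theta> 0) \<tau>
       (2 / u\<^sup>2 * (ln ((1 - A) * p / (A * (1 - p)))
                  - 2 * ln ((1 - A) / A) * (A * (p - A) / ((1 - 2 * A) * (1 - p)))))"
      unfolding bx q0[symmetric] b_def[symmetric] .
  next
    fix \<alpha> :: real assume \<alpha>: "0 < \<alpha>"
    have "(\<integral> \<omega>. exp_neg \<alpha> (\<tau> \<omega>) \<partial>given P \<theta> 1) = (\<integral> \<omega>. exp_neg \<alpha> (D1.T \<omega>) \<partial>given P \<theta> 1)"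
      using \<tau>1 by (intro integral_cong_AE measurable_compose[OF \<tau>_given] measurable_compose[OF D1.T_measurable])
        (auto elim: eventually_mono)
    also have "\<dots> = exp ((b - x0) / 2) * (sinh (\<beta> \<alpha> * (b + x0)) / sinh (2 * \<beta> \<alpha> * b)) + exp (- ((b + x0) / 2)) * (sinh (\<beta> \<alpha> * (b - x0)) / sinh (2 * \<beta> \<alpha> * b))"
      unfolding D1.expectation_exp_neg[OF \<alpha>] D1.exit_transform_eq[OF \<alpha>] \<beta>_def by simp
    also note laplace_transform_powr(1)[OF R(1) r(1), of "\<beta> \<alpha>", unfolded R(2) r(2)]
    finally show "(\<integral> \<omega>. exp_neg \<alpha> (\<tau> \<omega>) \<partial>given P \<theta> 1) =
          ((R powr (\<beta> \<alpha> - 1/2) - R powr (- \<beta> \<alpha> + 1/2)) * r powr (- \<beta> \<alpha> - 1/2)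
           + (R powr (\<beta> \<alpha> + 1/2) - R powr (- \<beta> \<alpha> - 1/2)) * r powr (\<beta> \<alpha> - 1/2))
          / (R powr (2 * \<beta> \<alpha>) - R powr (- 2 * \<beta> \<alpha>))" .
    have "(\<integral> \<omega>. exp_neg \<alpha> (\<tau> \<omega>) \<partial>given P \<theta> 0) = (\<integral> \<omega>. exp_neg \<alpha> (D0.T \<omega>) \<partial>given P \<theta> 0)"
      using \<tau>0 by (intro integral_cong_AE measurable_compose[OF \<tau>_given] measurable_compose[OF D0.T_measurable])
        (auto elim: eventually_mono)
    also have "\<dots> = exp (- ((b - x0) / 2)) * (sinh (\<beta> \<alpha> * (b + x0)) / sinh (2 * \<beta> \<alpha> * b)) + exp ((b + x0) / 2) * (sinh (\<beta> \<alpha> * (b - x0)) / sinh (2 * \<beta> \<alpha> * b))"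
      unfolding D0.expectation_exp_neg[OF \<alpha>] D0.exit_transform_eq[OF \<alpha>] \<beta>_def
      by (simp add: minus_divide_left add.commute)
    also note laplace_transform_powr(2)[OF R(1) r(1), of "\<beta> \<alpha>", unfolded R(2) r(2)]
    finally show "(\<integral> \<omega>. exp_neg \<alpha> (\<tau> \<omega>) \<partial>given P \<theta> 0) =
          ((R powr (\<beta> \<alpha> + 1/2) - R powr (- \<beta> \<alpha> - 1/2)) * r powr (- \<beta> \<alpha> + 1/2)
           + (R powr (\<beta> \<alpha> - 1/2) - R powr (- \<beta> \<alpha> + 1/2)) * r powr (\<beta> \<alpha> + 1/2))
          / (R powr (2 * \<beta> \<alpha>) - R powr (- 2 * \<beta> \<alpha>))" .
  next
    show "has_density_on_pos (given P \<theta> 1) \<tau>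
       (\<lambda>t. exp (- (u\<^sup>2 * t / 8)) *
            (sqrt (A * (1 - p) / ((1 - A) * p)) * image_series u R r t
             + sqrt ((1 - A) * (1 - p) / (A * p)) * image_series u R (1 / r) t))"
      \<comment> \<open>The term 1 / r has to become exp (- x0) before r itself is replaced, as
        otherwise it would turn into 1 / exp x0.\<close>
      unfolding odds sqrt_exp halves(1,2) R(3)[symmetric] r(4)[symmetric]
      unfolding r(3)[symmetric]
      by (rule has_density_on_pos_cong_AE[OF D1.T_has_density \<tau>_given \<tau>1])
    show "has_density_on_pos (given P \<theta> 0) \<tau>
       (\<lambda>t. exp (- (u\<^sup>2 * t / 8)) *
            (sqrt ((1 - A) * p / (A * (1 - p))) * image_series u R r t
             + sqrt (A * p / ((1 - A) * (1 - p))) * image_series u R (1 / r) t))"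
      unfolding odds sqrt_exp halves(3,4) R(3)[symmetric] r(4)[symmetric]
      unfolding r(3)[symmetric]
      by (rule has_density_on_pos_cong_AE[OF D0.T_has_density \<tau>_given \<tau>0])
  qed
qed

end
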